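(* There is an algorithm that decides, in time linear in the size of a given finite simple graph $G$, whether $G$ is D3-reducible.
   Context: All graphs are finite and simple. The D3 reductions are the following two operations on a graph $G$. (D3a) Let $p,q,r$ be three vertices of degree three that induce a triangle in $G$ and whose neighbors outside $\{p,q,r\}$ are three distinct vertices; replace $p,q,r$ by a single new vertex adjacent to exactly those three outside neighbors. (D3b) Let $p,q,r$ be three vertices of degree three that induce a path with middle vertex $q$ (so $p,r$ are nonadjacent), and suppose there is a single vertex $s$ adjacent to all three of $p,q,r$; delete $q$ and add a new edge from $p$ to $r$. A graph is D3-reducible if it can be transformed into a graph isomorphic to the complete graph $K_4$ by a finite sequence of D3 reductions. *)

theory Defs
  imports Main
begin

section \<open>Simple graphs\<close>

type_synonym 'a ugraph = "'a set \<times> 'a set set"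

definition verts :: "'a ugraph \<Rightarrow> 'a set" where
  "verts G = fst G"

definition edges :: "'a ugraph \<Rightarrow> 'a set set" where
  "edges G = snd G"

definition simple_graph :: "'a ugraph \<Rightarrow> bool" where
  "simple_graph G \<longleftrightarrow> finite (verts G) \<and> (\<forall>e \<in> edges G. e \<subseteq> verts G \<and> card e = 2)"

definition adj :: "'a ugraph \<Rightarrow> 'a \<Rightarrow> 'a \<Rightarrow> bool" where
  "adj G u v \<longleftrightarrow> {u, v} \<in> edges G"

definition nbrs :: "'a ugraph \<Rightarrow> 'a \<Rightarrow> 'a set" where
  "nbrs G v = {u. adj G v u}"

definition degree :: "'a ugraph \<Rightarrow> 'a \<Rightarrow> nat" where
  "degree G v = card (nbrs G v)"

definition complete_graph :: "nat \<Rightarrow> nat ugraph" where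
  "complete_graph n = ({..<n}, {e. e \<subseteq> {..<n} \<and> card e = 2})"

definition isomorphic :: "'a ugraph \<Rightarrow> 'b ugraph \<Rightarrow> bool" where
  "isomorphic G H \<longleftrightarrow>
     (\<exists>f. bij_betw f (verts G) (verts H) \<and> edges H = (\<lambda>e. f ` e) ` edges G)"

definition graph_size :: "'a ugraph \<Rightarrow> nat" where
  "graph_size G = card (verts G) + card (edges G)"


section \<open>D3 reductions\<close>

text \<open>
  In \<open>D3a\<close>, each of \<open>p\<close>, \<open>q\<close>, \<open>r\<close> has exactly one neighbor outside the triangle, so \<open>card S = 3\<close>
  says that these three outside neighbors are distinct. In both reductions the distinctness of
  vertices known to be adjacent is implied for simple graphs.
\<close>

definition D3a :: "'a ugraph \<Rightarrow> 'a ugraph \<Rightarrow> bool" where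
  "D3a G H \<longleftrightarrow>
     (\<exists>p q r w. let T = {p, q, r}; S = (nbrs G p \<union> nbrs G q \<union> nbrs G r) - T in
        T \<subseteq> verts G \<and>
        degree G p = 3 \<and> degree G q = 3 \<and> degree G r = 3 \<and>
        adj G p q \<and> adj G q r \<and> adj G p r \<and>
        card S = 3 \<and>
        w \<notin> verts G \<and>
        H = (insert w (verts G - T),
             {e \<in> edges G. e \<inter> T = {}} \<union> {{w, x} | x. x \<in> S}))"

definition D3b :: "'a ugraph \<Rightarrow> 'a ugraph \<Rightarrow> bool" where
  "D3b G H \<longleftrightarrow>
     (\<exists>p q r s. {p, q, r, s} \<subseteq> verts G \<and> p \<noteq> r \<and>
        degree G p = 3 \<and> degree G q = 3 \<and> degree G r = 3 \<and>
        adj G p q \<and> adj G q r \<and> \<not> adj G p r \<and>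
        adj G s p \<and> adj G s q \<and> adj G s r \<and>
        H = (verts G - {q}, {e \<in> edges G. q \<notin> e} \<union> {{p, r}}))"

definition D3_step :: "'a ugraph \<Rightarrow> 'a ugraph \<Rightarrow> bool" where
  "D3_step G H \<longleftrightarrow> D3a G H \<or> D3b G H"

definition D3_reducible :: "'a ugraph \<Rightarrow> bool" where
  "D3_reducible G \<longleftrightarrow> (\<exists>H. D3_step\<^sup>*\<^sup>* G H \<and> isomorphic H (complete_graph 4))"


section \<open>Random access machines\<close>

text \<open>
  Algorithms are structured programs for a word RAM: finitely many registers, a memory of words
  with indirect addressing, and unit cost for each elementary instruction and each evaluation of a
  test. The parameter \<open>W\<close> of the semantics bounds the numbers that fit into a word. A run that
  would overflow a word is stuck, so it does not count as an execution. Only \<open>Const\<close> and \<open>Add\<close>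
  need an overflow check, since every other instruction stores a number no larger than one already
  held in a register or in memory. Subtraction is truncated at zero.
\<close>

type_synonym reg = nat

datatype test = Less reg reg | Equal reg reg

datatype prog =
    Skip
  | Const reg nat
  | Copy reg reg
  | Add reg reg reg
  | Sub reg reg reg
  | Load reg reg
  | Store reg reg
  | Seq prog prog
  | If test prog prog
  | While test prog

type_synonym state = "(reg \<Rightarrow> nat) \<times> (nat \<Rightarrow> nat)"

fun holds :: "test \<Rightarrow> state \<Rightarrow> bool" where
  "holds (Less i j) (R, M) \<longleftrightarrow> R i < R j"
| "holds (Equal i j) (R, M) \<longleftrightarrow> R i = R j"

text \<open>\<open>exec W P s t s'\<close>: started in \<open>s\<close>, the program \<open>P\<close> halts in \<open>s'\<close> after \<open>t\<close> time units.\<close>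

inductive exec :: "nat \<Rightarrow> prog \<Rightarrow> state \<Rightarrow> nat \<Rightarrow> state \<Rightarrow> bool" for W where
  Skip: "exec W Skip s 1 s"
| Const: "a < W \<Longrightarrow> exec W (Const i a) (R, M) 1 (R(i := a), M)"
| Copy: "exec W (Copy i j) (R, M) 1 (R(i := R j), M)"
| Add: "R j + R k < W \<Longrightarrow> exec W (Add i j k) (R, M) 1 (R(i := R j + R k), M)"
| Sub: "exec W (Sub i j k) (R, M) 1 (R(i := R j - R k), M)"
| Load: "exec W (Load i j) (R, M) 1 (R(i := M (R j)), M)"
| Store: "exec W (Store i j) (R, M) 1 (R, M(R i := R j))"
| Seq: "exec W P s t s' \<Longrightarrow> exec W Q s' u s'' \<Longrightarrow> exec W (Seq P Q) s (t + u) s''"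
| If_true: "holds b s \<Longrightarrow> exec W P s t s' \<Longrightarrow> exec W (If b P Q) s (1 + t) s'"
| If_false: "\<not> holds b s \<Longrightarrow> exec W Q s t s' \<Longrightarrow> exec W (If b P Q) s (1 + t) s'"
| While_true: "holds b s \<Longrightarrow> exec W P s t s' \<Longrightarrow> exec W (While b P) s' u s'' \<Longrightarrow>
    exec W (While b P) s (1 + t + u) s''"
| While_false: "\<not> holds b s \<Longrightarrow> exec W (While b P) s 1 s"

text \<open>Execution is deterministic, so the outcome and the running time are unique when they exist.\<close>

inductive_cases exec_simpleE:
  "exec W Skip s t s'" "exec W (Const i a) s t s'" "exec W (Copy i j) s t s'"
  "exec W (Add i j k) s t s'" "exec W (Sub i j k) s t s'" "exec W (Load i j) s t s'"
  "exec W (Store i j) s t s'"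
inductive_cases exec_SeqE: "exec W (Seq P Q) s t s'"
inductive_cases exec_IfE: "exec W (If b P Q) s t s'"
inductive_cases exec_WhileE: "exec W (While b P) s t s'"

lemma exec_deterministic:
  "exec W P s t s' \<Longrightarrow> exec W P s u s'' \<Longrightarrow> u = t \<and> s'' = s'"
proof (induction arbitrary: u s'' rule: exec.induct)
  case (Seq P s t s' Q v s2)
  from Seq.prems obtain t' r v' where *: "exec W P s t' r" "exec W Q r v' s''" "u = t' + v'"
    by (rule exec_SeqE)
  from Seq.IH(1)[OF *(1)] have "t' = t" "r = s'" by simp_all
  with Seq.IH(2)[of v' s''] * show ?case by simp
next
  case (If_true b s P t s' Q)
  from If_true.prems If_true.hyps(1) obtain t' where *: "exec W P s t' s''" "u = 1 + t'"
    by (auto elim: exec_IfE)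
  with If_true.IH[OF *(1)] show ?case by simp
next
  case (If_false b s Q t s' P)
  from If_false.prems If_false.hyps(1) obtain t' where *: "exec W Q s t' s''" "u = 1 + t'"
    by (auto elim: exec_IfE)
  with If_false.IH[OF *(1)] show ?case by simp
next
  case (While_true b s P t s' v s2)
  from While_true.prems obtain t' r v'
    where *: "exec W P s t' r" "exec W (While b P) r v' s''" "u = 1 + t' + v'"
    by (rule exec_WhileE) (use While_true.hyps in auto)
  from While_true.IH(1)[OF *(1)] have "t' = t" "r = s'" by simp_all
  with While_true.IH(2)[of v' s''] * show ?case by simp
next
  case (While_false b s P)
  from While_false.prems show ?case
    by (rule exec_WhileE) (use While_false.hyps in auto)
qed (auto elim: exec_simpleE)


section \<open>Deciding graph properties in linear time\<close>

text \<open>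
  A graph with vertices \<open>0, \<dots>, n - 1\<close> is presented by \<open>n\<close>, the number of edges, and the endpoints
  of its edges, where each edge is listed once, in arbitrary order and orientation.
\<close>

definition edge_list :: "'a ugraph \<Rightarrow> ('a \<times> 'a) list \<Rightarrow> bool" where
  "edge_list G es \<longleftrightarrow>
     distinct (map (\<lambda>(u, v). {u, v}) es) \<and> set (map (\<lambda>(u, v). {u, v}) es) = edges G"

definition input_words :: "nat \<Rightarrow> (nat \<times> nat) list \<Rightarrow> nat list" where
  "input_words n es = n # length es # concat (map (\<lambda>(u, v). [u, v]) es)"

definition initial_state :: "nat list \<Rightarrow> state" where
  "initial_state ws = ((\<lambda>_. 0), (\<lambda>i. if i < length ws then ws ! i else 0))"

text \<open>
  The word bound \<open>(size + 2) ^ k\<close> amounts to words of \<open>O(log size)\<close> bits. The constants \<open>c\<close>, \<open>k\<close>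
  depend only on the program. The answer is returned in register \<open>0\<close>.
\<close>

definition decides_in_linear_time :: "prog \<Rightarrow> (nat ugraph \<Rightarrow> bool) \<Rightarrow> bool" where
  "decides_in_linear_time P Q \<longleftrightarrow>
     (\<exists>c k. \<forall>G n es. simple_graph G \<and> verts G = {..<n} \<and> edge_list G es \<longrightarrow>
        (\<exists>t R M. exec ((graph_size G + 2) ^ k) P (initial_state (input_words n es)) t (R, M) \<and>
           t \<le> c * (graph_size G + 1) \<and>
           R 0 = (if Q G then 1 else 0)))"

end

theory Submission
  imports Defs "HOL-Combinatorics.Transposition"
begin

text \<open>
  On finite simple graphs the D3 reductions are locally confluent up to isomorphism, and they remove
  vertices. By Newman's argument a graph is D3-reducible iff some, equivalently any, greedily chosen
  maximal sequence of reductions ends in \<open>K\<^sub>4\<close>. Whether a reduction can be anchored at a vertex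
  depends only on the neighbour sets of this vertex and of its neighbours of degree three. So it
  suffices to keep a stack of candidate vertices and, after a reduction, to push the at most three
  vertices whose neighbour sets changed, together with their neighbours, provided that their degree is
  three. At most twelve vertices are pushed per removed vertex, which bounds the number of iterations
  by \<open>14 n\<close>. The memory is zero initially, so an \<open>n \<times> n\<close> table of positions in neighbour lists costs
  no set-up time and makes every list update a constant number of instructions.
\<close>

section \<open>Graphs as neighbour functions\<close>

text \<open>Confluence holds only up to isomorphism because some reductions destroy each other. When
  two edges join two reducible triangles, contracting one leaves the other with two equal outside
  neighbours; and D3b patterns can overlap so that the middle vertex of one is an end or the hub
  \<open>s\<close> of the other. In every such conflict the two results are isomorphic, by
  exchanging one or two pairs of vertices, so no peak needs more than one further step on each side.
  The induction also uses that K4 admits no reduction: a reducible graph with an available step must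
  succeed through some step. The fresh vertex of D3a is a second obstacle. In memory the contracted
  triangle keeps the name of a corner, so the relation \<open>step\<close> matches
  \<open>D3_step\<close> only up to a transposition. The machine has no multiplication, hence the
  stored row addresses. Termination and time both come from the potential
  \<open>13 * |V| + h\<close>, where \<open>h\<close> is the stack height: it pays for pushes and
  pops alike.\<close>

definition gmap :: "('a \<Rightarrow> 'b) \<Rightarrow> 'a ugraph \<Rightarrow> 'b ugraph" where
  "gmap f G = (f ` verts G, (\<lambda>e. f ` e) ` edges G)"

lemma adj_gmap: "bij f \<Longrightarrow> adj (gmap f G) (f u) (f v) = adj G u v"
proof -
  assume f: "bij f"
  have "{f u, f v} = f ` e \<longleftrightarrow> {u,v} = e" for e
    using f inj_image_eq_iff[of f "{u,v}" e] by (simp add: bij_def)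
  thus ?thesis unfolding adj_def gmap_def edges_def snd_conv image_iff by metis
qed

lemma nbrs_gmap: "bij f \<Longrightarrow> nbrs (gmap f G) (f u) = f ` nbrs G u"
proof -
  assume f: "bij f"
  show ?thesis
  proof (intro set_eqI)
    fix w obtain v where w: "w = f v" using f by (metis bij_pointE)
    show "w \<in> nbrs (gmap f G) (f u) \<longleftrightarrow> w \<in> f ` nbrs G u"
      using f by (auto simp: w nbrs_def adj_gmap bij_def dest: injD)
  qed
qed

lemma degree_gmap: "bij f \<Longrightarrow> degree (gmap f G) (f u) = degree G u"
  by (simp add: degree_def nbrs_gmap card_image bij_def inj_on_def)

lemma verts_gmap: "verts (gmap f G) = f ` verts G"
  by (simp add: gmap_def verts_def)

lemma edges_gmap: "edges (gmap f G) = (\<lambda>e. f ` e) ` edges G"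
  by (simp add: gmap_def edges_def)

lemma gmap_comp: "gmap f (gmap g G) = gmap (f \<circ> g) G"
  by (simp add: gmap_def verts_def edges_def image_comp o_def)

lemma gmap_id: "gmap id G = G"
  by (simp add: gmap_def verts_def edges_def)

lemma D3a_gmap:
  assumes f: "bij f" and s: "D3a G H"
  shows "D3a (gmap f G) (gmap f H)"
proof -
  have inj: "inj f" using f by (simp add: bij_def)
  note im = inj_image_mem_iff[OF inj] image_set_diff[OF inj]
  from s obtain p q r w where *: "{p,q,r} \<subseteq> verts G"
    "degree G p = 3" "degree G q = 3" "degree G r = 3" "adj G p q" "adj G q r" "adj G p r"
    "card ((nbrs G p \<union> nbrs G q \<union> nbrs G r) - {p,q,r}) = 3" "w \<notin> verts G"
    and H: "H = (insert w (verts G - {p,q,r}), {e \<in> edges G. e \<inter> {p,q,r} = {}} \<union>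
        {{w, x} | x. x \<in> (nbrs G p \<union> nbrs G q \<union> nbrs G r) - {p,q,r}})"
    unfolding D3a_def Let_def by blast
  have S: "(nbrs (gmap f G) (f p) \<union> nbrs (gmap f G) (f q) \<union> nbrs (gmap f G) (f r)) - {f p, f q, f r}
     = f ` ((nbrs G p \<union> nbrs G q \<union> nbrs G r) - {p,q,r})"
    by (simp add: nbrs_gmap[OF f] im image_Un)
  have e1: "f ` e \<inter> {f p, f q, f r} = {} \<longleftrightarrow> e \<inter> {p,q,r} = {}" for e
    using inj by (auto dest: injD)
  have e2: "(\<lambda>e. f ` e) ` {e \<in> edges G. e \<inter> {p,q,r} = {}}
     = {e \<in> (\<lambda>e. f ` e) ` edges G. e \<inter> {f p, f q, f r} = {}}"
    using e1 by (auto simp only: image_iff mem_Collect_eq)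
  have e3: "(\<lambda>e. f ` e) ` {{w, x} | x. x \<in> A} = {{f w, x} | x. x \<in> f ` A}" for A
  proof -
    have "{{w, x} | x. x \<in> A} = (\<lambda>x. {w,x}) ` A" by blast
    moreover have "{{f w, x} | x. x \<in> f ` A} = (\<lambda>x. {f w,x}) ` (f ` A)" by blast
    ultimately show ?thesis by (simp add: image_image)
  qed
  have "gmap f H = (insert (f w) (verts (gmap f G) - {f p, f q, f r}),
     {e \<in> edges (gmap f G). e \<inter> {f p, f q, f r} = {}} \<union>
      {{f w, x} | x. x \<in> (nbrs (gmap f G) (f p) \<union> nbrs (gmap f G) (f q) \<union> nbrs (gmap f G) (f r)) - {f p, f q, f r}})"
    unfolding S verts_gmap edges_gmap
    by (simp only: H gmap_def verts_def edges_def fst_conv snd_conv image_Un e3 e2[unfolded edges_def])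
      (simp add: im)
  moreover have "card (f ` ((nbrs G p \<union> nbrs G q \<union> nbrs G r) - {p,q,r})) = 3"
    using *(8) inj by (subst card_image) (auto simp: inj_on_def)
  ultimately have res: "gmap f H = (insert (f w) (verts (gmap f G) - {f p, f q, f r}),
     {e \<in> edges (gmap f G). e \<inter> {f p, f q, f r} = {}} \<union>
      {{f w, x} | x. x \<in> (nbrs (gmap f G) (f p) \<union> nbrs (gmap f G) (f q) \<union> nbrs (gmap f G) (f r)) - {f p, f q, f r}})"
    "card (f ` ((nbrs G p \<union> nbrs G q \<union> nbrs G r) - {p,q,r})) = 3" by simp_all
  show ?thesis
    unfolding D3a_def Let_def
    apply (rule exI[of _ "f p"], rule exI[of _ "f q"], rule exI[of _ "f r"], rule exI[of _ "f w"])
    using * res by (simp only: S degree_gmap[OF f] adj_gmap[OF f]) (simp add: verts_gmap im)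
qed

lemma D3b_gmap:
  assumes f: "bij f" and s: "D3b G H"
  shows "D3b (gmap f G) (gmap f H)"
proof -
  have inj: "inj f" using f by (simp add: bij_def)
  note im = inj_image_mem_iff[OF inj] image_set_diff[OF inj] inj_eq[OF inj]
  from s obtain p q r s where *: "{p, q, r, s} \<subseteq> verts G" "p \<noteq> r"
        "degree G p = 3" "degree G q = 3" "degree G r = 3"
        "adj G p q" "adj G q r" "\<not> adj G p r"
        "adj G s p" "adj G s q" "adj G s r"
    and H: "H = (verts G - {q}, {e \<in> edges G. q \<notin> e} \<union> {{p, r}})"
    unfolding D3b_def by blast
  have e2: "(\<lambda>e. f ` e) ` {e \<in> edges G. q \<notin> e} = {e \<in> (\<lambda>e. f ` e) ` edges G. f q \<notin> e}"
    by (auto simp: im)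
  have res: "gmap f H = (verts (gmap f G) - {f q}, {e \<in> edges (gmap f G). f q \<notin> e} \<union> {{f p, f r}})"
    unfolding verts_gmap edges_gmap
    by (simp only: H gmap_def verts_def edges_def fst_conv snd_conv image_Un e2[unfolded edges_def])
      (simp add: im)
  show ?thesis
    unfolding D3b_def
    apply (rule exI[of _ "f p"], rule exI[of _ "f q"], rule exI[of _ "f r"], rule exI[of _ "f s"])
    using * res by (simp only: degree_gmap[OF f] adj_gmap[OF f]) (auto simp: verts_gmap im)
qed

lemma D3_steps_gmap:
  assumes f: "bij f" shows "D3_step\<^sup>*\<^sup>* G H \<Longrightarrow> D3_step\<^sup>*\<^sup>* (gmap f G) (gmap f H)"
proof (induction rule: rtranclp_induct)
  case (step H K)
  then have "D3_step (gmap f H) (gmap f K)"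
    using D3a_gmap[OF f] D3b_gmap[OF f] unfolding D3_step_def by blast
  with step.IH show ?case by simp
qed simp

lemma isomorphic_gmap:
  assumes f: "bij f" and "isomorphic G K" shows "isomorphic (gmap f G) K"
proof -
  from assms obtain g where g: "bij_betw g (verts G) (verts K)" "edges K = (\<lambda>e. g ` e) ` edges G"
    unfolding isomorphic_def by blast
  have "bij_betw (inv f) (f ` verts G) (verts G)"
    using f by (simp add: bij_betw_def bij_def inj_on_def image_comp)
  hence "bij_betw (g \<circ> inv f) (verts (gmap f G)) (verts K)"
    using g(1) by (simp add: verts_gmap bij_betw_trans)
  moreover have "edges K = (\<lambda>e. (g \<circ> inv f) ` e) ` edges (gmap f G)"
    using f by (simp add: g(2) edges_gmap image_image bij_def image_comp o_def)
  ultimately show ?thesis unfolding isomorphic_def by blast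
qed

text \<open>Transport of reductions gives one implication; applying it to \<open>inv f\<close> gives
  the other.\<close>

lemma D3_reducible_gmap:
  fixes f :: "'a \<Rightarrow> 'a"
  assumes f: "bij f" shows "D3_reducible (gmap f G) = D3_reducible G"
proof -
  have *: "D3_reducible (gmap g H)" if "bij g" "D3_reducible H" for g :: "'a \<Rightarrow> 'a" and H
    using that D3_steps_gmap isomorphic_gmap unfolding D3_reducible_def by blast
  have "inv f \<circ> f = id" using f by (simp add: bij_def)
  hence "gmap (inv f) (gmap f G) = G" by (simp add: gmap_comp gmap_id)
  thus ?thesis using *[of f G] *[of "inv f" "gmap f G"] f by (auto simp: bij_imp_bij_inv)
qed

section \<open>Well-formed neighbour functions and their isomorphisms\<close>

type_synonym 'a ngraph = "'a set \<times> ('a \<Rightarrow> 'a set)"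

definition ugraph_of :: "'a ngraph \<Rightarrow> 'a ugraph" where
  "ugraph_of S = (fst S, {{u, v} | u v. v \<in> snd S u})"

text \<open>Together with symmetry, the inclusion forces empty neighbour sets outside the vertex
  set. Results of different reductions can therefore be compared by equality of functions.\<close>

definition wf_ngraph :: "'a ngraph \<Rightarrow> bool" where
  "wf_ngraph S \<longleftrightarrow> finite (fst S) \<and> (\<forall>v. snd S v \<subseteq> fst S - {v}) \<and> (\<forall>u v. v \<in> snd S u \<longrightarrow> u \<in> snd S v)"

lemma wf_ngraphD:
  assumes "wf_ngraph S"
  shows "finite (fst S)" "v \<in> snd S u \<Longrightarrow> v \<in> fst S" "v \<in> snd S u \<Longrightarrow> u \<in> snd S v" "v \<notin> snd S v"
  using assms unfolding wf_ngraph_def by blast+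

lemma verts_ugraph_of [simp]: "verts (ugraph_of S) = fst S"
  by (simp add: ugraph_of_def verts_def)

lemma adj_ugraph_of: "wf_ngraph S \<Longrightarrow> adj (ugraph_of S) u v \<longleftrightarrow> v \<in> snd S u"
  by (auto simp: wf_ngraph_def adj_def ugraph_of_def edges_def doubleton_eq_iff)

lemma nbrs_ugraph_of: "wf_ngraph S \<Longrightarrow> nbrs (ugraph_of S) u = snd S u"
  by (auto simp: nbrs_def adj_ugraph_of)

lemma simple_ugraph_of: "wf_ngraph S \<Longrightarrow> simple_graph (ugraph_of S)"
proof -
  assume w: "wf_ngraph S"
  have "e \<subseteq> fst S \<and> card e = 2" if e: "e \<in> edges (ugraph_of S)" for e
  proof -
    obtain u v where uv: "e = {u,v}" "v \<in> snd S u"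
      using e by (auto simp: edges_def ugraph_of_def)
    moreover have "u \<in> snd S v" using uv w by (simp add: wf_ngraph_def)
    moreover have "snd S u \<subseteq> fst S - {u}" "snd S v \<subseteq> fst S - {v}"
      using w by (auto simp: wf_ngraph_def)
    ultimately have "u \<noteq> v" "u \<in> fst S" "v \<in> fst S" by auto
    with \<open>e = {u,v}\<close> show ?thesis by simp
  qed
  thus ?thesis using w by (simp add: simple_graph_def wf_ngraph_def)
qed

lemma ugraph_of_nbrs:
  assumes "simple_graph G" shows "ugraph_of (verts G, nbrs G) = G" "wf_ngraph (verts G, nbrs G)"
proof -
  have *: "\<exists>u v. e = {u, v} \<and> u \<noteq> v \<and> u \<in> verts G \<and> v \<in> verts G" if "e \<in> edges G" for e
    using assms that unfolding simple_graph_def card_2_iff by (metis insert_subset)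
  have "{{u, v} | u v. v \<in> nbrs G u} = edges G"
  proof
    show "edges G \<subseteq> {{u, v} | u v. v \<in> nbrs G u}"
    proof
      fix e assume e: "e \<in> edges G"
      then obtain u v where "e = {u,v}" using * by blast
      with e show "e \<in> {{u, v} | u v. v \<in> nbrs G u}" unfolding nbrs_def adj_def by blast
    qed
  qed (auto simp: nbrs_def adj_def)
  thus "ugraph_of (verts G, nbrs G) = G" by (simp add: ugraph_of_def verts_def edges_def)
  have "v \<in> verts G \<and> v \<noteq> u" if "{u,v} \<in> edges G" for u v
    using *[OF that] by (auto simp: doubleton_eq_iff)
  thus "wf_ngraph (verts G, nbrs G)"
    using assms by (auto simp: wf_ngraph_def simple_graph_def nbrs_def adj_def insert_commute)
qed

text \<open>The bijection acts on the whole type instead of between vertex sets, so composition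
  needs no side conditions. The concrete isomorphisms below are transpositions and products of
  them.\<close>

definition ngraph_iso :: "'a ngraph \<Rightarrow> 'a ngraph \<Rightarrow> bool" (infix "\<approx>" 50) where
  "S \<approx> T \<longleftrightarrow> (\<exists>f. bij f \<and> fst T = f ` fst S \<and> (\<forall>v. snd T (f v) = f ` snd S v))"

lemma ngraph_isoI:
  assumes "bij f" "fst T = f ` fst S" "\<And>u v. f u \<in> snd T (f v) \<longleftrightarrow> u \<in> snd S v"
  shows "S \<approx> T"
proof -
  have "w \<in> snd T (f v) \<longleftrightarrow> w \<in> f ` snd S v" for v w
  proof -
    obtain u where "w = f u" using assms(1) by (metis bij_pointE)
    thus ?thesis using assms(3)[of u v] assms(1) by (simp add: inj_image_mem_iff bij_is_inj)
  qed
  thus ?thesis using assms unfolding ngraph_iso_def by blast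
qed

lemma ngraph_iso_refl: "S \<approx> S"
  unfolding ngraph_iso_def by (intro exI[of _ id]) simp

lemma ngraph_iso_trans: assumes "S \<approx> T" "T \<approx> U" shows "S \<approx> U"
proof -
  obtain f where f: "bij f" "fst T = f ` fst S" "\<And>v. snd T (f v) = f ` snd S v"
    using assms(1) unfolding ngraph_iso_def by blast
  obtain g where g: "bij g" "fst U = g ` fst T" "\<And>v. snd U (g v) = g ` snd T v"
    using assms(2) unfolding ngraph_iso_def by blast
  show ?thesis using f g unfolding ngraph_iso_def
    by (intro exI[of _ "g \<circ> f"]) (simp add: bij_comp image_comp)
qed

lemma ngraph_iso_ugraph_of:
  assumes "S \<approx> T" shows "\<exists>f. bij f \<and> ugraph_of T = gmap f (ugraph_of S)"
proof -
  obtain f where f: "bij f" "fst T = f ` fst S" "\<And>v. snd T (f v) = f ` snd S v"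
    using assms unfolding ngraph_iso_def by blast
  have "{{u, v} | u v. v \<in> snd T u} = (\<lambda>e. f ` e) ` {{u, v} | u v. v \<in> snd S u}" (is "?A = ?B")
  proof
    show "?A \<subseteq> ?B"
    proof
      fix e assume "e \<in> ?A"
      then obtain u v where e: "e = {u,v}" "v \<in> snd T u" by blast
      obtain u' where u: "u = f u'" using f(1) by (metis bij_pointE)
      with e f(3) obtain v' where "v = f v'" "v' \<in> snd S u'" by auto
      with u e have "e = f ` {u', v'}" "{u', v'} \<in> {{u, v} | u v. v \<in> snd S u}" by auto
      thus "e \<in> ?B" by blast
    qed
    show "?B \<subseteq> ?A"
    proof
      fix e assume "e \<in> ?B"
      then obtain u v where "e = {f u, f v}" "v \<in> snd S u" by auto
      with f(3)[of u] show "e \<in> ?A" by blast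
    qed
  qed
  thus ?thesis using f by (intro exI[of _ f]) (simp add: ugraph_of_def gmap_def verts_def edges_def)
qed

lemma reducible_iso:
  "S \<approx> T \<Longrightarrow> D3_reducible (ugraph_of S) = D3_reducible (ugraph_of T)"
  using ngraph_iso_ugraph_of D3_reducible_gmap by metis

section \<open>The two local patterns and the graphs that they produce\<close>

definition confA :: "('a \<Rightarrow> 'a set) \<Rightarrow> 'a \<Rightarrow> 'a \<Rightarrow> 'a \<Rightarrow> 'a \<Rightarrow> 'a \<Rightarrow> 'a \<Rightarrow> bool" where
  "confA N p q r x y z \<longleftrightarrow> N p = {q, r, x} \<and> N q = {p, r, y} \<and> N r = {p, q, z} \<and>
     distinct [p, q, r, x, y, z]"

text \<open>Only \<open>p\<close>, \<open>q\<close>, \<open>r\<close> have degree three;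
  \<open>s\<close> is arbitrary, and \<open>x = y\<close> is allowed. That \<open>x\<close> is not
  \<open>r\<close> and \<open>y\<close> is not \<open>p\<close> expresses that the ends are
  nonadjacent.\<close>

definition confB :: "('a \<Rightarrow> 'a set) \<Rightarrow> 'a \<Rightarrow> 'a \<Rightarrow> 'a \<Rightarrow> 'a \<Rightarrow> 'a \<Rightarrow> 'a \<Rightarrow> bool" where
  "confB N p q r s x y \<longleftrightarrow> N p = {q, s, x} \<and> N q = {p, r, s} \<and> N r = {q, s, y} \<and>
     distinct [p, q, r, s] \<and> x \<notin> {p, q, r, s} \<and> y \<notin> {p, q, r, s}"

definition merge :: "'a \<Rightarrow> 'a \<Rightarrow> 'a \<Rightarrow> 'a \<Rightarrow> 'a" where
  "merge p q r u = (if u = q \<or> u = r then p else u)"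

text \<open>The vertex that replaces the triangle is called \<open>p\<close> again, instead of a fresh name.\<close>

definition resA :: "'a ngraph \<Rightarrow> 'a \<Rightarrow> 'a \<Rightarrow> 'a \<Rightarrow> 'a \<Rightarrow> 'a \<Rightarrow> 'a \<Rightarrow> 'a ngraph" where
  "resA S p q r x y z = (fst S - {q, r},
     \<lambda>v. if v = p then {x, y, z} else if v = q \<or> v = r then {} else merge p q r ` snd S v)"

definition resB :: "'a ngraph \<Rightarrow> 'a \<Rightarrow> 'a \<Rightarrow> 'a \<Rightarrow> 'a ngraph" where
  "resB S p q r = (fst S - {q},
     \<lambda>v. if v = q then {} else snd S v - {q} \<union> (if v = p then {r} else if v = r then {p} else {}))"

inductive step :: "'a ngraph \<Rightarrow> 'a ngraph \<Rightarrow> bool" where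
  stepA: "confA (snd S) p q r x y z \<Longrightarrow> step S (resA S p q r x y z)"
| stepB: "confB (snd S) p q r s x y \<Longrightarrow> step S (resB S p q r)"

lemma card3_obtain: assumes "card A = 3" "a \<in> A" "b \<in> A" "a \<noteq> b"
  obtains c where "A = {a, b, c}" "c \<noteq> a" "c \<noteq> b"
proof -
  have "card (A - {a,b}) = 1" using assms by (subst card_Diff_subset) auto
  then obtain c where c: "A - {a,b} = {c}" by (auto simp: card_1_singleton_iff)
  then have "A = {a,b,c}" "c \<noteq> a" "c \<noteq> b" using assms by auto
  thus ?thesis by (rule that)
qed

text \<open>Gives adjacency a form symmetric in \<open>u\<close> and \<open>v\<close>, free of the
  image under \<open>merge\<close>. Outside the triangle only \<open>x\<close>, \<open>y\<close>,
  \<open>z\<close> see a corner, so exactly these end up adjacent to \<open>p\<close>.\<close>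

lemma adj_resA:
  assumes "wf_ngraph S" "confA (snd S) p q r x y z"
  shows "u \<in> snd (resA S p q r x y z) v \<longleftrightarrow> (v = p \<and> u \<in> {x,y,z} \<or> u = p \<and> v \<in> {x,y,z} \<or>
      u \<notin> {p,q,r} \<and> v \<notin> {p,q,r} \<and> u \<in> snd S v)"
proof -
  have c: "snd S p = {q, r, x}" "snd S q = {p, r, y}" "snd S r = {p, q, z}" "distinct [p, q, r, x, y, z]"
    using assms(2) by (auto simp: confA_def)
  have i: "u \<in> snd S p \<longleftrightarrow> p \<in> snd S u" "u \<in> snd S q \<longleftrightarrow> q \<in> snd S u" "u \<in> snd S r \<longleftrightarrow> r \<in> snd S u" for u 
    using assms(1) by (auto simp: wf_ngraph_def)
  have j: "p \<in> snd S u \<longleftrightarrow> u \<in> {q,r,x}" "q \<in> snd S u \<longleftrightarrow> u \<in> {p,r,y}" "r \<in> snd S u \<longleftrightarrow> u \<in> {p,q,z}" for u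
    using i c by auto
  show ?thesis
    using j c(4) unfolding resA_def by (auto simp: merge_def image_iff)
qed

lemma wf_resA:
  assumes "wf_ngraph S" "confA (snd S) p q r x y z" shows "wf_ngraph (resA S p q r x y z)"
proof -
  obtain V N where S: "S = (V, N)" by (cases S)
  have w: "finite V" "\<And>v. N v \<subseteq> V - {v}" "\<And>u v. v \<in> N u \<longleftrightarrow> u \<in> N v"
    using assms(1) by (auto simp: wf_ngraph_def S)
  have c: "N p = {q, r, x}" "N q = {p, r, y}" "N r = {p, q, z}" "distinct [p, q, r, x, y, z]"
    using assms(2) by (auto simp: confA_def S)
  have V: "x \<in> V" "y \<in> V" "z \<in> V" "p \<in> V" "q \<in> V" "r \<in> V"
    using w(2)[of p] w(2)[of q] w(2)[of r] c by auto
  define M where "M = snd (resA S p q r x y z)"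
  have M: "u \<in> M v \<longleftrightarrow> (v = p \<and> u \<in> {x,y,z} \<or> u = p \<and> v \<in> {x,y,z} \<or>
      u \<notin> {p,q,r} \<and> v \<notin> {p,q,r} \<and> u \<in> N v)" for u v
    unfolding M_def adj_resA[OF assms] by (simp add: S)
  have "M v \<subseteq> (V - {q,r}) - {v}" for v
    using M V w(2) c(4) by fastforce
  moreover have "u \<in> M v \<longleftrightarrow> v \<in> M u" for u v unfolding M using w(3) by blast
  moreover have "fst (resA S p q r x y z) = V - {q,r}" by (simp add: resA_def S)
  ultimately show ?thesis unfolding wf_ngraph_def using w(1) by (fold M_def) simp
qed

lemma wf_resB:
  assumes "wf_ngraph S" "confB (snd S) p q r s x y" shows "wf_ngraph (resB S p q r)"
proof -
  obtain V N where S: "S = (V, N)" by (cases S)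
  have w: "finite V" "\<And>v. N v \<subseteq> V - {v}" "\<And>u v. v \<in> N u \<longleftrightarrow> u \<in> N v"
    using assms(1) by (auto simp: wf_ngraph_def S)
  have c: "N q = {p, r, s}" "p \<noteq> r" "p \<noteq> q" "r \<noteq> q"
    using assms(2) by (auto simp: confB_def S)
  have V: "p \<in> V" "r \<in> V" using w(2)[of q] c by auto
  define M where "M = snd (resB S p q r)"
  have M: "u \<in> M v \<longleftrightarrow> u \<noteq> q \<and> v \<noteq> q \<and> (u \<in> N v \<or> u = p \<and> v = r \<or> u = r \<and> v = p)" for u v
    using c(2-) unfolding M_def resB_def S by auto
  have "M v \<subseteq> (V - {q}) - {v}" for v
    using M V w(2) c(2-) by fastforce
  moreover have "u \<in> M v \<longleftrightarrow> v \<in> M u" for u v unfolding M using w(3) by blast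
  moreover have "fst (resB S p q r) = V - {q}" by (simp add: resB_def S)
  ultimately show ?thesis unfolding wf_ngraph_def using w(1) by (fold M_def) simp
qed

lemma wf_step: "step S T \<Longrightarrow> wf_ngraph S \<Longrightarrow> wf_ngraph T"
  by (induction rule: step.induct) (auto intro: wf_resA wf_resB)

section \<open>D3 steps as local configurations\<close>

text \<open>Turns the reused corner name \<open>p\<close> into a fresh name \<open>w\<close>, as D3a
  demands.\<close>

definition rename :: "'a \<Rightarrow> 'a \<Rightarrow> 'a ngraph \<Rightarrow> 'a ngraph" where
  "rename p w S = (transpose p w ` fst S, \<lambda>v. transpose p w ` snd S (transpose p w v))"

lemma rename_iso: "S \<approx> rename p w S"
proof -
  have "snd (rename p w S) (transpose p w v) = transpose p w ` snd S v" for v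
    unfolding rename_def snd_conv transpose_involutory by (rule refl)
  moreover have "fst (rename p w S) = transpose p w ` fst S" unfolding rename_def by (rule fst_conv)
  moreover have "bij (transpose p w)" by (rule bij_transpose)
  ultimately show ?thesis unfolding ngraph_iso_def by blast
qed

lemma in_rename: "u \<in> snd (rename p w S) v \<longleftrightarrow> transpose p w u \<in> snd S (transpose p w v)"
proof -
  have "u \<in> transpose p w ` A \<longleftrightarrow> transpose p w u \<in> A" for A
    using inj_image_mem_iff[OF bij_is_inj[OF bij_transpose], of p w "transpose p w u" A] by simp
  thus ?thesis by (simp add: rename_def)
qed

lemma ugraph_of_resA:
  assumes wf: "wf_ngraph S" and c: "confA (snd S) p q r x y z" and w: "w \<notin> fst S"
  shows "ugraph_of (rename p w (resA S p q r x y z)) = (insert w (fst S - {p, q, r}),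
     {e \<in> edges (ugraph_of S). e \<inter> {p, q, r} = {}} \<union> {{w, u} | u. u \<in> {x, y, z}})"
proof -
  have d: "distinct [p,q,r,x,y,z]" using c by (simp add: confA_def)
  have V: "x \<in> fst S" "y \<in> fst S" "z \<in> fst S" "p \<in> fst S" "q \<in> fst S" "r \<in> fst S"
    using wf_ngraphD(2)[OF wf, of _ p] wf_ngraphD(2)[OF wf, of _ q] wf_ngraphD(2)[OF wf, of _ r] c
    unfolding confA_def by auto
  have ne: "w \<noteq> p" "w \<noteq> q" "w \<noteq> r" "w \<noteq> x" "w \<noteq> y" "w \<noteq> z" using V w by auto
  have nw: "w \<notin> snd S v" "v \<notin> snd S w" for v using wf w unfolding wf_ngraph_def by blast+
  have adj: "v \<in> snd (rename p w (resA S p q r x y z)) u \<longleftrightarrow>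
     (u = w \<and> v \<in> {x,y,z} \<or> v = w \<and> u \<in> {x,y,z} \<or> u \<notin> {p,q,r} \<and> v \<notin> {p,q,r} \<and> v \<in> snd S u)" for u v
    unfolding in_rename adj_resA[OF wf c] using ne d nw
    by (cases "u = w"; cases "u = p"; cases "v = w"; cases "v = p") (simp_all, blast+)
  \<comment> \<open>\<open>p\<close> moves to \<open>w\<close>, and all other vertices stay fixed
    because \<open>w\<close> is fresh.\<close>
  have "transpose p w ` (fst S - {q,r}) = insert w (fst S - {p, q, r})"
  proof -
    have "fst S - {q,r} = insert p (fst S - {p,q,r})" using V d by auto
    moreover have "transpose p w ` (fst S - {p,q,r}) = fst S - {p,q,r}"
      using w by (auto simp: transpose_def image_iff)
    ultimately show ?thesis by simp
  qed
  moreover have "{{u, v} | u v. v \<in> snd (rename p w (resA S p q r x y z)) u} =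
     {e \<in> edges (ugraph_of S). e \<inter> {p, q, r} = {}} \<union> {{w, u} | u. u \<in> {x, y, z}}"
    (is "?A = ?B")
  proof
    show "?A \<subseteq> ?B"
    proof
      fix e assume "e \<in> ?A"
      then obtain u v where e: "e = {u,v}" "v \<in> snd (rename p w (resA S p q r x y z)) u" by blast
      from e(2)[unfolded adj] consider "u = w" "v \<in> {x,y,z}" | "v = w" "u \<in> {x,y,z}" |
         "u \<notin> {p,q,r}" "v \<notin> {p,q,r}" "v \<in> snd S u" by blast
      thus "e \<in> ?B"
      proof cases
        case 2 hence "e = {w, u}" using e by blast
        with 2 show ?thesis by blast
      qed (use e in \<open>auto simp: ugraph_of_def edges_def\<close>)
    qed
    show "?B \<subseteq> ?A"
    proof
      fix e assume "e \<in> ?B"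
      then consider "e \<in> edges (ugraph_of S)" "e \<inter> {p, q, r} = {}" | u where "e = {w,u}" "u \<in> {x,y,z}" by blast
      thus "e \<in> ?A"
      proof cases
        case 1
        then obtain u v where "e = {u,v}" "v \<in> snd S u" by (auto simp: ugraph_of_def edges_def)
        with 1 adj[of v u] show ?thesis by blast
      qed (use adj in blast)
    qed
  qed
  ultimately show ?thesis by (simp add: ugraph_of_def rename_def resA_def)
qed

lemma ugraph_of_resB:
  assumes wf: "wf_ngraph S" and c: "confB (snd S) p q r s x y"
  shows "ugraph_of (resB S p q r) = (fst S - {q}, {e \<in> edges (ugraph_of S). q \<notin> e} \<union> {{p, r}})"
proof -
  have d: "distinct [p,q,r,s]" using c by (simp add: confB_def)
  have adj: "v \<in> snd (resB S p q r) u \<longleftrightarrow>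
    u \<noteq> q \<and> v \<noteq> q \<and> (v \<in> snd S u \<or> u = p \<and> v = r \<or> u = r \<and> v = p)" for u v
    using d unfolding resB_def by auto
  have "{{u, v} | u v. v \<in> snd (resB S p q r) u} = {e \<in> edges (ugraph_of S). q \<notin> e} \<union> {{p, r}}"
    (is "?A = ?B")
  proof
    show "?A \<subseteq> ?B" unfolding adj ugraph_of_def edges_def snd_conv by blast
    show "?B \<subseteq> ?A"
    proof
      fix e assume "e \<in> ?B"
      then consider "e \<in> edges (ugraph_of S)" "q \<notin> e" | "e = {p,r}" by blast
      thus "e \<in> ?A"
      proof cases
        case 1
        then obtain u v where "e = {u,v}" "v \<in> snd S u" by (auto simp: ugraph_of_def edges_def)
        with 1 adj[of v u] show ?thesis by blast
      next
        case 2 with adj[of p r] d show ?thesis by auto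
      qed
    qed
  qed
  thus ?thesis by (simp add: ugraph_of_def resB_def)
qed

text \<open>The infinite type supplies the fresh vertex of D3a; for a triangle, \<open>T'\<close> is
  \<open>T\<close> with the surviving corner renamed to it.\<close>

lemma step_imp_D3_step:
  assumes "step S T" and wf: "wf_ngraph S" and "infinite (UNIV :: 'a set)"
  shows "\<exists>T'. D3_step (ugraph_of (S :: 'a ngraph)) (ugraph_of T') \<and> T \<approx> T'"
  using assms(1)
proof cases
  case (stepA p q r x y z)
  have "finite (fst S)" using wf by (simp add: wf_ngraph_def)
  then obtain w where w: "w \<notin> fst S" using ex_new_if_finite assms(3) by blast
  have c: "snd S p = {q,r,x}" "snd S q = {p,r,y}" "snd S r = {p,q,z}" "distinct [p,q,r,x,y,z]"
    using stepA(2) by (auto simp: confA_def)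
  have V: "p \<in> fst S" "q \<in> fst S" "r \<in> fst S"
    using wf_ngraphD(2)[OF wf, of _ p] wf_ngraphD(2)[OF wf, of _ q] c(1,2) by auto
  have out: "(snd S p \<union> snd S q \<union> snd S r) - {p,q,r} = {x,y,z}" using c by auto
  have "D3a (ugraph_of S) (ugraph_of (rename p w T))"
    unfolding stepA(1) ugraph_of_resA[OF wf stepA(2) w] D3a_def Let_def
    apply (rule exI[of _ p], rule exI[of _ q], rule exI[of _ r], rule exI[of _ w])
    using c w V unfolding degree_def nbrs_ugraph_of[OF wf] adj_ugraph_of[OF wf] verts_ugraph_of out
    by simp
  thus ?thesis using rename_iso[of T p w] unfolding D3_step_def by (intro exI[of _ "rename p w T"]) simp
next
  case (stepB p q r s x y)
  have c: "snd S p = {q,s,x}" "snd S q = {p,r,s}" "snd S r = {q,s,y}" "distinct [p,q,r,s]"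
     "x \<notin> {p,q,r,s}" "y \<notin> {p,q,r,s}"
    using stepB(2) by (auto simp: confB_def)
  have sN: "p \<in> snd S s" "q \<in> snd S s" "r \<in> snd S s" using c(1-3) by (auto intro: wf_ngraphD(3)[OF wf])
  have V: "p \<in> fst S" "q \<in> fst S" "r \<in> fst S" "s \<in> fst S"
    using wf_ngraphD(2)[OF wf, of _ p] wf_ngraphD(2)[OF wf, of _ q] c(1,2) by auto
  have "D3b (ugraph_of S) (ugraph_of T)"
    unfolding stepB(1) ugraph_of_resB[OF wf stepB(2)] D3b_def
    apply (rule exI[of _ p], rule exI[of _ q], rule exI[of _ r], rule exI[of _ s])
    using c V sN not_sym unfolding degree_def nbrs_ugraph_of[OF wf] adj_ugraph_of[OF wf] verts_ugraph_of
    by (simp add: card_insert_if not_sym)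
  thus ?thesis using ngraph_iso_refl[of T] unfolding D3_step_def by (intro exI[of _ T]) simp
qed

lemma D3_step_imp_step:
  assumes "D3_step (ugraph_of S) H" and wf: "wf_ngraph S"
  shows "\<exists>T T'. step S T \<and> H = ugraph_of T' \<and> T \<approx> T'"
proof -
  have irr: "v \<notin> snd S v" and sym: "u \<in> snd S v \<Longrightarrow> v \<in> snd S u" for u v
    using wf_ngraphD[OF wf] by blast+
  from assms(1) consider "D3a (ugraph_of S) H" | "D3b (ugraph_of S) H" unfolding D3_step_def by blast
  thus ?thesis
  proof cases
    case 1
    then obtain p q r w where *: "card (snd S p) = 3" "card (snd S q) = 3" "card (snd S r) = 3"
      "q \<in> snd S p" "r \<in> snd S q" "r \<in> snd S p"
      "card ((snd S p \<union> snd S q \<union> snd S r) - {p,q,r}) = 3" "w \<notin> fst S"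
      and H: "H = (insert w (fst S - {p,q,r}), {e \<in> edges (ugraph_of S). e \<inter> {p,q,r} = {}} \<union>
        {{w, x} | x. x \<in> (snd S p \<union> snd S q \<union> snd S r) - {p,q,r}})"
      unfolding D3a_def Let_def degree_def nbrs_ugraph_of[OF wf] adj_ugraph_of[OF wf] verts_ugraph_of
      by blast
    have ne: "p \<noteq> q" "q \<noteq> r" "p \<noteq> r" using * irr by auto
    obtain x where x: "snd S p = {q,r,x}" "x \<noteq> q" "x \<noteq> r" using card3_obtain[OF *(1,4,6)] ne by metis
    obtain y where y: "snd S q = {p,r,y}" "y \<noteq> p" "y \<noteq> r" using card3_obtain[OF *(2) sym[OF *(4)] *(5)] ne by metis
    obtain z where z: "snd S r = {p,q,z}" "z \<noteq> p" "z \<noteq> q" using card3_obtain[OF *(3) sym[OF *(6)] sym[OF *(5)]] ne by metis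
    have ne': "x \<noteq> p" "y \<noteq> q" "z \<noteq> r" using x y z irr by auto
    have out: "(snd S p \<union> snd S q \<union> snd S r) - {p,q,r} = {x,y,z}" using x y z ne ne' by auto
    \<comment> \<open>Three outside neighbours in total are possible only if those of the single
      corners differ pairwise.\<close>
    have "distinct [x,y,z]" using *(7) unfolding out by (auto simp: card_insert_if split: if_splits)
    hence c: "confA (snd S) p q r x y z" using x y z ne ne' by (auto simp: confA_def)
    have "H = ugraph_of (rename p w (resA S p q r x y z))"
      unfolding ugraph_of_resA[OF wf c *(8)] H out by (rule refl)
    thus ?thesis using step.stepA[OF c] rename_iso by (intro exI conjI)
  next
    case 2
    then obtain p q r s where *: "card (snd S p) = 3" "card (snd S q) = 3" "card (snd S r) = 3"
      "q \<in> snd S p" "r \<in> snd S q" "r \<notin> snd S p" "p \<in> snd S s" "q \<in> snd S s" "r \<in> snd S s" "p \<noteq> r"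
      and H: "H = (fst S - {q}, {e \<in> edges (ugraph_of S). q \<notin> e} \<union> {{p, r}})"
      unfolding D3b_def degree_def nbrs_ugraph_of[OF wf] adj_ugraph_of[OF wf] verts_ugraph_of
      by blast
    have ne: "p \<noteq> q" "q \<noteq> r" "p \<noteq> s" "q \<noteq> s" "r \<noteq> s" using * irr by auto
    obtain x where x: "snd S p = {q,s,x}" "x \<noteq> q" "x \<noteq> s" using card3_obtain[OF *(1,4) sym[OF *(7)]] ne by metis
    obtain y where y: "snd S r = {q,s,y}" "y \<noteq> q" "y \<noteq> s" using card3_obtain[OF *(3) sym[OF *(5)] sym[OF *(9)]] ne by metis
    obtain oo where "snd S q = {p,r,oo}" "oo \<noteq> p" "oo \<noteq> r" using card3_obtain[OF *(2) sym[OF *(4)] *(5)] *(10) by metis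
    hence q: "snd S q = {p,r,s}" using sym[OF *(8)] ne by auto
    have "x \<noteq> p" "y \<noteq> r" "x \<noteq> r" "y \<noteq> p" using x y irr *(6) sym[of p r] by auto
    with x y q ne *(10) have c: "confB (snd S) p q r s x y" by (simp add: confB_def)
    show ?thesis using step.stepB[OF c] H ugraph_of_resB[OF wf c] ngraph_iso_refl by metis
  qed
qed

section \<open>Symmetries of the two patterns\<close>

lemma confA_swap: "confA N p q r x y z \<Longrightarrow> confA N p r q x z y"
  by (auto simp: confA_def insert_commute)

lemma confA_rot: "confA N p q r x y z \<Longrightarrow> confA N q p r y x z"
  by (auto simp: confA_def insert_commute)

lemma confB_swap: "confB N p q r s x y \<Longrightarrow> confB N r q p s y x"
  by (auto simp: confB_def insert_commute)

lemma resA_swap: "resA S p r q x z y = resA S p q r x y z"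
  by (auto simp: resA_def merge_def fun_eq_iff insert_commute disj_commute)

lemma resB_swap: "resB S r q p = resB S p q r"
  by (auto simp: resB_def fun_eq_iff)

text \<open>Letting another corner survive only exchanges the names \<open>p\<close> and
  \<open>q\<close>. Unlike \<open>resA_swap\<close>, this is an isomorphism and not an
  equality.\<close>

lemma resA_rot:
  assumes wf: "wf_ngraph S" and c: "confA (snd S) p q r x y z"
  shows "resA S p q r x y z \<approx> resA S q p r y x z"
proof (rule ngraph_isoI[of "transpose p q"])
  have d: "distinct [p,q,r,x,y,z]" using c by (simp add: confA_def)
  have V: "p \<in> fst S" "q \<in> fst S"
    using wf_ngraphD(2)[OF wf, of _ p] wf_ngraphD(2)[OF wf, of _ q] c unfolding confA_def by auto
  show "fst (resA S q p r y x z) = transpose p q ` fst (resA S p q r x y z)"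
    using d V by (auto simp: resA_def transpose_def image_iff)
  show "transpose p q u \<in> snd (resA S q p r y x z) (transpose p q v) \<longleftrightarrow> u \<in> snd (resA S p q r x y z) v" for u v
    unfolding adj_resA[OF wf c] adj_resA[OF wf confA_rot[OF c]]
    using d by (cases "u = p"; cases "u = q"; cases "v = p"; cases "v = q") auto
qed simp

text \<open>Swap and rotation generate all six orders of the corners. This brings the two corners
  that carry edges to another triangle into fixed positions.\<close>

lemma confA_arrange:
  assumes wf: "wf_ngraph S" and c: "confA (snd S) p q r x y z"
    and uv: "u \<in> {p,q,r}" "v \<in> {p,q,r}" "u \<noteq> v"
  shows "\<exists>p' x' y' z'. {p', u, v} = {p, q, r} \<and> {x', y', z'} = {x, y, z} \<and>
     confA (snd S) p' u v x' y' z' \<and> resA S p q r x y z \<approx> resA S p' u v x' y' z'"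
proof -
  note c2 = confA_swap[OF c]
  have id: "resA S p q r x y z \<approx> resA S p q r x y z" "resA S p q r x y z \<approx> resA S p r q x z y"
    using ngraph_iso_refl resA_swap by metis+
  note c3 = confA_rot[OF c] confA_rot[OF c2]
  have i3: "resA S p q r x y z \<approx> resA S q p r y x z" "resA S p q r x y z \<approx> resA S r p q z x y"
    using resA_rot[OF wf c] resA_rot[OF wf c2] resA_swap by metis+
  note c4 = confA_swap[OF c3(1)] confA_swap[OF c3(2)]
  have i4: "resA S p q r x y z \<approx> resA S q r p y z x" "resA S p q r x y z \<approx> resA S r q p z y x"
    using i3 resA_swap by metis+
  from uv consider "u = p" "v = q" | "u = p" "v = r" | "u = q" "v = p" | "u = q" "v = r"
    | "u = r" "v = p" | "u = r" "v = q" by blast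
  thus ?thesis
  proof cases
    case 1 with c3(2) i3(2) show ?thesis by blast
  next
    case 2 with c3(1) i3(1) show ?thesis by blast
  next
    case 3 with c4(2) i4(2) show ?thesis by blast
  next
    case 4 with c id(1) show ?thesis by blast
  next
    case 5 with c4(1) i4(1) show ?thesis by blast
  next
    case 6 with c2 id(2) show ?thesis by blast
  qed
qed

text \<open>The triangle seen from an arbitrary corner. As the outside neighbours are distinct,
  \<open>oo\<close> is the one neighbour of \<open>u\<close> that sees neither of the other
  two.\<close>

lemma confA_corner:
  assumes "confA N p q r x y z" "u \<in> {p,q,r}"
  obtains v w oo where "{p,q,r} = {u,v,w}" "N u = {v,w,oo}" "oo \<notin> N v" "oo \<notin> N w" "w \<in> N v" "v \<in> N w"
    "distinct [u,v,w,oo]" "oo \<in> {x,y,z}"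
proof -
  have c: "N p = {q,r,x}" "N q = {p,r,y}" "N r = {p,q,z}" "distinct [p,q,r,x,y,z]"
    using assms(1) by (auto simp: confA_def)
  from assms(2) consider "u = p" | "u = q" | "u = r" by blast
  thus thesis
  proof cases
    case 1 show thesis by (rule that[of q r x]) (use 1 c in auto)
  next
    case 2 show thesis by (rule that[of p r y]) (use 2 c in auto)
  next
    case 3 show thesis by (rule that[of p q z]) (use 3 c in auto)
  qed
qed

text \<open>Joinability up to isomorphism, with at most one more step on each side; every peak
  closes in this way.\<close>

definition conn :: "'a ngraph \<Rightarrow> 'a ngraph \<Rightarrow> bool" where
  "conn S T \<longleftrightarrow> (\<exists>S' T'. S \<approx> S' \<and> T \<approx> T' \<and> (S' = T' \<or> (\<exists>U. step S' U \<and> step T' U)))"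

lemma conn_iso: "S \<approx> T \<Longrightarrow> conn S T"
  unfolding conn_def using ngraph_iso_refl by blast

lemma conn_step: "step S U \<Longrightarrow> step T U \<Longrightarrow> conn S T"
  unfolding conn_def using ngraph_iso_refl by blast

lemma conn_cong: "S \<approx> S' \<Longrightarrow> T \<approx> T' \<Longrightarrow> conn S' T' \<Longrightarrow> conn S T"
  unfolding conn_def using ngraph_iso_trans by blast

lemma conn_sym: "conn S T \<Longrightarrow> conn T S"
  unfolding conn_def by metis

text \<open>At a shared corner the outside neighbour is the only neighbour without an edge to
  another neighbour. Hence both triangles have the same one, and the two remaining neighbours agree
  as well.\<close>

lemma confA_overlap:
  assumes "confA N p q r x y z" "confA N p' q' r' x' y' z'" "{p,q,r} \<inter> {p',q',r'} \<noteq> {}"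
  shows "{p,q,r} = {p',q',r'}"
proof -
  obtain u where u: "u \<in> {p,q,r}" "u \<in> {p',q',r'}" using assms(3) by blast
  obtain v w oo where 1: "{p,q,r} = {u,v,w}" "N u = {v,w,oo}" "oo \<notin> N v" "oo \<notin> N w" "w \<in> N v" "distinct [u,v,w,oo]"
    using confA_corner[OF assms(1) u(1)] by metis
  obtain v' w' oo' where 2: "{p',q',r'} = {u,v',w'}" "N u = {v',w',oo'}" "oo' \<notin> N v'" "oo' \<notin> N w'" "w' \<in> N v'" "distinct [u,v',w',oo']" "v' \<in> N w'"
    using confA_corner[OF assms(2) u(2)] by metis
    have "oo = oo'"
  proof (rule ccontr)
    assume "oo \<noteq> oo'"
    hence "oo = v' \<or> oo = w'" using 1(2) 2(2) by blast
    thus False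
    proof
      assume *: "oo = v'"
      hence "w' \<in> {v,w}" using 1(2) 2(2) 2(6) by auto
      thus False using * 1(3,4) 2(7) by blast
    next
      assume *: "oo = w'"
      hence "v' \<in> {v,w}" using 1(2) 2(2) 2(6) by auto
      thus False using * 1(3,4) 2(5) by blast
    qed
  qed
  hence "{v,w} = {v',w'}" using 1(2) 2(2) 1(6) 2(6) by (metis insert_commute Diff_insert_absorb distinct_length_2_or_more insert_absorb2 insertE insert_Diff_single singletonD)
  thus ?thesis using 1(1) 2(1) by auto
qed

section \<open>Local confluence\<close>

text \<open>The \<open>merge\<close> maps of disjoint triangles commute. The distinctness
  assumptions say that each triangle keeps three different outside neighbours when the other is
  contracted; this fails only if at least two edges join them.\<close>

lemma resA_commute:
  assumes c: "confA (snd S) p q r x y z" and c': "confA (snd S) p' q' r' x' y' z'"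
    and disj: "{p,q,r} \<inter> {p',q',r'} = {}"
    and d: "distinct [merge p' q' r' x, merge p' q' r' y, merge p' q' r' z]"
    and d': "distinct [merge p q r x', merge p q r y', merge p q r z']"
  shows "\<exists>U. step (resA S p q r x y z) U \<and> step (resA S p' q' r' x' y' z') U"
proof -
  let ?m = "merge p q r" and ?m' = "merge p' q' r'"
  \<comment> \<open>Stated for arbitrary triangles because it is applied in both orders.\<close>
  have conf: "confA (snd (resA S p q r x y z)) p' q' r' (merge p q r x') (merge p q r y') (merge p q r z')"
    if c: "confA (snd S) p q r x y z" and c': "confA (snd S) p' q' r' x' y' z'"
    and disj: "{p,q,r} \<inter> {p',q',r'} = {}"
    and d: "distinct [merge p q r x', merge p q r y', merge p q r z']"
    for p q r x y z p' q' r' x' y' z'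
  proof -
    have *: "snd S p' = {q', r', x'}" "snd S q' = {p', r', y'}" "snd S r' = {p', q', z'}"
      "distinct [p', q', r', x', y', z']" using c' by (auto simp: confA_def)
    have m: "merge p q r u = u" if "u \<in> {p',q',r'}" for u using that disj by (auto simp: merge_def)
    have m2: "merge p q r u \<notin> {p',q',r'}" if "u \<notin> {p',q',r'}" for u using that disj by (auto simp: merge_def)
    have ne: "p' \<notin> {p,q,r}" "q' \<notin> {p,q,r}" "r' \<notin> {p,q,r}" using disj by auto
    show ?thesis using * d ne m m2[of x'] m2[of y'] m2[of z']
      unfolding confA_def resA_def by simp metis
  qed
  have mm: "?m (?m' u) = ?m' (?m u)" for u using disj by (auto simp: merge_def)
  have s1: "snd (resA (resA S p q r x y z) p' q' r' (?m x') (?m y') (?m z')) v =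
    (if v = p' then {?m x', ?m y', ?m z'} else if v = q' \<or> v = r' then {}
     else if v = p then {?m' x, ?m' y, ?m' z} else if v = q \<or> v = r then {} else ?m' ` ?m ` snd S v)" for v
    by (simp add: resA_def)
  have s2: "snd (resA (resA S p' q' r' x' y' z') p q r (?m' x) (?m' y) (?m' z)) v =
    (if v = p then {?m' x, ?m' y, ?m' z} else if v = q \<or> v = r then {}
     else if v = p' then {?m x', ?m y', ?m z'} else if v = q' \<or> v = r' then {} else ?m ` ?m' ` snd S v)" for v
    by (simp add: resA_def)
  have "snd (resA (resA S p q r x y z) p' q' r' (?m x') (?m y') (?m z')) v
     = snd (resA (resA S p' q' r' x' y' z') p q r (?m' x) (?m' y) (?m' z)) v" for v
    unfolding s1 s2 image_image mm using disj by auto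
  hence "resA (resA S p q r x y z) p' q' r' (?m x') (?m y') (?m z')
     = resA (resA S p' q' r' x' y' z') p q r (?m' x) (?m' y) (?m' z)"
    by (intro prod_eqI ext) (auto simp: resA_def)
  moreover have disj': "{p',q',r'} \<inter> {p,q,r} = {}" using disj by blast
  ultimately show ?thesis
    using stepA[OF conf[OF c c' disj d']] stepA[OF conf[OF c' c disj' d]] by metis
qed

text \<open>After one contraction two corners of the other triangle share their outside neighbour,
  so the second contraction is lost. The results are isomorphic instead: the contracted vertex
  \<open>p\<close> of the first result corresponds to the leftover corner \<open>p\<close> of the
  second, and likewise for \<open>p'\<close>, once \<open>q\<close>, \<open>r\<close> trade names
  with \<open>q'\<close>, \<open>r'\<close>.\<close>

lemma resA_linked:
  assumes wf: "wf_ngraph S" and c: "confA (snd S) p q r x q' r'" and c': "confA (snd S) p' q' r' x' q r"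
  shows "resA S p q r x q' r' \<approx> resA S p' q' r' x' q r"
proof (rule ngraph_isoI[of "transpose q q' \<circ> transpose r r'"])
  let ?f = "transpose q q' \<circ> transpose r r'"
  have d: "distinct [p,q,r,x,q',r']" "distinct [p',q',r',x',q,r]"
    and N: "snd S p = {q,r,x}" "snd S p' = {q',r',x'}" using c c' by (auto simp: confA_def)
  have sym: "a \<in> snd S b \<longleftrightarrow> b \<in> snd S a" for a b using wf_ngraphD(3)[OF wf] by blast
  have pp: "p \<noteq> p'" using N d by auto
  have f: "?f q = q'" "?f r = r'" "?f q' = q" "?f r' = r" "v \<notin> {q,r,q',r'} \<Longrightarrow> ?f v = v" for v
    using d by (auto simp: transpose_def)
  show "bij ?f" by (simp add: bij_comp)
  have V: "{p,q,r,p',q',r'} \<subseteq> fst S"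
    using wf_ngraphD(2)[OF wf, of _ p] wf_ngraphD(2)[OF wf, of _ q] wf_ngraphD(2)[OF wf, of _ q'] c c'
    unfolding confA_def by auto
  have "?f ` (fst S - {q,r}) = fst S - {q',r'}" 
  proof -
    have "fst S - {q,r} = (fst S - {q,r,q',r'}) \<union> {q',r'}" using V d by auto
    moreover have "?f ` (fst S - {q,r,q',r'}) = fst S - {q,r,q',r'}" using f(5) by force
    moreover have "?f ` {q',r'} = {q,r}" using f by simp
    moreover have "fst S - {q',r'} = (fst S - {q,r,q',r'}) \<union> {q,r}" using V d by auto
    ultimately show ?thesis by (metis image_Un)
  qed
  thus "fst (resA S p' q' r' x' q r) = ?f ` fst (resA S p q r x q' r')" by (simp add: resA_def)
  show "?f u \<in> snd (resA S p' q' r' x' q r) (?f v) \<longleftrightarrow> u \<in> snd (resA S p q r x q' r') v" for u v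
  proof -
    have sN: "a \<in> snd S p \<longleftrightarrow> a \<in> {q,r,x}" "a \<in> snd S p' \<longleftrightarrow> a \<in> {q',r',x'}" 
      "a \<in> snd S q \<longleftrightarrow> a \<in> {p,r,q'}" "a \<in> snd S r \<longleftrightarrow> a \<in> {p,q,r'}"
      "a \<in> snd S q' \<longleftrightarrow> a \<in> {p',r',q}" "a \<in> snd S r' \<longleftrightarrow> a \<in> {p',q',r}" for a
      using c c' by (auto simp: confA_def)
    note sN' = sN[unfolded sym[of _ p] sym[of _ p'] sym[of _ q] sym[of _ r] sym[of _ q'] sym[of _ r']]
    \<comment> \<open>A third edge between the triangles can only join \<open>p\<close> and
      \<open>p'\<close>, and then it shows on both sides.\<close>
    have xx: "x = p' \<longleftrightarrow> x' = p" using sN(1)[of p'] sN(2)[of p] sym[of p p'] d by auto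
    let ?eq = "(?f v = p' \<and> ?f u \<in> {x', q, r} \<or> ?f u = p' \<and> ?f v \<in> {x', q, r} \<or>
         ?f u \<notin> {p', q', r'} \<and> ?f v \<notin> {p', q', r'} \<and> ?f u \<in> snd S (?f v)) =
        (v = p \<and> u \<in> {x, q', r'} \<or> u = p \<and> v \<in> {x, q', r'} \<or> u \<notin> {p, q, r} \<and> v \<notin> {p, q, r} \<and> u \<in> snd S v)"
    show ?thesis
      unfolding adj_resA[OF wf c] adj_resA[OF wf c']
    proof (cases "u \<in> {q,r,q',r'}"; cases "v \<in> {q,r,q',r'}")
      assume "u \<in> {q,r,q',r'}" "v \<in> {q,r,q',r'}"
      thus ?eq
        using d pp by (elim insertE emptyE) (simp_all only: f sN, auto)
    next
      assume "u \<in> {q,r,q',r'}" "v \<notin> {q,r,q',r'}"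
      thus ?eq
        using d pp f(5)[of v] by (elim insertE[of u] emptyE) (simp_all only: f sN sN', auto)
    next
      assume "u \<notin> {q,r,q',r'}" "v \<in> {q,r,q',r'}"
      thus ?eq
        using d pp f(5)[of u] by (elim insertE[of v] emptyE) (simp_all only: f sN sN', auto)
    next
      assume "u \<notin> {q,r,q',r'}" "v \<notin> {q,r,q',r'}"
      thus ?eq
        using d pp f(5)[of u] f(5)[of v] sN(1)[of u] sN(2)[of u] sN'(1)[of v] sN'(2)[of v] xx
        by (cases "u = p"; cases "v = p"; cases "u = p'"; cases "v = p'") auto
    qed
  qed
qed

lemma conn_AA:
  assumes wf: "wf_ngraph S" and c: "confA (snd S) p q r x y z" and c': "confA (snd S) p' q' r' x' y' z'"
  shows "conn (resA S p q r x y z) (resA S p' q' r' x' y' z')"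
proof (cases "{p,q,r} \<inter> {p',q',r'} = {}")
  case False
  hence eq: "{p,q,r} = {p',q',r'}" by (rule confA_overlap[OF c c'])
  have d: "distinct [p,q,r]" "distinct [p',q',r']" using c c' by (auto simp: confA_def)
  have "q' \<in> {p,q,r}" "r' \<in> {p,q,r}" "q' \<noteq> r'" using eq d by auto
  then obtain a b e f where 1: "{a, q', r'} = {p, q, r}" "confA (snd S) a q' r' b e f"
     "resA S p q r x y z \<approx> resA S a q' r' b e f" using confA_arrange[OF wf c] by metis
  have a: "a = p'" using 1(1) eq 1(2) d by (auto simp: confA_def)
  have "b = x' \<and> e = y' \<and> f = z'" using 1(2) c' unfolding a confA_def by auto
  thus ?thesis using 1(3) a conn_iso by simp
next
  case disj: True
  have d: "distinct [p,q,r,x,y,z]" "distinct [p',q',r',x',y',z']" using c c' by (auto simp: confA_def)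
  show ?thesis
  \<comment> \<open>Two different outside neighbours in the other triangle amount to two joining
    edges.\<close>
  proof (cases "\<exists>a b. a \<in> {x,y,z} \<and> b \<in> {x,y,z} \<and> a \<noteq> b \<and> a \<in> {p',q',r'} \<and> b \<in> {p',q',r'}")
    case True
    then obtain a b where ab: "a \<in> {x,y,z}" "b \<in> {x,y,z}" "a \<noteq> b" "a \<in> {p',q',r'}" "b \<in> {p',q',r'}" by blast
    have *: "\<exists>u. u \<in> {p,q,r} \<and> a \<in> snd S u \<and> (\<forall>v\<in>{p,q,r}. a \<in> snd S v \<longrightarrow> v = u)" if "a \<in> {x,y,z}" for a
      using c d(1) that unfolding confA_def by auto
    obtain u where u: "u \<in> {p,q,r}" "a \<in> snd S u" "\<And>v. v \<in> {p,q,r} \<Longrightarrow> a \<in> snd S v \<Longrightarrow> v = u" using *[OF ab(1)] by blast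
    obtain v where v: "v \<in> {p,q,r}" "b \<in> snd S v" "\<And>u. u \<in> {p,q,r} \<Longrightarrow> b \<in> snd S u \<Longrightarrow> u = v" using *[OF ab(2)] by blast
    \<comment> \<open>A corner has a single outside neighbour, so the two joining edges leave from
      different corners.\<close>
    have "u \<noteq> v"
    proof
      assume "u = v"
      obtain v' w t where t: "{p,q,r} = {u,v',w}" "snd S u = {v',w,t}" using confA_corner[OF c u(1)] by metis
      have "a \<notin> {p,q,r}" "b \<notin> {p,q,r}" using ab(1,2) d(1) by auto
      hence "a = t" "b = t" using t u(2) v(2) \<open>u = v\<close> by auto
      thus False using ab(3) by simp
    qed
    obtain p1 x1 y1 z1 where 1: "{p1,u,v} = {p,q,r}" "{x1,y1,z1} = {x,y,z}" "confA (snd S) p1 u v x1 y1 z1"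
        "resA S p q r x y z \<approx> resA S p1 u v x1 y1 z1"
      using confA_arrange[OF wf c u(1) v(1) \<open>u \<noteq> v\<close>] by metis
    obtain p2 x2 y2 z2 where 2: "{p2,a,b} = {p',q',r'}" "confA (snd S) p2 a b x2 y2 z2"
        "resA S p' q' r' x' y' z' \<approx> resA S p2 a b x2 y2 z2"
      using confA_arrange[OF wf c' ab(4,5,3)] by metis
    have out: "a \<notin> {p1,u,v}" "b \<notin> {p1,u,v}" "u \<notin> {p2,a,b}" "v \<notin> {p2,a,b}"
      unfolding 1(1) 2(1) using ab(1,2) d(1) u(1) v(1) disj by auto
    have nb: "snd S u = {p1,v,y1}" "snd S v = {p1,u,z1}" "snd S a = {p2,b,y2}" "snd S b = {p2,a,z2}"
      using 1(3) 2(2) by (auto simp: confA_def)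
    have "y1 = a" using nb(1) u(2) out(1) by auto
    moreover have "z1 = b" using nb(2) v(2) out(2) by auto
    moreover have "y2 = u" using nb(3) wf_ngraphD(3)[OF wf u(2)] out(3) by auto
    moreover have "z2 = v" using nb(4) wf_ngraphD(3)[OF wf v(2)] out(4) by auto
    ultimately have "resA S p1 u v x1 y1 z1 \<approx> resA S p2 a b x2 y2 z2"
      using resA_linked[OF wf, of p1 u v x1 a b p2 x2] 1(3) 2(2) by simp
    thus ?thesis by (rule conn_cong[OF 1(4) 2(3) conn_iso])
  next
    case F: False
    \<comment> \<open>The absence of two joining edges is symmetric in the triangles; here it is
      restated from the other side.\<close>
    have F': "\<not> (x' \<in> {p,q,r} \<and> y' \<in> {p,q,r})" "\<not> (x' \<in> {p,q,r} \<and> z' \<in> {p,q,r})" "\<not> (z' \<in> {p,q,r} \<and> y' \<in> {p,q,r})"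
    proof -
      have "a \<in> {x,y,z}" if "b \<in> {p,q,r}" "b \<in> snd S a" "a \<in> {p',q',r'}" for a b
        using c wf_ngraphD(3)[OF wf that(2)] that disj unfolding confA_def by blast
      note * = this[of _ p'] this[of _ q'] this[of _ r']
      have N: "x' \<in> snd S p'" "y' \<in> snd S q'" "z' \<in> snd S r'" using c' by (auto simp: confA_def)
      show "\<not> (x' \<in> {p,q,r} \<and> y' \<in> {p,q,r})"
        using F *(1)[OF _ N(1)] *(2)[OF _ N(2)] d(2) by (metis distinct_length_2_or_more insertCI)
      show "\<not> (x' \<in> {p,q,r} \<and> z' \<in> {p,q,r})"
        using F *(1)[OF _ N(1)] *(3)[OF _ N(3)] d(2) by (metis distinct_length_2_or_more insertCI)
      show "\<not> (z' \<in> {p,q,r} \<and> y' \<in> {p,q,r})"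
        using F *(3)[OF _ N(3)] *(2)[OF _ N(2)] d(2) by (metis distinct_length_2_or_more insertCI)
    qed
    have "distinct [merge p q r x', merge p q r y', merge p q r z']"
      using d(2) F' by (auto simp: merge_def)
    moreover have "distinct [merge p' q' r' x, merge p' q' r' y, merge p' q' r' z]"
    proof -
      have "\<not> (x \<in> {p',q',r'} \<and> y \<in> {p',q',r'})" "\<not> (x \<in> {p',q',r'} \<and> z \<in> {p',q',r'})" "\<not> (z \<in> {p',q',r'} \<and> y \<in> {p',q',r'})"
        using F d(1) by (metis distinct_length_2_or_more insertCI)+
      thus ?thesis using d(1) by (auto simp: merge_def)
    qed
    ultimately show ?thesis using resA_commute[OF c c' disj] conn_step by blast
  qed
qed

section \<open>Peaks that involve D3b\<close>

lemma confB_facts: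
  assumes "confB N p q r s x y"
  shows "N p = {q,s,x}" "N q = {p,r,s}" "N r = {q,s,y}" "p \<noteq> q" "p \<noteq> r" "p \<noteq> s" "q \<noteq> r" "q \<noteq> s" "r \<noteq> s"
    "x \<noteq> p" "x \<noteq> q" "x \<noteq> r" "x \<noteq> s" "y \<noteq> p" "y \<noteq> q" "y \<noteq> r" "y \<noteq> s" "r \<notin> N p" "p \<notin> N r"
  using assms by (auto simp: confB_def)

text \<open>The outside neighbour of a corner sees no other corner. Every neighbour of the middle
  vertex \<open>b\<close> sees another one, so \<open>b\<close> is no corner. If an end were a
  corner, \<open>b\<close> would be its outside neighbour and yet be adjacent to the corner
  \<open>s\<close>. If \<open>s\<close> were a corner, both ends would have to be its only outside
  neighbour.\<close>

lemma confA_confB_disjoint: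
  assumes wf: "wf_ngraph S" and c: "confA (snd S) p q r x y z" and c': "confB (snd S) a b d s e f"
  shows "{p,q,r} \<inter> {a,b,d,s} = {}"
proof -
  note B = confB_facts[OF c'] and sym = wf_ngraphD(3)[OF wf]
  have sN: "a \<in> snd S s" "b \<in> snd S s" "d \<in> snd S s" using B(1-3) by (auto intro: sym)
  have nb: "b \<notin> {p,q,r}"
  proof
    assume "b \<in> {p,q,r}"
    then obtain v w t where t: "snd S b = {v,w,t}" "t \<notin> snd S v" "t \<notin> snd S w"
      "w \<in> snd S v" "v \<in> snd S w" "distinct [b,v,w,t]" using confA_corner[OF c] by metis
    have "t \<in> {a,d,s}" "v \<in> {a,d,s}" "w \<in> {a,d,s}" using t(1) B(2) by auto
    thus False using t(2-) B(18,19) sN sym[OF sN(1)] sym[OF sN(3)] by auto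
  qed
  have na: "a' \<notin> {p,q,r}" if "snd S a' = {b,s,e'}" for a' e'
  proof
    assume "a' \<in> {p,q,r}"
    then obtain v w t where t: "{p,q,r} = {a',v,w}" "snd S a' = {v,w,t}" "t \<notin> snd S v" "t \<notin> snd S w"
      using confA_corner[OF c] by metis
    have "b = t" using nb t(1,2) that by auto
    hence "s \<in> {v,w}" using t(2) that B(8) by auto
    thus False using t(3,4) \<open>b = t\<close> sN(2) by auto
  qed
  have n: "a \<notin> {p,q,r}" "d \<notin> {p,q,r}" using na B(1,3) by blast+
  have "s \<notin> {p,q,r}"
  proof
    assume "s \<in> {p,q,r}"
    then obtain v w t where t: "{p,q,r} = {s,v,w}" "snd S s = {v,w,t}"
      using confA_corner[OF c] by metis
    have "a = t" "d = t" using t sN n by auto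
    thus False using B(5) by simp
  qed
  thus ?thesis using nb n by blast
qed

lemma conn_AB:
  assumes wf: "wf_ngraph S" and c: "confA (snd S) p q r x y z" and c': "confB (snd S) a b d s e f"
  shows "conn (resA S p q r x y z) (resB S a b d)"
proof -
  note B = confB_facts[OF c'] and sym = wf_ngraphD(3)[OF wf]
  have A: "snd S p = {q,r,x}" "snd S q = {p,r,y}" "snd S r = {p,q,z}" "distinct [p,q,r,x,y,z]"
    using c by (auto simp: confA_def)
  have disj: "a \<notin> {p,q,r}" "b \<notin> {p,q,r}" "d \<notin> {p,q,r}" "s \<notin> {p,q,r}"
    using confA_confB_disjoint[OF wf c c'] by auto
  have bN: "b \<notin> snd S p" "b \<notin> snd S q" "b \<notin> snd S r" using sym[of b] B(2) disj by auto
  let ?m = "merge p q r"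
  have m: "?m u = b \<longleftrightarrow> u = b" for u using disj by (auto simp: merge_def)
  have m2: "?m u \<noteq> v" if "u \<noteq> v" "v \<notin> {p,q,r}" for u v using that by (auto simp: merge_def)
  have ma: "?m a = a" "?m d = d" "?m b = b" "?m s = s" using disj by (auto simp: merge_def)
  \<comment> \<open>The third neighbour of an end may be a corner of the triangle, hence
    \<open>?m e\<close> and \<open>?m f\<close>.\<close>
  have c1: "confB (snd (resA S p q r x y z)) a b d s (?m e) (?m f)"
    using disj B ma m2[of e] m2[of f] unfolding confB_def resA_def by auto
  have c2: "confA (snd (resB S a b d)) p q r x y z"
    using bN disj A unfolding confA_def resB_def by auto
  have bx: "b \<noteq> x" "b \<noteq> y" "b \<noteq> z" using bN A by auto
  have mi: "?m ` (X - {b}) = ?m ` X - {b}" for X using m by auto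
  have "snd (resB (resA S p q r x y z) a b d) v = snd (resA (resB S a b d) p q r x y z) v" for v
  proof -
    consider "v = p" | "v = q \<or> v = r" "v \<noteq> p" | "v = b" "v \<notin> {p,q,r}" | "v \<noteq> b" "v \<notin> {p,q,r}" by blast
    thus ?thesis
    proof cases
      case 1 thus ?thesis using disj bx by (auto simp: resA_def resB_def)
    next
      case 2 thus ?thesis using disj by (auto simp: resA_def resB_def)
    next
      case 3 thus ?thesis by (simp add: resA_def resB_def)
    next
      case 4 thus ?thesis using ma by (simp add: resA_def resB_def mi image_Un)
    qed
  qed
  hence "resB (resA S p q r x y z) a b d = resA (resB S a b d) p q r x y z"
    by (intro prod_eqI ext) (auto simp: resA_def resB_def)
  thus ?thesis using stepB[OF c1] stepA[OF c2] conn_step by metis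
qed

lemma in_resB:
  assumes "confB N p q r s x y"
  shows "u \<in> snd (resB (V, N) p q r) v \<longleftrightarrow>
    v \<noteq> q \<and> u \<noteq> q \<and> (u \<in> N v \<or> v = p \<and> u = r \<or> v = r \<and> u = p)"
  using confB_facts(4-)[OF assms] by (auto simp: resB_def)

text \<open>If the middle vertices coincide, so do the results. If one of them lies in the other
  pattern, or both patterns have the same ends, exchanging \<open>q\<close> and \<open>q'\<close> is
  an isomorphism. Otherwise each pattern survives the other reduction, and the two deletions
  commute.\<close>

lemma conn_BB:
  assumes wf: "wf_ngraph S" and c: "confB (snd S) p q r s x y" and c': "confB (snd S) p' q' r' s' x' y'"
  shows "conn (resB S p q r) (resB S p' q' r')"
proof -
  obtain V N where S: "S = (V, N)" by (cases S)
  have cN: "confB N p q r s x y" and cN': "confB N p' q' r' s' x' y'" using c c' by (simp_all add: S)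
  note B = confB_facts[OF cN] and B' = confB_facts[OF cN']
  have sym: "u \<in> N v \<Longrightarrow> v \<in> N u" and irr: "v \<notin> N v" for u v
    using wf_ngraphD(3,4)[OF wf] by (auto simp: S)
  have V: "q \<in> V" "q' \<in> V" using wf_ngraphD(2)[OF wf, of _ p] wf_ngraphD(2)[OF wf, of _ p'] B(1) B'(1) by (auto simp: S)
  \<comment> \<open>Exchanging the two deleted vertices works if the survivor has the same
    neighbours in both results (\<open>nb\<close>) and all other vertices are joined alike
    (\<open>e\<close>).\<close>
  have iso: "resB S p1 q1 r1 \<approx> resB S p2 q2 r2"
    if c1: "confB N p1 q1 r1 s1 x1 y1" and c2: "confB N p2 q2 r2 s2 x2 y2" and V: "q1 \<in> V" "q2 \<in> V" and ne: "q1 \<noteq> q2"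
    and nb: "\<And>v. v \<noteq> q1 \<Longrightarrow> v \<noteq> q2 \<Longrightarrow> q2 \<in> N v \<or> v = p1 \<and> q2 = r1 \<or> v = r1 \<and> q2 = p1 \<longleftrightarrow>
       q1 \<in> N v \<or> v = p2 \<and> q1 = r2 \<or> v = r2 \<and> q1 = p2"
    and e: "\<And>u v. u \<noteq> q1 \<Longrightarrow> u \<noteq> q2 \<Longrightarrow> v \<noteq> q1 \<Longrightarrow> v \<noteq> q2 \<Longrightarrow>
       u \<in> N v \<or> v = p1 \<and> u = r1 \<or> v = r1 \<and> u = p1 \<longleftrightarrow> u \<in> N v \<or> v = p2 \<and> u = r2 \<or> v = r2 \<and> u = p2"
    for p1 q1 r1 s1 x1 y1 p2 q2 r2 s2 x2 y2
  proof (rule ngraph_isoI[of "transpose q1 q2"])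
    show "fst (resB S p2 q2 r2) = transpose q1 q2 ` fst (resB S p1 q1 r1)"
      using V ne by (auto simp: S resB_def transpose_def image_iff)
    show "transpose q1 q2 u \<in> snd (resB S p2 q2 r2) (transpose q1 q2 v) \<longleftrightarrow> u \<in> snd (resB S p1 q1 r1) v" for u v
    proof -
      have sy: "a \<in> N b \<longleftrightarrow> b \<in> N a" for a b using sym by blast
      consider "v = q1" | "u = q1" | "v = q2" "u = q2" | "v = q2" "u \<noteq> q2" "u \<noteq> q1" | "v \<noteq> q2" "v \<noteq> q1" "u = q2"
        | "u \<noteq> q1" "u \<noteq> q2" "v \<noteq> q1" "v \<noteq> q2" by blast
      thus ?thesis
      proof cases
        case 1 thus ?thesis unfolding S in_resB[OF c1] in_resB[OF c2] by simp
      next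
        case 2 thus ?thesis unfolding S in_resB[OF c1] in_resB[OF c2] by simp
      next
        case 3 thus ?thesis unfolding S in_resB[OF c1] in_resB[OF c2] using ne irr confB_facts[OF c1] confB_facts[OF c2] by auto
      next
        case 4 thus ?thesis unfolding S in_resB[OF c1] in_resB[OF c2] using ne nb[of u] sy by auto
      next
        case 5 thus ?thesis unfolding S in_resB[OF c1] in_resB[OF c2] using ne nb[of v] by auto
      next
        case 6 thus ?thesis unfolding S in_resB[OF c1] in_resB[OF c2] using e[of u v] by simp
      qed
    qed
  qed simp
  have overlap: "conn (resB S p1 q1 r1) (resB S p2 q2 r2)"
    if c1: "confB N p1 q1 r1 s1 x1 y1" and c2: "confB N p2 q2 r2 s2 x2 y2" and V: "q1 \<in> V" "q2 \<in> V" and ne: "q1 \<noteq> q2"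
      and q: "q1 \<in> {p2,r2,s2}" for p1 q1 r1 s1 x1 y1 p2 q2 r2 s2 x2 y2
  proof -
    \<comment> \<open>The middles are the inner vertices of a path \<open>r1\<close>,
      \<open>q1\<close>, \<open>q2\<close>, \<open>r2\<close> that is joined completely to one
      vertex \<open>s1\<close>. Deleting either of them leaves a path from \<open>r1\<close> to
      \<open>r2\<close> with one inner vertex.\<close>
    have path: "conn (resB S p1 q1 r1) (resB S p2 q2 r2)"
      if c1: "confB N p1 q1 r1 s1 x1 y1" and c2: "confB N p2 q2 r2 s2 x2 y2"
        and q: "q1 = p2" "q2 = p1" for p1 q1 r1 s1 x1 y1 p2 q2 r2 s2 x2 y2
    proof -
      note C = confB_facts[OF c1] and D = confB_facts[OF c2]
      have "s2 \<in> N q1" "s2 \<in> N p1" "s2 \<noteq> p1" using D(1,2,8) q by auto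
      hence s: "s2 = s1" using C(2,18) by auto
      have "r2 \<in> N p1" "r2 \<noteq> q1" "r2 \<noteq> s2" using D(2,5,9) q by auto
      hence x: "r2 = x1" using C(1) s by auto
      have "resB S p1 q1 r1 \<approx> resB S p2 q2 r2"
      proof (rule iso[OF c1 c2])
        show "q1 \<in> V" "q2 \<in> V" using wf_ngraphD(2)[OF wf, of _ q2] wf_ngraphD(2)[OF wf, of _ q1] C(1) C(2) q by (auto simp: S)
        have N: "q2 \<in> N v \<longleftrightarrow> v \<in> {q1,s1,x1}" "q1 \<in> N v \<longleftrightarrow> v \<in> {p1,r1,s1}" for v using sym C(1,2) q by blast+
        show "q2 \<in> N v \<or> v = p1 \<and> q2 = r1 \<or> v = r1 \<and> q2 = p1 \<longleftrightarrow>
          q1 \<in> N v \<or> v = p2 \<and> q1 = r2 \<or> v = r2 \<and> q1 = p2" if "v \<noteq> q1" "v \<noteq> q2" for v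
          unfolding N using that q s x C D by auto
      qed (use q C(4) in auto)
      thus ?thesis by (rule conn_iso)
    qed
    note C = confB_facts[OF c1] and D = confB_facts[OF c2]
    show ?thesis
    proof (cases "q1 = s2")
      case True
      \<comment> \<open>In this case the two middles are adjacent twins: \<open>q2\<close> is
        \<open>s1\<close>, and both are joined to the same two ends.\<close>
      have P: "{p2,q2,r2} = {p1,r1,s1}"
      proof -
        have "p2 \<in> N s2" "q2 \<in> N s2" "r2 \<in> N s2" using D(1-3) by (auto intro: sym)
        hence "{p2,q2,r2} \<subseteq> {p1,r1,s1}" using C(2) True by simp
        moreover have "card {p2,q2,r2} = 3" "card {p1,r1,s1} = 3" using C D by auto
        ultimately show ?thesis by (intro card_subset_eq) auto
      qed
      have sN: "p1 \<in> N s1" "r1 \<in> N s1" using C(1,3) sym by auto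
      have "s1 \<noteq> p2"
      proof
        assume "s1 = p2"
        hence "r2 = p1 \<or> r2 = r1" using P D(5) by blast
        thus False using sN D(19) \<open>s1 = p2\<close> C(1,3) by auto
      qed
      moreover have "s1 \<noteq> r2"
      proof
        assume "s1 = r2"
        hence "p2 = p1 \<or> p2 = r1" using P D(5) by blast
        thus False using sN D(18) \<open>s1 = r2\<close> C(1,3) by auto
      qed
      ultimately have "q2 = s1" using P by blast
      have pr: "{p2,r2} = {p1,r1}"
      proof -
        have "{p2,r2} = {p2,q2,r2} - {q2}" using D(4,7) by auto
        also have "\<dots> = {p1,r1}" using P \<open>q2 = s1\<close> C(6,9) by auto
        finally show ?thesis .
      qed
      have N: "N s1 = {p1,r1,q1}" using D(2) \<open>q2 = s1\<close> True pr by auto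
      have "resB S p1 q1 r1 \<approx> resB S p2 q2 r2"
      proof (rule iso[OF c1 c2 V ne])
        have N': "q2 \<in> N v \<longleftrightarrow> v \<in> {p1,r1,q1}" "q1 \<in> N v \<longleftrightarrow> v \<in> {p1,r1,q2}" for v using sym C(2) N \<open>q2 = s1\<close> by blast+
        show "q2 \<in> N v \<or> v = p1 \<and> q2 = r1 \<or> v = r1 \<and> q2 = p1 \<longleftrightarrow>
          q1 \<in> N v \<or> v = p2 \<and> q1 = r2 \<or> v = r2 \<and> q1 = p2" if "v \<noteq> q1" "v \<noteq> q2" for v
          unfolding N' using that C D True \<open>q2 = s1\<close> by auto
      qed (use pr in \<open>auto simp: doubleton_eq_iff\<close>)
      thus ?thesis by (rule conn_iso)
    next
      case False
      have sN: "p1 \<in> N s1" "r1 \<in> N s1" "q1 \<in> N s1" using C(1,2,3) sym by auto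
      obtain p3 r3 x3 y3 where 3: "confB N p3 q2 r3 s2 x3 y3" "resB S p3 q2 r3 = resB S p2 q2 r2" "q1 = p3"
        using q False c2 confB_swap[OF c2] resB_swap by (metis insert_iff singletonD)
      note E = confB_facts[OF 3(1)]
      \<comment> \<open>Otherwise \<open>p1\<close> and \<open>r1\<close> would be the two further
        neighbours \<open>r3\<close>, \<open>s2\<close> of \<open>q2\<close>, and the ends
        \<open>p3\<close> and \<open>r3\<close> would be adjacent.\<close>
      have "q2 \<noteq> s1"
      proof
        assume "q2 = s1"
        have "s2 \<in> N q1" using E(1) 3(3) by simp
        hence "s2 = p1 \<or> s2 = r1" using C(2) E(8) \<open>q2 = s1\<close> by auto
        moreover have "p1 = r3 \<or> p1 = s2" "r1 = r3 \<or> r1 = s2"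
          using E(2) sN(1,2) \<open>q2 = s1\<close> 3(3) C(4,7) by auto
        ultimately have "r3 = p1 \<or> r3 = r1" using C(5) by auto
        thus False using E(18) C(2) 3(3) by auto
      qed
      hence "q2 \<in> {p1,r1}" using E(1) C(2) 3(3) by auto
      then obtain p4 r4 x4 y4 where 4: "confB N p4 q1 r4 s1 x4 y4" "resB S p4 q1 r4 = resB S p1 q1 r1" "q2 = p4"
        using c1 confB_swap[OF c1] resB_swap by (metis insert_iff singletonD)
      show ?thesis using path[OF 4(1) 3(1) 3(3) 4(3)] 3(2) 4(2) by simp
    qed
  qed
  consider "q = q'" | "q \<noteq> q'" "q \<in> {p',r',s'}" | "q \<noteq> q'" "q' \<in> {p,r,s}"
    | "q \<noteq> q'" "{p',r'} = {p,r}" | "q \<noteq> q'" "q \<notin> {p',r',s'}" "q' \<notin> {p,r,s}" "{p',r'} \<noteq> {p,r}" by blast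
  thus ?thesis
  proof cases
    case 1
    have sN: "p \<in> N s" "r \<in> N s" "p' \<in> N s'" "r' \<in> N s'" using B(1,3) B'(1,3) sym by auto
    have P: "{p',r',s'} = {p,r,s}" using B(2) B'(2) 1 by simp
    \<comment> \<open>Among the neighbours of \<open>q\<close>, the vertex \<open>s\<close> is
      determined as the one that sees both others.\<close>
    have "s \<noteq> p'"
    proof
      assume "s = p'"
      hence "r' = p \<or> r' = r" using P B'(5) by blast
      thus False using sN B'(19) \<open>s = p'\<close> B(1,3) by auto
    qed
    moreover have "s \<noteq> r'"
    proof
      assume "s = r'"
      hence "p' = p \<or> p' = r" using P B'(5) by blast
      thus False using sN B'(18) \<open>s = r'\<close> B(1,3) by auto
    qed
    ultimately have "s' = s" using P by blast
    have "{p',r'} = {p',r',s'} - {s'}" using B'(6,9) by auto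
    also have "\<dots> = {p,r}" using P \<open>s' = s\<close> B(6,9) by auto
    finally have "{p',r'} = {p,r}" .
    hence "resB S p q r = resB S p' q' r'" using 1 resB_swap[of S] by (auto simp: doubleton_eq_iff)
    thus ?thesis using conn_iso ngraph_iso_refl by metis
  next
    case 2 thus ?thesis using overlap[OF cN cN' V] by blast
  next
    case 3 thus ?thesis using overlap[OF cN' cN V(2,1)] conn_sym by blast
  next
    case 4
    have sN: "p \<in> N s" "r \<in> N s" "q \<in> N s" "p' \<in> N s'" "r' \<in> N s'" "q' \<in> N s'" using B(1,2,3) B'(1,2,3) sym by auto
    have q': "q' \<in> N p" "q' \<in> N r" "s' \<in> N p" "s' \<in> N r" using B'(1,3) 4(2) by (auto simp: doubleton_eq_iff)
    have Nq': "N q' = {p,r,s'}" using B'(2) 4(2) by (auto simp: doubleton_eq_iff)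
    have pr: "p' = p \<and> r' = r \<or> p' = r \<and> r' = p" using 4(2) by (auto simp: doubleton_eq_iff)
    \<comment> \<open>Common ends make \<open>q\<close> and \<open>q'\<close> twins, adjacent if
      \<open>q' = s\<close> and nonadjacent otherwise.\<close>
    have "resB S p q r \<approx> resB S p' q' r'"
    proof (cases "q' = s")
      case True
      have "s' = q" using sN(3) True Nq' B(4,7) by auto
      hence "N q' = {p,r,q}" "N q = {p,r,q'}" using Nq' True B(2) by auto
      hence N': "q' \<in> N v \<longleftrightarrow> v \<in> {p,r,q}" "q \<in> N v \<longleftrightarrow> v \<in> {p,r,q'}" for v
        using sym by blast+
      show ?thesis
      proof (rule iso[OF cN cN' V 4(1)])
        show "q' \<in> N v \<or> v = p \<and> q' = r \<or> v = r \<and> q' = p \<longleftrightarrow>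
          q \<in> N v \<or> v = p' \<and> q = r' \<or> v = r' \<and> q = p'" if "v \<noteq> q" "v \<noteq> q'" for v
          unfolding N' using that pr B(4-9) B'(4-9) by auto
      qed (use 4(2) in \<open>auto simp: doubleton_eq_iff\<close>)
    next
      case False
      hence x: "q' = x" "q' = y" using q'(1,2) B(1,3) 4(1) by auto
      have "s' \<in> {q,s}" using q'(3) B(1) x B'(8) by auto
      moreover have "s' \<noteq> q" using sN(6) B(2,10,12) x(1) False by auto
      ultimately have "s' = s" by simp
      have N': "q' \<in> N v \<longleftrightarrow> v \<in> {p,r,s}" "q \<in> N v \<longleftrightarrow> v \<in> {p,r,s}" for v
      proof -
        have "q' \<in> N v \<longleftrightarrow> v \<in> N q'" "q \<in> N v \<longleftrightarrow> v \<in> N q" using sym by blast+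
        thus "q' \<in> N v \<longleftrightarrow> v \<in> {p,r,s}" "q \<in> N v \<longleftrightarrow> v \<in> {p,r,s}"
          using Nq' B(2) \<open>s' = s\<close> by simp_all
      qed
      show ?thesis
      proof (rule iso[OF cN cN' V 4(1)])
        show "q' \<in> N v \<or> v = p \<and> q' = r \<or> v = r \<and> q' = p \<longleftrightarrow>
          q \<in> N v \<or> v = p' \<and> q = r' \<or> v = r' \<and> q = p'" if "v \<noteq> q" "v \<noteq> q'" for v
          unfolding N' using that pr B(4-9) B'(4-9) by auto
      qed (use 4(2) in \<open>auto simp: doubleton_eq_iff\<close>)
    qed
    thus ?thesis by (rule conn_iso)
  next
    case 5
    \<comment> \<open>In the second pattern only the third neighbour of an end can change. An end
      that loses \<open>q1\<close> is also an end of the first pattern and gains the opposite end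
      instead; this is not the other end of the second pattern, because the pairs of ends
      differ.\<close>
    have pers: "\<exists>x3 y3. confB (snd (resB S p1 q1 r1)) p2 q2 r2 s2 x3 y3"
      if c1: "confB N p1 q1 r1 s1 x1 y1" and c2: "confB N p2 q2 r2 s2 x2 y2" and ne: "q1 \<noteq> q2"
        "q1 \<notin> {p2,r2,s2}" "q2 \<notin> {p1,r1,s1}" "{p2,r2} \<noteq> {p1,r1}"
      for p1 q1 r1 s1 x1 y1 p2 q2 r2 s2 x2 y2
    proof -
      note C = confB_facts[OF c1] and D = confB_facts[OF c2]
      let ?N = "snd (resB S p1 q1 r1)"
      have N: "u \<in> ?N v \<longleftrightarrow> v \<noteq> q1 \<and> u \<noteq> q1 \<and> (u \<in> N v \<or> v = p1 \<and> u = r1 \<or> v = r1 \<and> u = p1)" for u v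
        unfolding S in_resB[OF c1] by (rule refl)
      have q: "q1 \<in> N v \<longleftrightarrow> v \<in> {p1,r1,s1}" for v using C(2) sym by blast
      have corner: "\<exists>x3. ?N p3 = {q2,s2,x3} \<and> x3 \<notin> {p3,q2,r3,s2}"
        if p3: "N p3 = {q2,s2,x0}" "x0 \<notin> {p3,q2,r3,s2}" "q1 \<noteq> p3" "{p3,r3} \<noteq> {p1,r1}" "p3 \<noteq> q2" "p3 \<noteq> r3" "p3 \<noteq> s2" for p3 r3 x0
      proof (cases "x0 = q1")
        case True
        have "p3 \<noteq> s1"
        proof
          assume "p3 = s1"
          hence "p1 \<in> N p3" "r1 \<in> N p3" using C(1,3) by (auto intro: sym)
          hence "p1 = s2" "r1 = s2" using p3(1) True C(4,7) ne(3) by auto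
          thus False using C(5) by simp
        qed
        hence "p3 = p1 \<or> p3 = r1" using q[of p3] p3(1) True by auto
        thus ?thesis
        proof
          assume *: "p3 = p1"
          have "?N p3 = {q2,s2,r1}" unfolding set_eq_iff N using p3 * True C(4-9) ne by auto
          moreover have "r1 \<notin> {p3,q2,r3,s2}" using * C(5,18) ne(3) p3(1,4) by auto
          ultimately show ?thesis by blast
        next
          assume *: "p3 = r1"
          have "?N p3 = {q2,s2,p1}" unfolding set_eq_iff N using p3 * True C(4-9) ne by auto
          moreover have "p1 \<notin> {p3,q2,r3,s2}" using * C(5,19) ne(3) p3(1,4) by auto
          ultimately show ?thesis by blast
        qed
      next
        case False
        hence "p3 \<notin> {p1,r1}" using q[of p3] p3(1) ne by auto
        hence "?N p3 = {q2,s2,x0}" unfolding set_eq_iff N using p3 False ne by auto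
        thus ?thesis using p3(2) by blast
      qed
      obtain x3 where 3: "?N p2 = {q2,s2,x3}" "x3 \<notin> {p2,q2,r2,s2}"
        using corner[of p2 x2 r2] D ne by auto
      obtain y3 where 4: "?N r2 = {q2,s2,y3}" "y3 \<notin> {r2,q2,p2,s2}"
        using corner[of r2 y2 p2] D ne by (auto simp: insert_commute)
      have "?N q2 = {p2,r2,s2}" unfolding set_eq_iff N using D(2) ne by auto
      hence "confB ?N p2 q2 r2 s2 x3 y3" using 3 4 D(4-9) by (auto simp: confB_def)
      thus ?thesis by blast
    qed
    obtain x3 y3 where 3: "confB (snd (resB S p q r)) p' q' r' s' x3 y3" using pers[OF cN cN' 5] by blast
    have "{p,r} \<noteq> {p',r'}" using 5(4) by simp
    then obtain x4 y4 where 4: "confB (snd (resB S p' q' r')) p q r s x4 y4"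
      using pers[OF cN' cN 5(1)[symmetric] 5(3,2)] by blast
    have "snd (resB (resB S p q r) p' q' r') v = snd (resB (resB S p' q' r') p q r) v" for v
      using 5 by (auto simp: resB_def)
    hence "resB (resB S p q r) p' q' r' = resB (resB S p' q' r') p q r"
      by (intro prod_eqI ext) (auto simp: resB_def)
    thus ?thesis using stepB[OF 3] stepB[OF 4] conn_step by metis
  qed
qed

lemma conn_steps:
  assumes "wf_ngraph S" "step S T" "step S T'" shows "conn T T'"
  using assms(2)
proof cases
  case A: (stepA p q r x y z)
  from assms(3) show ?thesis
    by cases (use A conn_AA[OF assms(1)] conn_AB[OF assms(1)] in \<open>simp; blast\<close>)+
next
  case B: (stepB p q r s x y)
  from assms(3) show ?thesis
    by cases (use B conn_sym[OF conn_AB[OF assms(1)]] conn_BB[OF assms(1)] in \<open>simp; blast\<close>)+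
qed

section \<open>Greedy reduction\<close>

lemma card_step:
  assumes wf: "wf_ngraph S" and "step S T" shows "card (fst T) < card (fst S)"
  using assms(2)
proof cases
  case (stepA p q r x y z)
  have "q \<in> fst S" using wf_ngraphD(2)[OF wf, of q p] stepA(2) by (simp add: confA_def)
  hence "fst T \<subset> fst S" using stepA(1) by (auto simp: resA_def)
  thus ?thesis using wf_ngraphD(1)[OF wf] by (rule psubset_card_mono[rotated])
next
  case (stepB p q r s x y)
  have "q \<in> fst S" using wf_ngraphD(2)[OF wf, of q p] stepB(2) by (simp add: confB_def)
  hence "fst T \<subset> fst S" using stepB(1) by (auto simp: resB_def)
  thus ?thesis using wf_ngraphD(1)[OF wf] by (rule psubset_card_mono[rotated])
qed

section \<open>Properties of K4\<close>

lemma isomorphic_K4_iff: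
  assumes wf: "wf_ngraph S"
  shows "isomorphic (ugraph_of S) (complete_graph 4) \<longleftrightarrow> card (fst S) = 4 \<and> (\<forall>v\<in>fst S. snd S v = fst S - {v})"
proof -
  have vK: "verts (complete_graph 4) = {..<4}" and eK: "edges (complete_graph 4) = {e. e \<subseteq> {..<4} \<and> card e = 2}"
    by (simp_all add: complete_graph_def verts_def edges_def)
  show ?thesis
  proof
    assume "isomorphic (ugraph_of S) (complete_graph 4)"
    then obtain f where f: "bij_betw f (fst S) {..<4::nat}"
      "{e. e \<subseteq> {..<4} \<and> card e = 2} = (\<lambda>e. f ` e) ` edges (ugraph_of S)"
      unfolding isomorphic_def vK eK by auto
    have "card (fst S) = 4" using bij_betw_same_card[OF f(1)] by simp
    moreover have "snd S v = fst S - {v}" if v: "v \<in> fst S" for v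
    proof
      show "snd S v \<subseteq> fst S - {v}" using wf_ngraphD(2,4)[OF wf] by blast
      show "fst S - {v} \<subseteq> snd S v"
      proof
        fix u assume u: "u \<in> fst S - {v}"
        have inj: "inj_on f (fst S)" using f(1) by (simp add: bij_betw_def)
        have "f u \<noteq> f v" "f u < 4" "f v < 4" using u v inj f(1) by (auto dest: inj_onD bij_betwE)
        hence "{f u, f v} \<in> {e. e \<subseteq> {..<4} \<and> card e = 2}" by simp
        then obtain e where e: "e \<in> edges (ugraph_of S)" "{f u, f v} = f ` e" unfolding f(2) by blast
        then obtain a b where ab: "e = {a,b}" "b \<in> snd S a" by (auto simp: ugraph_of_def edges_def)
        have in1: "a \<in> fst S" "b \<in> fst S" using wf_ngraphD(2,3)[OF wf] ab(2) by blast+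
        have "f u = f a \<and> f v = f b \<or> f u = f b \<and> f v = f a" using e(2) ab(1) by (auto simp: doubleton_eq_iff)
        hence "u = a \<and> v = b \<or> u = b \<and> v = a" using inj_onD[OF inj] in1 u v by blast
        thus "u \<in> snd S v" using ab(2) wf_ngraphD(3)[OF wf] by blast
      qed
    qed
    ultimately show "card (fst S) = 4 \<and> (\<forall>v\<in>fst S. snd S v = fst S - {v})" by blast
  next
    assume *: "card (fst S) = 4 \<and> (\<forall>v\<in>fst S. snd S v = fst S - {v})"
    obtain f where f: "bij_betw f (fst S) {..<4::nat}"
      using ex_bij_betw_finite_nat[OF wf_ngraphD(1)[OF wf]] * by (auto simp: atLeast0LessThan)
    have E: "edges (ugraph_of S) = {e. e \<subseteq> fst S \<and> card e = 2}"
    proof (intro set_eqI iffI)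
      fix e assume "e \<in> edges (ugraph_of S)"
      thus "e \<in> {e. e \<subseteq> fst S \<and> card e = 2}"
        using simple_ugraph_of[OF wf] by (auto simp: simple_graph_def)
    next
      fix e assume "e \<in> {e. e \<subseteq> fst S \<and> card e = 2}"
      then obtain a b where "e = {a,b}" "a \<noteq> b" "a \<in> fst S" "b \<in> fst S" by (auto simp: card_2_iff)
      moreover from this have "b \<in> snd S a" using * by blast
      ultimately show "e \<in> edges (ugraph_of S)" by (auto simp: ugraph_of_def edges_def)
    qed
    have inj: "inj_on f (fst S)" and im: "f ` fst S = {..<4}" using f by (auto simp: bij_betw_def)
    have "{e. e \<subseteq> {..<4} \<and> card e = 2} = (\<lambda>e. f ` e) ` {e. e \<subseteq> fst S \<and> card e = 2}"
    proof (intro set_eqI iffI)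
      fix e assume e: "e \<in> {e. e \<subseteq> {..<4::nat} \<and> card e = 2}"
      then obtain e' where e': "e' \<subseteq> fst S" "e = f ` e'" unfolding im[symmetric] by (auto simp: subset_image_iff)
      moreover have "card e' = card e" using e' inj by (simp add: card_image inj_on_subset)
      ultimately show "e \<in> (\<lambda>e. f ` e) ` {e. e \<subseteq> fst S \<and> card e = 2}" using e by auto
    next
      fix e assume "e \<in> (\<lambda>e. f ` e) ` {e. e \<subseteq> fst S \<and> card e = 2}"
      then obtain e' where e': "e' \<subseteq> fst S" "e = f ` e'" "card e' = 2" by blast
      moreover have "card e = card e'" using e' inj by (simp add: card_image inj_on_subset)
      ultimately show "e \<in> {e. e \<subseteq> {..<4} \<and> card e = 2}" using im by auto
    qed
    thus "isomorphic (ugraph_of S) (complete_graph 4)"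
      unfolding isomorphic_def vK eK E verts_ugraph_of using f by blast
  qed
qed

text \<open>Guarantees that a reducible graph with an available step also has a step to a reducible
  graph, the starting point of the confluence argument. D3a would need nonadjacent \<open>p\<close>
  and \<open>y\<close>, and D3b needs nonadjacent ends.\<close>

lemma no_step_K4:
  assumes wf: "wf_ngraph S" and K: "isomorphic (ugraph_of S) (complete_graph 4)"
  shows "\<not> step S T"
proof
  have c: "card (fst S) = 4" and N: "\<And>v. v \<in> fst S \<Longrightarrow> snd S v = fst S - {v}"
    using K isomorphic_K4_iff[OF wf] by auto
  assume "step S T"
  thus False
  proof cases
    case (stepA p q r x y z)
    hence A: "snd S p = {q,r,x}" "snd S q = {p,r,y}" "distinct [p,q,r,x,y,z]" by (auto simp: confA_def)
    have V: "p \<in> fst S" "q \<in> fst S" using wf_ngraphD(2)[OF wf, of _ q] wf_ngraphD(2)[OF wf, of _ p] A by auto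
    have "y \<in> snd S p" using N[OF V(1)] N[OF V(2)] A by auto
    thus False using A by auto
  next
    case (stepB p q r s x y)
    note B = confB_facts[OF stepB(2)]
    have V: "p \<in> fst S" "r \<in> fst S" using wf_ngraphD(2)[OF wf, of _ q] B(2) by auto
    thus False using N[OF V(1)] B(5,18) by auto
  qed
qed

section \<open>Invariance of reducibility along single steps\<close>

lemma D3_reducible_unfold:
  "D3_reducible G \<longleftrightarrow> isomorphic G (complete_graph 4) \<or> (\<exists>H. D3_step G H \<and> D3_reducible H)"
proof
  assume "D3_reducible G"
  then obtain K where K: "D3_step\<^sup>*\<^sup>* G K" "isomorphic K (complete_graph 4)" unfolding D3_reducible_def by blast
  from K(1) show "isomorphic G (complete_graph 4) \<or> (\<exists>H. D3_step G H \<and> D3_reducible H)"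
    by (cases rule: converse_rtranclpE) (use K(2) in \<open>unfold D3_reducible_def, blast+\<close>)
next
  assume "isomorphic G (complete_graph 4) \<or> (\<exists>H. D3_step G H \<and> D3_reducible H)"
  thus "D3_reducible G" unfolding D3_reducible_def by (meson converse_rtranclp_into_rtranclp rtranclp.rtrancl_refl)
qed

lemma reducible_if_step:
  fixes S :: "nat ngraph"
  assumes wf: "wf_ngraph S" and "step S T" and T: "D3_reducible (ugraph_of T)"
  shows "D3_reducible (ugraph_of S)"
proof -
  obtain T' where "D3_step (ugraph_of S) (ugraph_of T')" "T \<approx> T'"
    using step_imp_D3_step[OF assms(2) wf] by auto
  thus ?thesis using T reducible_iso D3_reducible_unfold by blast
qed

lemma reducible_cases:
  fixes S :: "nat ngraph"
  assumes wf: "wf_ngraph S" and red: "D3_reducible (ugraph_of S)"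
  shows "isomorphic (ugraph_of S) (complete_graph 4) \<or> (\<exists>T. step S T \<and> D3_reducible (ugraph_of T))"
proof -
  from red consider "isomorphic (ugraph_of S) (complete_graph 4)"
    | H where "D3_step (ugraph_of S) H" "D3_reducible H" using D3_reducible_unfold by blast
  thus ?thesis
  proof cases
    case 2
    obtain T T' where "step S T" "H = ugraph_of T'" "T \<approx> T'" using D3_step_imp_step[OF 2(1) wf] by blast
    thus ?thesis using 2(2) reducible_iso by blast
  qed blast
qed

lemma wf_iso: assumes "S \<approx> T" "wf_ngraph S" shows "wf_ngraph T"
proof -
  obtain f where f: "bij f" "fst T = f ` fst S" "\<And>v. snd T (f v) = f ` snd S v"
    using assms(1) unfolding ngraph_iso_def by blast
  have i: "inj f" using f(1) by (rule bij_is_inj)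
  have "snd T v \<subseteq> fst T - {v}" for v
  proof -
    obtain v' where v: "v = f v'" using f(1) by (metis bij_pointE)
    have "snd S v' \<subseteq> fst S - {v'}" using assms(2) by (simp add: wf_ngraph_def)
    thus ?thesis unfolding v f(2,3) using i by (auto dest: injD)
  qed
  moreover have "u \<in> snd T v" if "v \<in> snd T u" for u v
  proof -
    obtain v' u' where v: "v = f v'" "u = f u'" using f(1) by (metis bij_pointE)
    have "v' \<in> snd S u'" using that unfolding v f(3) using i by (auto dest: injD)
    hence "u' \<in> snd S v'" by (rule wf_ngraphD(3)[OF assms(2)])
    thus ?thesis unfolding v f(3) by blast
  qed
  ultimately show ?thesis using wf_ngraphD(1)[OF assms(2)] f(2) unfolding wf_ngraph_def by simp
qed

lemma card_iso: "S \<approx> T \<Longrightarrow> card (fst S) = card (fst T)"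
  unfolding ngraph_iso_def by (metis bij_is_inj card_image inj_on_subset subset_UNIV)

text \<open>Newman's induction. The given step to \<open>T\<close> and a successful step to
  \<open>T1\<close> meet after at most one more step, up to isomorphism. Reducibility passes from
  \<open>A\<close> down to the meeting point by induction and up to \<open>B\<close> by
  \<open>reducible_if_step\<close>.\<close>

lemma reducible_step:
  fixes S :: "nat ngraph"
  shows "wf_ngraph S \<Longrightarrow> step S T \<Longrightarrow> D3_reducible (ugraph_of S) \<Longrightarrow> D3_reducible (ugraph_of T)"
proof (induction "card (fst S)" arbitrary: S T rule: less_induct)
  case less
  note wf = less.prems(1)
  obtain T1 where T1: "step S T1" "D3_reducible (ugraph_of T1)"
    using reducible_cases[OF wf less.prems(3)] no_step_K4[OF wf] less.prems(2) by blast
  obtain A B where AB: "T1 \<approx> A" "T \<approx> B" "A = B \<or> (\<exists>U. step A U \<and> step B U)"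
    using conn_steps[OF wf T1(1) less.prems(2)] unfolding conn_def by blast
  have A: "D3_reducible (ugraph_of A)" using reducible_iso[OF AB(1)] T1(2) by simp
  have wfAB: "wf_ngraph A" "wf_ngraph B"
    using wf_iso AB wf_step[OF T1(1) wf] wf_step[OF less.prems(2) wf] by blast+
  have "card (fst A) < card (fst S)" using card_step[OF wf T1(1)] card_iso[OF AB(1)] by simp
  hence "D3_reducible (ugraph_of B)"
    using AB(3) A less.hyps[of A] wfAB reducible_if_step by blast
  thus ?case using reducible_iso[OF AB(2)] by simp
qed

text \<open>With \<open>v\<close> a corner or the middle vertex, its three neighbours fill the roles
  \<open>q\<close>, \<open>r\<close>, \<open>x\<close> or \<open>p\<close>, \<open>r\<close>,
  \<open>s\<close>, so a bounded search at \<open>v\<close> settles the question.\<close>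

definition anchor :: "('a \<Rightarrow> 'a set) \<Rightarrow> 'a \<Rightarrow> bool" where
  "anchor N v \<longleftrightarrow> (\<exists>q r x y z. confA N v q r x y z) \<or> (\<exists>p r s x y. confB N p v r s x y)"

definition triggered :: "('a \<Rightarrow> 'a set) \<Rightarrow> 'a \<Rightarrow> 'a \<Rightarrow> 'a \<Rightarrow> 'a \<Rightarrow> bool" where
  "triggered N v a b c \<longleftrightarrow> (\<exists>y z. confA N v a b c y z) \<or> (\<exists>x y. confB N a v b c x y)"

text \<open>In both patterns two neighbours have interchangeable roles. Only the choice of the third
  matters, so three rotations replace the six orders.\<close>

lemma anchor_triggered:
  assumes "anchor N v" "N v = {a, b, c}" "distinct [a,b,c]"
  shows "triggered N v a b c \<or> triggered N v b c a \<or> triggered N v c a b"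
proof -
  have sw: "triggered N v a b c \<longleftrightarrow> triggered N v b a c" for a b c
    unfolding triggered_def by (blast intro: confA_swap confB_swap)
  from assms(1) obtain q r x where t: "triggered N v q r x" unfolding anchor_def triggered_def by blast
  hence "N v = {q,r,x}" "distinct [q,r,x]" unfolding triggered_def confA_def confB_def by auto
  hence "q \<in> {a,b,c}" "r \<in> {a,b,c}" "x \<in> {a,b,c}" "q \<noteq> r" "q \<noteq> x" "r \<noteq> x" using assms(2) by auto
  hence "q = a \<and> r = b \<and> x = c \<or> q = b \<and> r = a \<and> x = c \<or> q = a \<and> r = c \<and> x = b \<or> q = c \<and> r = a \<and> x = b
     \<or> q = b \<and> r = c \<and> x = a \<or> q = c \<and> r = b \<and> x = a" by blast
  thus ?thesis using t sw by metis
qed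

text \<open>A pattern anchored at \<open>v\<close> reads only the neighbour sets of \<open>v\<close>
  and of two of its neighbours, all of size three. A new anchor needs a change in one of
  them.\<close>

lemma anchor_local:
  assumes "anchor N' v" "\<not> anchor N v"
  shows "\<exists>c. N' c \<noteq> N c \<and> card (N' c) = 3 \<and> (v = c \<or> v \<in> N' c)"
proof (rule ccontr)
  assume no: "\<not> ?thesis"
  from assms(1) consider q r x y z where "confA N' v q r x y z" | p r s x y where "confB N' p v r s x y"
    unfolding anchor_def by blast
  thus False
  proof cases
    case 1
    hence c: "N' v = {q,r,x}" "N' q = {v,r,y}" "N' r = {v,q,z}" "distinct [v,q,r,x,y,z]"
      by (auto simp: confA_def)
    hence "card (N' v) = 3" "card (N' q) = 3" "card (N' r) = 3" "v \<in> N' q" "v \<in> N' r" by auto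
    hence "N' v = N v" "N' q = N q" "N' r = N r" using no by blast+
    hence "confA N v q r x y z" using 1 by (simp add: confA_def)
    thus False using assms(2) unfolding anchor_def by blast
  next
    case 2
    note c = confB_facts[OF 2]
    have "card (N' v) = 3" "card (N' p) = 3" "card (N' r) = 3" "v \<in> N' p" "v \<in> N' r" using c by auto
    hence "N' v = N v" "N' p = N p" "N' r = N r" using no by blast+
    hence "confB N p v r s x y" using 2 by (simp add: confB_def)
    thus False using assms(2) unfolding anchor_def by blast
  qed
qed

text \<open>Without anchors there is no step, so success means being K4 already. On four vertices
  degree three is adjacency to all others, hence two counts replace the isomorphism test.\<close>

lemma reducible_irreducible:
  fixes S :: "nat ngraph"
  assumes wf: "wf_ngraph S" and no: "\<forall>v\<in>fst S. \<not> anchor (snd S) v"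
  shows "D3_reducible (ugraph_of S) \<longleftrightarrow> card (fst S) = 4 \<and> card {v \<in> fst S. card (snd S v) = 3} = 4"
proof -
  have "\<not> step S T" for T
  proof
    assume "step S T"
    thus False
    proof cases
      case (stepA p q r x y z)
      hence "p \<in> fst S" "anchor (snd S) p"
        using wf_ngraphD(2)[OF wf, of p q] unfolding anchor_def by (simp add: confA_def, blast)
      thus False using no by blast
    next
      case (stepB p q r s x y)
      hence "q \<in> fst S" "anchor (snd S) q"
        using wf_ngraphD(2)[OF wf, of q p] unfolding anchor_def by (simp add: confB_def, blast)
      thus False using no by blast
    qed
  qed
  hence "D3_reducible (ugraph_of S) \<longleftrightarrow> isomorphic (ugraph_of S) (complete_graph 4)"
    using reducible_cases[OF wf] D3_reducible_unfold by blast
  also have "\<dots> \<longleftrightarrow> card (fst S) = 4 \<and> card {v \<in> fst S. card (snd S v) = 3} = 4"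
  proof (cases "card (fst S) = 4")
    case True
    have f: "finite (fst S)" by (rule wf_ngraphD(1)[OF wf])
    have "card (snd S v) = 3 \<longleftrightarrow> snd S v = fst S - {v}" if v: "v \<in> fst S" for v
    proof -
      have "snd S v \<subseteq> fst S - {v}" using wf_ngraphD(2,4)[OF wf] by blast
      moreover have "card (fst S - {v}) = 3" using True v f by simp
      moreover have "finite (fst S - {v})" using f by simp
      ultimately show ?thesis by (metis card_subset_eq)
    qed
    hence "(\<forall>v\<in>fst S. snd S v = fst S - {v}) \<longleftrightarrow> {v \<in> fst S. card (snd S v) = 3} = fst S" by auto
    also have "\<dots> \<longleftrightarrow> card {v \<in> fst S. card (snd S v) = 3} = 4"
      using True f card_subset_eq[of "fst S" "{v \<in> fst S. card (snd S v) = 3}"] by auto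
    finally show ?thesis unfolding isomorphic_K4_iff[OF wf] using True by simp
  qed (simp add: isomorphic_K4_iff[OF wf])
  finally show ?thesis .
qed

section \<open>Preconditions for loop-free programs\<close>

text \<open>Symbolic addresses: programs are verified over functions on \<open>loc\<close>, and the
  disjointness of the memory regions enters only through \<open>addr_inject\<close>.\<close>

datatype loc = Inp nat | Deg nat | Row nat | Nb nat nat | Pos nat nat | Stk nat

type_synonym lmem = "loc \<Rightarrow> nat"

text \<open>Worst case over branches. The value at loops is a dummy, as \<open>awp\<close> is false
  on them.\<close>

primrec cost :: "prog \<Rightarrow> nat" where
  "cost Skip = 1" | "cost (Const i a) = 1" | "cost (Copy i j) = 1" | "cost (Add i j k) = 1"
| "cost (Sub i j k) = 1" | "cost (Load i j) = 1" | "cost (Store i j) = 1"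
| "cost (Seq P Q) = cost P + cost Q" | "cost (If t P Q) = 1 + max (cost P) (cost Q)"
| "cost (While t P) = 0"

fun test_holds :: "test \<Rightarrow> (reg \<Rightarrow> nat) \<Rightarrow> bool" where
  "test_holds (Less i j) R = (R i < R j)"
| "test_holds (Equal i j) R = (R i = R j)"

lemma holds_iff: "holds t (R, M) = test_holds t R"
  by (cases t) auto

locale ram = fixes n b W :: nat
begin

text \<open>Row \<open>v\<close> takes \<open>2 * n\<close> cells, the neighbour list followed by
  the position table. \<open>Row v\<close> stores the start of this row because the machine cannot
  multiply. The stack comes last and may grow.\<close>

primrec addr :: "loc \<Rightarrow> nat" where
  "addr (Inp i) = i"
| "addr (Deg v) = b + v"
| "addr (Row v) = b + n + v"
| "addr (Nb v i) = b + 2 * n + 2 * n * v + i"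
| "addr (Pos v u) = b + 2 * n + 2 * n * v + n + u"
| "addr (Stk i) = b + 2 * n + 2 * n * n + i"

primrec valid :: "loc \<Rightarrow> bool" where
  "valid (Inp i) = (i < b)"
| "valid (Deg v) = (v < n)"
| "valid (Row v) = (v < n)"
| "valid (Nb v i) = (v < n \<and> i < n)"
| "valid (Pos v u) = (v < n \<and> u < n)"
| "valid (Stk i) = True"

lemma block_inject:
  assumes "i < 2 * n" "j < 2 * n" "2 * n * v + i = 2 * n * u + (j::nat)"
  shows "v = u \<and> i = j"
proof -
  have "(2 * n * v + i) div (2 * n) = v" "(2 * n * u + j) div (2 * n) = u"
    "(2 * n * v + i) mod (2 * n) = i" "(2 * n * u + j) mod (2 * n) = j" using assms(1,2) by simp_all
  thus ?thesis using assms(3) by metis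
qed

lemma block_bound: "v < n \<Longrightarrow> i < 2 * n \<Longrightarrow> 2 * n * v + i < 2 * n * n"
proof -
  assume v: "v < n" and i: "i < 2 * n"
  have "2 * n * Suc v \<le> 2 * n * n" using v by (intro mult_le_mono2) simp
  thus ?thesis using i by simp
qed

lemma addr_inject:
  assumes v: "valid k" "valid l" and e: "addr k = addr l" shows "k = l"
proof -
  \<comment> \<open>Lists and position tables share a tag because they are interleaved row by row;
    \<open>block_inject\<close> separates them.\<close>
  define tag where "tag l = (case l of Inp _ \<Rightarrow> 0 | Deg _ \<Rightarrow> 1 | Row _ \<Rightarrow> 2 | Nb _ _ \<Rightarrow> 3 | Pos _ _ \<Rightarrow> 3 | Stk _ \<Rightarrow> (4::nat))" for l
  have bd: "tag l = 0 \<and> addr l < b \<or> tag l = 1 \<and> b \<le> addr l \<and> addr l < b + n \<or>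
     tag l = 2 \<and> b + n \<le> addr l \<and> addr l < b + 2 * n \<or>
     tag l = 3 \<and> b + 2 * n \<le> addr l \<and> addr l < b + 2 * n + 2 * n * n \<or>
     tag l = 4 \<and> b + 2 * n + 2 * n * n \<le> addr l" if "valid l" for l
  proof (cases l)
    case (Nb v i) thus ?thesis using that block_bound[of v i] by (simp add: tag_def)
  next
    case (Pos v i) thus ?thesis using that block_bound[of v "n + i"] by (simp add: tag_def)
  qed (use that in \<open>auto simp: tag_def\<close>)
  have "tag k = tag l" using bd[OF v(1)] bd[OF v(2)] e by linarith
  thus ?thesis
  proof (cases k; cases l)
    fix a i c j assume "k = Nb a i" "l = Nb c j"
    thus ?thesis using v e block_inject[of i j a c] by simp
  next
    fix a i c j assume "k = Nb a i" "l = Pos c j"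
    thus ?thesis using v e block_inject[of i "n + j" a c] by simp
  next
    fix a i c j assume "k = Pos a i" "l = Nb c j"
    thus ?thesis using v e block_inject[of "n + i" j a c] by simp
  next
    fix a i c j assume "k = Pos a i" "l = Pos c j"
    thus ?thesis using v e block_inject[of "n + i" "n + j" a c] by simp
  qed (use e in \<open>auto simp: tag_def\<close>)
qed

definition mrel :: "(nat \<Rightarrow> nat) \<Rightarrow> lmem \<Rightarrow> bool" where
  "mrel M m \<longleftrightarrow> (\<forall>l. valid l \<longrightarrow> M (addr l) = m l)"

lemma mrel_upd: "mrel M m \<Longrightarrow> valid l \<Longrightarrow> mrel (M(addr l := x)) (m(l := x))"
  using addr_inject unfolding mrel_def by auto

text \<open>Loops are excluded here and treated by \<open>ewp\<close>, which also bounds the running time.\<close>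

primrec awp :: "prog \<Rightarrow> ((reg \<Rightarrow> nat) \<Rightarrow> lmem \<Rightarrow> bool) \<Rightarrow> (reg \<Rightarrow> nat) \<Rightarrow> lmem \<Rightarrow> bool" where
  "awp Skip Q = Q"
| "awp (Const i a) Q = (\<lambda>R m. a < W \<and> Q (R(i := a)) m)"
| "awp (Copy i j) Q = (\<lambda>R m. Q (R(i := R j)) m)"
| "awp (Add i j k) Q = (\<lambda>R m. R j + R k < W \<and> Q (R(i := R j + R k)) m)"
| "awp (Sub i j k) Q = (\<lambda>R m. Q (R(i := R j - R k)) m)"
| "awp (Load i j) Q = (\<lambda>R m. \<exists>l. valid l \<and> R j = addr l \<and> Q (R(i := m l)) m)"
| "awp (Store i j) Q = (\<lambda>R m. \<exists>l. valid l \<and> R i = addr l \<and> Q R (m(l := R j)))"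
| "awp (Seq P1 P2) Q = awp P1 (awp P2 Q)"
| "awp (If t P1 P2) Q = (\<lambda>R m. if test_holds t R then awp P1 Q R m else awp P2 Q R m)"
| "awp (While t P) Q = (\<lambda>R m. False)"

lemma awp_sound:
  "awp P Q R m \<Longrightarrow> mrel M m \<Longrightarrow>
    \<exists>t R' M' m'. exec W P (R, M) t (R', M') \<and> t \<le> cost P \<and> mrel M' m' \<and> Q R' m'"
proof (induction P arbitrary: Q R m M)
  case Skip thus ?case using exec.Skip[of W "(R, M)"] by fastforce
next
  case (Const i a) thus ?case using exec.Const[of a W i R M] by fastforce
next
  case (Copy i j) thus ?case using exec.Copy[of W i j R M] by fastforce
next
  case (Add i j k) thus ?case using exec.Add[of R j k W i M] by fastforce
next
  case (Sub i j k) thus ?case using exec.Sub[of W i j k R M] by fastforce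
next
  case (Load i j)
  then obtain l where "valid l" "R j = addr l" "Q (R(i := m l)) m" by auto
  thus ?case using exec.Load[of W i j R M] Load.prems(2) by (fastforce simp: mrel_def)
next
  case (Store i j)
  then obtain l where l: "valid l" "R i = addr l" "Q R (m(l := R j))" by auto
  show ?case using exec.Store[of W i j R M] mrel_upd[OF Store.prems(2) l(1)] l by fastforce
next
  case (Seq P1 P2)
  obtain t1 R1 M1 m1 where 1: "exec W P1 (R, M) t1 (R1, M1)" "t1 \<le> cost P1" "mrel M1 m1" "awp P2 Q R1 m1"
    using Seq.IH(1) Seq.prems by fastforce
  obtain t2 R2 M2 m2 where 2: "exec W P2 (R1, M1) t2 (R2, M2)" "t2 \<le> cost P2" "mrel M2 m2" "Q R2 m2"
    using Seq.IH(2)[OF 1(4,3)] by blast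
  show ?case using exec.Seq[OF 1(1) 2(1)] 1(2) 2(2-) by fastforce
next
  case (If t P1 P2)
  show ?case
  proof (cases "test_holds t R")
    case True
    then obtain t1 R1 M1 m1 where 1: "exec W P1 (R, M) t1 (R1, M1)" "t1 \<le> cost P1" "mrel M1 m1" "Q R1 m1"
      using If.IH(1) If.prems by fastforce
    have "exec W (If t P1 P2) (R, M) (1 + t1) (R1, M1)" using True 1(1) by (intro exec.If_true) (simp_all add: holds_iff)
    thus ?thesis using 1 by fastforce
  next
    case False
    then obtain t1 R1 M1 m1 where 1: "exec W P2 (R, M) t1 (R1, M1)" "t1 \<le> cost P2" "mrel M1 m1" "Q R1 m1"
      using If.IH(2) If.prems by fastforce
    have "exec W (If t P1 P2) (R, M) (1 + t1) (R1, M1)" using False 1(1) by (intro exec.If_false) (simp_all add: holds_iff)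
    thus ?thesis using 1 by fastforce
  qed
next
  case (While t P) thus ?case by simp
qed

lemma awp_mono: "awp P Q R m \<Longrightarrow> (\<And>R m. Q R m \<Longrightarrow> Q' R m) \<Longrightarrow> awp P Q' R m"
proof (induction P arbitrary: Q Q' R m)
  case (Seq P1 P2)
  show ?case using Seq.IH(1)[of "awp P2 Q" R m "awp P2 Q'"] Seq.IH(2)[of Q _ _ Q'] Seq.prems by simp
next
  case (If t P1 P2)
  thus ?case by (simp split: if_splits)
qed auto

section \<open>Total correctness of loops with a time bound\<close>

definition ewp :: "prog \<Rightarrow> nat \<Rightarrow> ((reg \<Rightarrow> nat) \<Rightarrow> lmem \<Rightarrow> bool) \<Rightarrow> (reg \<Rightarrow> nat) \<Rightarrow> lmem \<Rightarrow> bool" where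
  "ewp P T Q R m \<longleftrightarrow> (\<forall>M. mrel M m \<longrightarrow>
     (\<exists>t R' M' m'. exec W P (R, M) t (R', M') \<and> t \<le> T \<and> mrel M' m' \<and> Q R' m'))"

lemma ewp_awp: "awp P Q R m \<Longrightarrow> ewp P (cost P) Q R m"
  unfolding ewp_def using awp_sound by blast

lemma ewp_Seq:
  assumes "ewp P1 T1 Q1 R m" "\<And>R m. Q1 R m \<Longrightarrow> ewp P2 T2 Q R m" "T1 + T2 \<le> T"
  shows "ewp (Seq P1 P2) T Q R m"
  unfolding ewp_def
proof (intro allI impI)
  fix M assume "mrel M m"
  with assms(1) obtain t1 R1 M1 m1 where 1: "exec W P1 (R, M) t1 (R1, M1)" "t1 \<le> T1" "mrel M1 m1" "Q1 R1 m1"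
    unfolding ewp_def by blast
  with assms(2) obtain t2 R2 M2 m2 where 2: "exec W P2 (R1, M1) t2 (R2, M2)" "t2 \<le> T2" "mrel M2 m2" "Q R2 m2"
    unfolding ewp_def by blast
  have "t1 + t2 \<le> T" using 1(2) 2(2) assms(3) by linarith
  thus "\<exists>t R' M' m'. exec W (Seq P1 P2) (R, M) t (R', M') \<and> t \<le> T \<and> mrel M' m' \<and> Q R' m'"
    using exec.Seq[OF 1(1) 2(1)] 2(3,4) by blast
qed

text \<open>The index \<open>k\<close> of the invariant is a variant: each iteration lowers it, so
  it also bounds the number of iterations.\<close>

lemma ewp_While:
  assumes body: "\<And>R m k. I R m k \<Longrightarrow> test_holds t R \<Longrightarrow> awp P (\<lambda>R' m'. \<exists>k'<k. I R' m' k') R m"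
  shows "I R m k \<Longrightarrow> ewp (While t P) (1 + (1 + cost P) * k) (\<lambda>R m. \<not> test_holds t R \<and> (\<exists>k. I R m k)) R m"
proof (induction k arbitrary: R m rule: less_induct)
  case (less k)
  show ?case
    unfolding ewp_def
  proof (intro allI impI)
    fix M assume M: "mrel M m"
    show "\<exists>t' R' M' m'. exec W (While t P) (R, M) t' (R', M') \<and> t' \<le> 1 + (1 + cost P) * k \<and> mrel M' m' \<and>
       \<not> test_holds t R' \<and> (\<exists>k. I R' m' k)"
    proof (cases "test_holds t R")
      case False
      hence "exec W (While t P) (R, M) 1 (R, M)" by (intro exec.While_false) (simp add: holds_iff)
      thus ?thesis using M less.prems False by fastforce
    next
      case True
      obtain t1 R1 M1 m1 k1 where 1: "exec W P (R, M) t1 (R1, M1)" "t1 \<le> cost P" "mrel M1 m1" "k1 < k" "I R1 m1 k1"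
        using awp_sound[OF body[OF less.prems True] M] by blast
      obtain t2 R2 M2 m2 where 2: "exec W (While t P) (R1, M1) t2 (R2, M2)" "t2 \<le> 1 + (1 + cost P) * k1" "mrel M2 m2"
         "\<not> test_holds t R2" "\<exists>k. I R2 m2 k"
        using less.IH[OF 1(4,5)] 1(3) unfolding ewp_def by blast
      have "exec W (While t P) (R, M) (1 + t1 + t2) (R2, M2)"
        using True by (intro exec.While_true[OF _ 1(1) 2(1)]) (simp add: holds_iff)
      moreover have "1 + t1 + t2 \<le> 1 + (1 + cost P) * k"
      proof -
        have "(1 + cost P) * Suc k1 \<le> (1 + cost P) * k" using 1(4) by (intro mult_le_mono2) simp
        thus ?thesis using 1(2) 2(2) by simp
      qed
      ultimately show ?thesis using 2(3-5) by blast
    qed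
  qed
qed

end

section \<open>Neighbour lists in memory\<close>

text \<open>
  Registers 1 to 7 hold constants: \<open>n\<close>, the start of the tables of degrees and of row addresses, the
  start of the stack, 1, 3 and 0. Register 8 is the height of the stack, register 9 the number of
  vertices of the current graph, and 10 to 13 are scratch registers.
\<close>

definition rd_deg :: "reg \<Rightarrow> reg \<Rightarrow> prog" where
  "rd_deg d v = Seq (Add d 2 v) (Load d d)"
definition rd_nb :: "reg \<Rightarrow> reg \<Rightarrow> reg \<Rightarrow> prog" where
  "rd_nb d v i = Seq (Add d 3 v) (Seq (Load d d) (Seq (Add d d i) (Load d d)))"
definition rd_pos :: "reg \<Rightarrow> reg \<Rightarrow> reg \<Rightarrow> prog" where
  "rd_pos d v u = Seq (Add d 3 v) (Seq (Load d d) (Seq (Add d d 1) (Seq (Add d d u) (Load d d))))"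
definition wr_deg :: "reg \<Rightarrow> reg \<Rightarrow> prog" where
  "wr_deg v x = Seq (Add 10 2 v) (Store 10 x)"
definition wr_nb :: "reg \<Rightarrow> reg \<Rightarrow> reg \<Rightarrow> prog" where
  "wr_nb v i x = Seq (Add 10 3 v) (Seq (Load 10 10) (Seq (Add 10 10 i) (Store 10 x)))"
definition wr_pos :: "reg \<Rightarrow> reg \<Rightarrow> reg \<Rightarrow> prog" where
  "wr_pos v u x = Seq (Add 10 3 v) (Seq (Load 10 10) (Seq (Add 10 10 1) (Seq (Add 10 10 u) (Store 10 x))))"
definition push :: "reg \<Rightarrow> prog" where
  "push x = Seq (Add 10 4 8) (Seq (Store 10 x) (Add 8 8 5))"

definition replace :: "reg \<Rightarrow> reg \<Rightarrow> reg \<Rightarrow> prog" where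
  "replace v u w = Seq (rd_pos 11 v u) (Seq (wr_nb v 11 w) (Seq (wr_pos v w 11) (wr_pos v u 7)))"
text \<open>The last list entry moves into the gap. The position of \<open>u\<close> is cleared
  after that of the moved vertex is written, so the result is also right when \<open>u\<close>
  itself is the last entry.\<close>

definition delete :: "reg \<Rightarrow> reg \<Rightarrow> prog" where
  "delete v u = Seq (rd_pos 11 v u) (Seq (rd_deg 12 v) (Seq (rd_nb 13 v 12) (Seq (wr_nb v 11 13)
     (Seq (wr_pos v 13 11) (Seq (wr_pos v u 7) (Seq (Sub 12 12 5) (wr_deg v 12)))))))"
definition append :: "reg \<Rightarrow> reg \<Rightarrow> prog" where
  "append v u = Seq (rd_deg 11 v) (Seq (Add 11 11 5) (Seq (wr_deg v 11) (Seq (wr_nb v 11 u) (wr_pos v u 11))))"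
text \<open>By \<open>anchor_local\<close>, a changed vertex creates anchors only at itself and its
  neighbours, and only if its degree is three; hence at most four pushes.\<close>

definition push_nbrs :: "reg \<Rightarrow> prog" where
  "push_nbrs u = Seq (rd_deg 11 u) (If (Equal 11 6)
     (Seq (push u) (Seq (rd_nb 12 u 5) (Seq (push 12) (Seq (Const 13 2) (Seq (rd_nb 12 u 13) (Seq (push 12)
       (Seq (rd_nb 12 u 6) (push 12)))))))) Skip)"

text \<open>
  Neighbour lists are indexed from 1, so that the initial value 0 of \<open>Pos v u\<close> means non-adjacency.
\<close>

definition adj_row :: "nat \<Rightarrow> lmem \<Rightarrow> nat \<Rightarrow> nat set \<Rightarrow> bool" where
  "adj_row n m v A \<longleftrightarrow> A \<subseteq> {..<n} - {v} \<and>
     (\<forall>i. 1 \<le> i \<and> i \<le> m (Deg v) \<longrightarrow> m (Nb v i) \<in> A \<and> m (Pos v (m (Nb v i))) = i) \<and>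
     (\<forall>u\<in>A. 1 \<le> m (Pos v u) \<and> m (Pos v u) \<le> m (Deg v) \<and> m (Nb v (m (Pos v u))) = u) \<and>
     (\<forall>u<n. u \<notin> A \<longrightarrow> m (Pos v u) = 0)"

text \<open>The position table inverts the list, so the list has no repetitions.\<close>

lemma adj_row_image:
  assumes "adj_row n m v A" shows "A = (\<lambda>i. m (Nb v i)) ` {1..m (Deg v)}" "m (Deg v) = card A"
proof -
  show "A = (\<lambda>i. m (Nb v i)) ` {1..m (Deg v)}"
    using assms unfolding adj_row_def by (force simp: image_iff)
  moreover have "inj_on (\<lambda>i. m (Nb v i)) {1..m (Deg v)}"
    using assms unfolding adj_row_def by (intro inj_onI) (metis atLeastAtMost_iff)
  ultimately show "m (Deg v) = card A" by (simp add: card_image)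
qed

text \<open>Without loops a degree is at most \<open>n - 1\<close>, so list indices that start at 1
  fit into the \<open>n\<close> cells of a row.\<close>

lemma adj_row_less:
  assumes "adj_row n m v A" "v < n" shows "m (Deg v) < n"
proof -
  have "card A \<le> card ({..<n} - {v})" using assms(1) by (intro card_mono) (auto simp: adj_row_def)
  thus ?thesis using adj_row_image(2)[OF assms(1)] assms(2) by simp
qed

lemma adj_row_cong:
  assumes "m' (Deg v) = m (Deg v)" "\<And>i. m' (Nb v i) = m (Nb v i)" "\<And>i. m' (Pos v i) = m (Pos v i)"
  shows "adj_row n m' v A = adj_row n m v A"
  using assms by (simp add: adj_row_def)

lemma adj_row_replace:
  assumes "adj_row n m v A" "u \<in> A" "w \<notin> A" "w < n" "w \<noteq> v"
  shows "adj_row n (m(Nb v (m (Pos v u)) := w, Pos v w := m (Pos v u), Pos v u := 0)) v (A - {u} \<union> {w})"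
proof -
  have uw: "u \<noteq> w" using assms by auto
  have p: "1 \<le> m (Pos v u)" "m (Pos v u) \<le> m (Deg v)" "m (Nb v (m (Pos v u))) = u"
    using assms(1,2) by (auto simp: adj_row_def)
  have i: "m (Nb v i) \<in> A" "m (Pos v (m (Nb v i))) = i" if "1 \<le> i" "i \<le> m (Deg v)" for i
    using assms(1) that by (auto simp: adj_row_def)
  have j: "m (Pos v x) = m (Pos v u) \<longleftrightarrow> x = u" if "x \<in> A" for x
    using assms(1,2) that unfolding adj_row_def by metis
  have k: "m (Nb v i) = u \<longleftrightarrow> i = m (Pos v u)" if "1 \<le> i" "i \<le> m (Deg v)" for i
    using i[OF that] p by auto
  have l: "m (Nb v i) \<noteq> w" if "1 \<le> i" "i \<le> m (Deg v)" for i
    using i(1)[OF that] assms(3) by auto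
  show ?thesis
    unfolding adj_row_def
  proof (intro conjI allI ballI impI)
    show "A - {u} \<union> {w} \<subseteq> {..<n} - {v}" using assms by (auto simp: adj_row_def)
  next
    fix i assume "1 \<le> i \<and> i \<le> (m(Nb v (m (Pos v u)) := w, Pos v w := m (Pos v u), Pos v u := 0)) (Deg v)"
    hence "1 \<le> i" "i \<le> m (Deg v)" by auto
    note * = i[OF this] k[OF this] l[OF this]
    show "(m(Nb v (m (Pos v u)) := w, Pos v w := m (Pos v u), Pos v u := 0)) (Nb v i) \<in> A - {u} \<union> {w}"
      using * by auto
    show "(m(Nb v (m (Pos v u)) := w, Pos v w := m (Pos v u), Pos v u := 0))
           (Pos v ((m(Nb v (m (Pos v u)) := w, Pos v w := m (Pos v u), Pos v u := 0)) (Nb v i))) = i"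
      using * uw by auto
  next
    fix x assume x: "x \<in> A - {u} \<union> {w}"
    have q: "1 \<le> m (Pos v x)" "m (Pos v x) \<le> m (Deg v)" "m (Nb v (m (Pos v x))) = x" if "x \<noteq> w"
      using assms(1) x that by (auto simp: adj_row_def)
    show "1 \<le> (m(Nb v (m (Pos v u)) := w, Pos v w := m (Pos v u), Pos v u := 0)) (Pos v x)"
      using p x q uw by auto
    show "(m(Nb v (m (Pos v u)) := w, Pos v w := m (Pos v u), Pos v u := 0)) (Pos v x)
         \<le> (m(Nb v (m (Pos v u)) := w, Pos v w := m (Pos v u), Pos v u := 0)) (Deg v)"
      using p x q uw by auto
    show "(m(Nb v (m (Pos v u)) := w, Pos v w := m (Pos v u), Pos v u := 0))
          (Nb v ((m(Nb v (m (Pos v u)) := w, Pos v w := m (Pos v u), Pos v u := 0)) (Pos v x))) = x"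
      using p x q uw j[of x] by auto
  next
    fix x assume x: "x < n" "x \<notin> A - {u} \<union> {w}"
    show "(m(Nb v (m (Pos v u)) := w, Pos v w := m (Pos v u), Pos v u := 0)) (Pos v x) = 0"
      using x assms(1) by (auto simp: adj_row_def)
  qed
qed

lemma adj_row_delete:
  assumes a: "adj_row n m v A" and u: "u \<in> A"
  defines "l \<equiv> m (Nb v (m (Deg v)))"
  shows "adj_row n (m(Nb v (m (Pos v u)) := l, Pos v l := m (Pos v u), Pos v u := 0, Deg v := m (Deg v) - 1)) v (A - {u})"
    (is "adj_row n ?m v _")
proof -
  have p: "1 \<le> m (Pos v u)" "m (Pos v u) \<le> m (Deg v)" "m (Nb v (m (Pos v u))) = u"
    using a u by (auto simp: adj_row_def)
  have i: "m (Nb v i) \<in> A" "m (Pos v (m (Nb v i))) = i" if "1 \<le> i" "i \<le> m (Deg v)" for i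
    using a that by (auto simp: adj_row_def)
  have q: "1 \<le> m (Pos v x)" "m (Pos v x) \<le> m (Deg v)" "m (Nb v (m (Pos v x))) = x" if "x \<in> A" for x
    using a that by (auto simp: adj_row_def)
  have d: "1 \<le> m (Deg v)" using p by linarith
  have l: "l \<in> A" "m (Pos v l) = m (Deg v)" using i[OF d] unfolding l_def by auto
  \<comment> \<open>Separates the degenerate case in which the deleted entry is the last
    one.\<close>
  have lu: "l = u \<longleftrightarrow> m (Pos v u) = m (Deg v)" using l p(3) unfolding l_def by metis
  have k: "m (Nb v i) = u \<longleftrightarrow> i = m (Pos v u)" "m (Nb v i) = l \<longleftrightarrow> i = m (Deg v)" if "1 \<le> i" "i \<le> m (Deg v)" for i
    using i(2)[OF that] p(3) l(2) l_def by metis+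
  show ?thesis
    unfolding adj_row_def
  proof (intro conjI allI ballI impI)
    show "A - {u} \<subseteq> {..<n} - {v}" using a by (auto simp: adj_row_def)
  next
    fix j assume "1 \<le> j \<and> j \<le> ?m (Deg v)"
    hence j: "1 \<le> j" "j \<le> m (Deg v)" "j \<noteq> m (Deg v)" using d by auto
    note * = i[OF j(1,2)] k[OF j(1,2)]
    show "?m (Nb v j) \<in> A - {u}" "?m (Pos v (?m (Nb v j))) = j"
    proof (atomize (full), cases "j = m (Pos v u)")
      case True
      hence "l \<noteq> u" using lu j(3) by simp
      thus "?m (Nb v j) \<in> A - {u} \<and> ?m (Pos v (?m (Nb v j))) = j" using True l(1) by simp
    next
      case False
      hence "m (Nb v j) \<noteq> u" "m (Nb v j) \<noteq> l" using * j(3) by blast+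
      thus "?m (Nb v j) \<in> A - {u} \<and> ?m (Pos v (?m (Nb v j))) = j" using False *(1,2) by simp
    qed
  next
    fix x assume x: "x \<in> A - {u}"
    note * = q[of x] q[OF u]
    have xl: "m (Pos v x) \<noteq> m (Pos v u)" using q[of x] q[of u] x u by auto
    have xl2: "m (Pos v x) = m (Deg v) \<Longrightarrow> x = l" using q[of x] x l_def by auto
    show "1 \<le> ?m (Pos v x)" using * x by auto
    show "?m (Pos v x) \<le> ?m (Deg v)"
    proof (cases "x = l")
      case True
      hence "m (Pos v u) \<noteq> m (Deg v)" using lu x by auto
      thus ?thesis using True x p by simp
    next
      case False
      hence "m (Pos v x) \<noteq> m (Deg v)" using xl2 by blast
      thus ?thesis using False x q[of x] by simp
    qed
    show "?m (Nb v (?m (Pos v x))) = x" using * x xl xl2 by auto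
  next
    fix x assume x: "x < n" "x \<notin> A - {u}"
    show "?m (Pos v x) = 0" using x a l by (auto simp: adj_row_def)
  qed
qed

lemma adj_row_append:
  assumes a: "adj_row n m v A" and u: "u \<notin> A" "u < n" "u \<noteq> v"
  shows "adj_row n (m(Deg v := Suc (m (Deg v)), Nb v (Suc (m (Deg v))) := u, Pos v u := Suc (m (Deg v)))) v (insert u A)"
    (is "adj_row n ?m v _")
proof -
  have i: "m (Nb v i) \<in> A" "m (Pos v (m (Nb v i))) = i" if "1 \<le> i" "i \<le> m (Deg v)" for i
    using a that by (auto simp: adj_row_def)
  have q: "1 \<le> m (Pos v x)" "m (Pos v x) \<le> m (Deg v)" "m (Nb v (m (Pos v x))) = x" if "x \<in> A" for x
    using a that by (auto simp: adj_row_def)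
  show ?thesis
    unfolding adj_row_def
  proof (intro conjI allI ballI impI)
    show "insert u A \<subseteq> {..<n} - {v}" using a u by (auto simp: adj_row_def)
  next
    fix j assume "1 \<le> j \<and> j \<le> ?m (Deg v)"
    hence j: "1 \<le> j" "j \<le> Suc (m (Deg v))" by auto
    show "?m (Nb v j) \<in> insert u A" using i[of j] j u by auto
    show "?m (Pos v (?m (Nb v j))) = j" using i[of j] j u by auto
  next
    fix x assume x: "x \<in> insert u A"
    note * = q[of x] 
    show "1 \<le> ?m (Pos v x)" using * x by auto
    show "?m (Pos v x) \<le> ?m (Deg v)" using * x by fastforce
    show "?m (Nb v (?m (Pos v x))) = x" using * x by fastforce
  next
    fix x assume x: "x < n" "x \<notin> insert u A"
    show "?m (Pos v x) = 0" using x a by (auto simp: adj_row_def)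
  qed
qed

text \<open>A removed vertex keeps a stale row; only its degree is reset. A stale stack entry then
  fails the degree test, and the final count passes over removed vertices.\<close>

definition rep :: "nat \<Rightarrow> lmem \<Rightarrow> nat set \<Rightarrow> (nat \<Rightarrow> nat set) \<Rightarrow> bool" where
  "rep n m V N \<longleftrightarrow> V \<subseteq> {..<n} \<and> (\<forall>v\<in>V. adj_row n m v (N v)) \<and> (\<forall>v<n. v \<notin> V \<longrightarrow> m (Deg v) = 0)"

lemma rep_upd:
  assumes "rep n m V N" "adj_row n m' v A"
    "\<And>x. x \<noteq> v \<Longrightarrow> m' (Deg x) = m (Deg x)" "\<And>x i. x \<noteq> v \<Longrightarrow> m' (Nb x i) = m (Nb x i)"
    "\<And>x i. x \<noteq> v \<Longrightarrow> m' (Pos x i) = m (Pos x i)" "v \<in> V"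
  shows "rep n m' V (N(v := A))"
proof -
  have "adj_row n m' x ((N(v := A)) x)" if "x \<in> V" for x
  proof (cases "x = v")
    case False
    hence "adj_row n m' x (N x) = adj_row n m x (N x)" using assms(3-5) by (intro adj_row_cong) auto
    thus ?thesis using assms(1) that False by (simp add: rep_def)
  qed (use assms(2) in simp)
  moreover have "m' (Deg x) = 0" if "x < n" "x \<notin> V" for x
    using assms(1,3,6) that unfolding rep_def by metis
  ultimately show ?thesis using assms(1) by (simp add: rep_def)
qed

lemma rep_cong: "(\<And>v. v \<in> V \<Longrightarrow> N v = N' v) \<Longrightarrow> rep n m V N = rep n m V N'"
  by (auto simp: rep_def)

lemma rep_mem_cong:
  assumes "\<And>v. m' (Deg v) = m (Deg v)" "\<And>v i. m' (Nb v i) = m (Nb v i)" "\<And>v i. m' (Pos v i) = m (Pos v i)"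
  shows "rep n m' V N = rep n m V N"
  unfolding rep_def using assms by (simp add: adj_row_cong[of m' _ m])

lemma rep_kill:
  assumes "rep n m V N" "v \<in> V" shows "rep n (m(Deg v := 0)) (V - {v}) N"
proof -
  have "adj_row n (m(Deg v := 0)) x (N x)" if "x \<in> V" "x \<noteq> v" for x
  proof -
    have "adj_row n (m(Deg v := 0)) x (N x) = adj_row n m x (N x)" using that by (intro adj_row_cong) auto
    thus ?thesis using assms that by (simp add: rep_def)
  qed
  thus ?thesis using assms by (auto simp: rep_def)
qed

lemma rep_deg: "rep n m V N \<Longrightarrow> v < n \<Longrightarrow> m (Deg v) = (if v \<in> V then card (N v) else 0)"
  using adj_row_image(2) unfolding rep_def by auto

lemma rep_deg3: "rep n m V N \<Longrightarrow> v < n \<Longrightarrow> m (Deg v) = 3 \<longleftrightarrow> v \<in> V \<and> card (N v) = 3"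
  by (simp add: rep_deg)

lemma rep_pos: "rep n m V N \<Longrightarrow> v \<in> V \<Longrightarrow> u < n \<Longrightarrow> m (Pos v u) = 0 \<longleftrightarrow> u \<notin> N v"
  unfolding rep_def adj_row_def by force

lemma rep_nb3:
  assumes "rep n m V N" "v \<in> V" "card (N v) = 3"
  shows "N v = {m (Nb v 1), m (Nb v 2), m (Nb v 3)}" "distinct [m (Nb v 1), m (Nb v 2), m (Nb v 3)]"
proof -
  have a: "adj_row n m v (N v)" using assms by (simp add: rep_def)
  have "{1..3::nat} = {1,2,3}" by auto
  thus "N v = {m (Nb v 1), m (Nb v 2), m (Nb v 3)}" using adj_row_image[OF a] assms(3) by simp
  hence "card {m (Nb v 1), m (Nb v 2), m (Nb v 3)} = 3" using assms(3) by simp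
  thus "distinct [m (Nb v 1), m (Nb v 2), m (Nb v 3)]" by (auto simp: card_insert_if split: if_splits)
qed

lemma rep_less: "rep n m V N \<Longrightarrow> v \<in> V \<Longrightarrow> u \<in> N v \<Longrightarrow> u < n \<and> u \<noteq> v"
  unfolding rep_def adj_row_def by auto

text \<open>\<open>20 * n + 20\<close> leaves room for the stack, whose pushes are verified below
  height \<open>15 * n + 10\<close>, and for sums of three vertices.\<close>

locale sparse_ram = ram +
  assumes wide: "b + 2 * n + 2 * n * n + 20 * n + 20 < W"
begin

definition env :: "(reg \<Rightarrow> nat) \<Rightarrow> lmem \<Rightarrow> bool" where
  "env R m \<longleftrightarrow> R 1 = n \<and> R 2 = b \<and> R 3 = b + n \<and> R 4 = b + 2 * n + 2 * n * n \<and> R 5 = 1 \<and> R 6 = 3 \<and> R 7 = 0 \<and>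
     (\<forall>v<n. m (Row v) = b + 2 * n + 2 * n * v)"

lemma env_reg [simp]: "8 \<le> i \<Longrightarrow> env (R(i := x)) m = env R m"
  by (simp add: env_def)

lemma env_mem [simp]:
  "env R (m(Deg v := x)) = env R m" "env R (m(Nb v i := x)) = env R m"
  "env R (m(Pos v i := x)) = env R m" "env R (m(Stk i := x)) = env R m"
  by (simp_all add: env_def)

text \<open>Injectivity of addresses pins down the location that \<open>awp\<close> leaves
  existential, which yields a rewrite rule.\<close>

lemma load_iff: "valid l \<Longrightarrow> R j = addr l \<Longrightarrow> awp (Load i j) Q R m = Q (R(i := m l)) m"
  using addr_inject by auto

lemma store_iff: "valid l \<Longrightarrow> R i = addr l \<Longrightarrow> awp (Store i j) Q R m = Q R (m(l := R j))"
  using addr_inject by auto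

lemma add_iff: "R j + R k < W \<Longrightarrow> awp (Add i j k) Q R m = Q (R(i := R j + R k)) m"
  by simp

lemma sub_eq: "awp (Sub i j k) Q R m = Q (R(i := R j - R k)) m"
  by simp

lemma block_W: "v < n \<Longrightarrow> i < 2 * n \<Longrightarrow> b + 2 * n + 2 * n * v + i < W"
  using block_bound[of v i] wide by simp

lemma awp_rd_deg:
  assumes "env R m" "R v < n"
  shows "awp (rd_deg d v) Q R m = Q (R(d := m (Deg (R v)))) m"
  unfolding rd_deg_def awp.simps(8)
  using assms wide by (subst add_iff, simp add: env_def) (subst load_iff[of "Deg (R v)"], simp_all add: env_def)

lemma awp_rd_nb:
  assumes "env R m" "R v < n" "R i < n" "i \<noteq> d"
  shows "awp (rd_nb d v i) Q R m = Q (R(d := m (Nb (R v) (R i)))) m"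
  unfolding rd_nb_def awp.simps(8)
  using assms wide block_W[of "R v" "R i"]
  by (subst add_iff, simp add: env_def) (subst load_iff[of "Row (R v)"], simp_all add: env_def del: awp.simps,
    subst add_iff, simp, subst load_iff[of "Nb (R v) (R i)"], simp_all add: env_def)

lemma awp_rd_pos:
  assumes "env R m" "R v < n" "R u < n" "u \<noteq> d" "d \<noteq> 1"
  shows "awp (rd_pos d v u) Q R m = Q (R(d := m (Pos (R v) (R u)))) m"
  unfolding rd_pos_def awp.simps(8)
  using assms wide block_W[of "R v" "n + R u"]
  by (subst add_iff, simp add: env_def) (subst load_iff[of "Row (R v)"], simp_all add: env_def del: awp.simps,
    subst add_iff, simp, subst add_iff, simp, subst load_iff[of "Pos (R v) (R u)"], simp_all add: env_def)

lemma awp_wr_deg: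
  assumes "env R m" "R v < n" "x \<noteq> 10"
  shows "awp (wr_deg v x) Q R m = Q (R(10 := addr (Deg (R v)))) (m(Deg (R v) := R x))"
  unfolding wr_deg_def awp.simps(8)
  using assms wide by (subst add_iff, simp add: env_def) (subst store_iff[of "Deg (R v)"], simp_all add: env_def)

lemma awp_wr_nb:
  assumes "env R m" "R v < n" "R i < n" "i \<noteq> 10" "x \<noteq> 10"
  shows "awp (wr_nb v i x) Q R m = Q (R(10 := addr (Nb (R v) (R i)))) (m(Nb (R v) (R i) := R x))"
  unfolding wr_nb_def awp.simps(8)
  using assms wide block_W[of "R v" "R i"]
  by (subst add_iff, simp add: env_def) (subst load_iff[of "Row (R v)"], simp_all add: env_def del: awp.simps,
    subst add_iff, simp, subst store_iff[of "Nb (R v) (R i)"], simp_all add: env_def)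

lemma awp_wr_pos:
  assumes "env R m" "R v < n" "R u < n" "u \<noteq> 10" "x \<noteq> 10"
  shows "awp (wr_pos v u x) Q R m = Q (R(10 := addr (Pos (R v) (R u)))) (m(Pos (R v) (R u) := R x))"
  unfolding wr_pos_def awp.simps(8)
  using assms wide block_W[of "R v" "n + R u"]
  by (subst add_iff, simp add: env_def) (subst load_iff[of "Row (R v)"], simp_all add: env_def del: awp.simps,
    subst add_iff, simp, subst add_iff, simp, subst store_iff[of "Pos (R v) (R u)"], simp_all add: env_def)

lemma awp_push:
  assumes "env R m" "x \<noteq> 10" "R 8 < 15 * n + 10"
  shows "awp (push x) Q R m = Q (R(10 := addr (Stk (R 8)), 8 := Suc (R 8))) (m(Stk (R 8) := R x))"
  unfolding push_def awp.simps(8)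
  using assms wide by (subst add_iff, simp add: env_def) (subst store_iff[of "Stk (R 8)"], simp_all add: env_def)

lemmas awp_macros = awp_rd_deg awp_rd_nb awp_rd_pos awp_wr_deg awp_wr_nb awp_wr_pos awp_push

text \<open>What the list operations preserve. Their effect on degrees, lists and positions is
  described by \<open>rep\<close> instead.\<close>

definition frame :: "(reg \<Rightarrow> nat) \<Rightarrow> lmem \<Rightarrow> (reg \<Rightarrow> nat) \<Rightarrow> lmem \<Rightarrow> bool" where
  "frame R m R' m' \<longleftrightarrow> (\<forall>r. r \<notin> {10,11,12,13} \<longrightarrow> R' r = R r) \<and> (\<forall>i. m' (Stk i) = m (Stk i)) \<and>
     (\<forall>v. m' (Row v) = m (Row v)) \<and> (\<forall>i. m' (Inp i) = m (Inp i))"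

lemma frame_trans: "frame R m R' m' \<Longrightarrow> frame R' m' R'' m'' \<Longrightarrow> frame R m R'' m''"
  by (simp add: frame_def)

lemma frame_env: "frame R m R' m' \<Longrightarrow> env R m \<Longrightarrow> env R' m'"
  by (simp add: frame_def env_def)

lemma awp_replace:
  assumes e: "env R m" and r: "rep n m V N" and v: "R v \<in> V" and u: "R u \<in> N (R v)" and w: "R w \<notin> N (R v)" "R w < n" "R w \<noteq> R v"
    and reg: "v \<notin> {10,11}" "u \<notin> {10,11}" "w \<notin> {10,11}"
    and Q: "\<And>R' m'. frame R m R' m' \<Longrightarrow> rep n m' V (N(R v := N (R v) - {R u} \<union> {R w})) \<Longrightarrow> Q R' m'"
  shows "awp (replace v u w) Q R m"
proof -
  have vn: "R v < n" "R u < n" using r v rep_less[OF r v u] by (auto simp: rep_def)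
  have a: "adj_row n m (R v) (N (R v))" using r v by (simp add: rep_def)
  have p: "m (Pos (R v) (R u)) < n" using a u adj_row_less[OF a vn(1)] by (auto simp: adj_row_def)
  show ?thesis
    unfolding replace_def awp.simps(8)
    using e vn p w reg
    apply (simp add: awp_macros del: awp.simps)
    apply (rule Q)
     apply (simp add: frame_def)
    using adj_row_replace[OF a u w] e
    apply (intro rep_upd[OF r]) apply (simp_all add: v env_def)
    done
qed

lemma awp_delete:
  assumes e: "env R m" and r: "rep n m V N" and v: "R v \<in> V" and u: "R u \<in> N (R v)"
    and reg: "v \<notin> {10,11,12,13}" "u \<notin> {10,11,12,13}"
    and Q: "\<And>R' m'. frame R m R' m' \<Longrightarrow> rep n m' V (N(R v := N (R v) - {R u})) \<Longrightarrow> Q R' m'"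
  shows "awp (delete v u) Q R m"
proof -
  have vn: "R v < n" "R u < n" using r v rep_less[OF r v u] by (auto simp: rep_def)
  have a: "adj_row n m (R v) (N (R v))" using r v by (simp add: rep_def)
  have p: "m (Pos (R v) (R u)) < n" "m (Deg (R v)) < n" "1 \<le> m (Deg (R v))"
    using a u adj_row_less[OF a vn(1)] by (auto simp: adj_row_def)
  have l: "m (Nb (R v) (m (Deg (R v)))) < n" using a p by (auto simp: adj_row_def)
  show ?thesis
    unfolding delete_def awp.simps(8)
    using e vn p l reg
    apply (simp add: awp_macros sub_eq del: awp.simps)
    apply (rule Q)
     apply (simp add: frame_def)
    using adj_row_delete[OF a u] e
    apply (intro rep_upd[OF r]) apply (simp_all add: v env_def)
    done
qed

lemma awp_append:
  assumes e: "env R m" and r: "rep n m V N" and v: "R v \<in> V" and u: "R u \<notin> N (R v)" "R u < n" "R u \<noteq> R v"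
    and reg: "v \<notin> {10,11,12,13}" "u \<notin> {10,11,12,13}"
    and Q: "\<And>R' m'. frame R m R' m' \<Longrightarrow> rep n m' V (N(R v := insert (R u) (N (R v)))) \<Longrightarrow> Q R' m'"
  shows "awp (append v u) Q R m"
proof -
  have vn: "R v < n" using r v by (auto simp: rep_def)
  have a: "adj_row n m (R v) (N (R v))" using r v by (simp add: rep_def)
  have a': "adj_row n (m(Deg (R v) := Suc (m (Deg (R v))), Nb (R v) (Suc (m (Deg (R v)))) := R u, Pos (R v) (R u) := Suc (m (Deg (R v))))) (R v) (insert (R u) (N (R v)))"
    by (rule adj_row_append[OF a u])
  have p: "Suc (m (Deg (R v))) < n" using adj_row_less[OF a' vn] by simp
  show ?thesis
    unfolding append_def awp.simps(8)
    using e vn p u reg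
    apply (simp add: awp_macros del: awp.simps)
    apply (subst add_iff)
    subgoal using wide by (simp add: env_def)
    apply (simp add: awp_macros del: awp.simps)
    apply (subgoal_tac "R 5 = 1")
    apply (simp add: awp_macros del: awp.simps)
    apply (rule Q)
     apply (simp add: frame_def)
    using a' e
    apply (intro rep_upd[OF r]) apply (simp_all add: v env_def)
    done
qed

end

section \<open>Performing a reduction\<close>

text \<open>
  Register 14 holds the vertex \<open>v\<close> taken from the stack, 15 to 17 its neighbours \<open>a\<close>, \<open>b\<close>, \<open>c\<close> in
  one of three rotations, 18 and 19 the third neighbours of \<open>a\<close> and \<open>b\<close> when these are adjacent.
\<close>

definition push3 :: "reg \<Rightarrow> reg \<Rightarrow> reg \<Rightarrow> prog" where
  "push3 u v w = Seq (push_nbrs u) (Seq (push_nbrs v) (push_nbrs w))"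

text \<open>The third neighbour is the sum of all three neighbours minus the two known ones.\<close>

definition outer :: "reg \<Rightarrow> reg \<Rightarrow> reg \<Rightarrow> reg \<Rightarrow> prog" where
  "outer d u v w = Seq (Const 20 2) (Seq (rd_nb d u 5) (Seq (rd_nb 21 u 20) (Seq (Add d d 21)
     (Seq (rd_nb 21 u 6) (Seq (Add d d 21) (Seq (Sub d d v) (Sub d d w)))))))"

text \<open>The corner in register 14 survives under its own name, so the list of its outside
  neighbour in register 17 stays valid. Only the vertices in 14, 18 and 19 change and are pushed
  with their neighbours.\<close>

definition act_a :: prog where
  "act_a = Seq (Sub 9 9 5) (Seq (Sub 9 9 5) (Seq (replace 18 15 14) (Seq (replace 19 16 14)
     (Seq (replace 14 15 18) (Seq (replace 14 16 19) (Seq (wr_deg 15 7) (Seq (wr_deg 16 7) (push3 14 18 19))))))))"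

text \<open>The new edge takes the place of the middle vertex in the lists of both ends, whose
  degrees stay three; only the hub in register 17 loses an entry.\<close>

definition act_b :: prog where
  "act_b = Seq (Sub 9 9 5) (Seq (replace 15 14 16) (Seq (replace 16 14 15) (Seq (delete 17 14)
     (Seq (wr_deg 14 7) (push3 15 16 17)))))"

definition try_a :: prog where
  "try_a = Seq (outer 18 15 14 16) (Seq (outer 19 16 14 15)
     (If (Equal 18 19) Skip (If (Equal 18 17) Skip (If (Equal 19 17) Skip act_a))))"

definition try_b :: prog where
  "try_b = Seq (rd_pos 20 15 17) (If (Equal 20 7) Skip (Seq (rd_pos 20 16 17) (If (Equal 20 7) Skip act_b)))"

text \<open>The patterns exclude each other: D3a wants the vertices in 15 and 16 adjacent, D3b wants
  them nonadjacent.\<close>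

definition probe :: prog where
  "probe = Seq (rd_deg 20 15) (If (Equal 20 6) (Seq (rd_deg 20 16) (If (Equal 20 6)
       (Seq (rd_pos 20 15 16) (If (Equal 20 7) try_b try_a)) Skip)) Skip)"

text \<open>Degree and neighbours are read anew because an earlier rotation may have reduced the
  graph and even removed the vertex.\<close>

definition attempt :: "nat \<Rightarrow> nat \<Rightarrow> nat \<Rightarrow> prog" where
  "attempt i j k = Seq (rd_deg 20 14) (If (Equal 20 6)
     (Seq (Const 20 i) (Seq (rd_nb 15 14 20) (Seq (Const 20 j) (Seq (rd_nb 16 14 20)
       (Seq (Const 20 k) (Seq (rd_nb 17 14 20) probe)))))) Skip)"

definition process :: prog where
  "process = Seq (Sub 8 8 5) (Seq (Add 10 4 8) (Seq (Load 14 10)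
     (Seq (attempt 1 2 3) (Seq (attempt 2 3 1) (attempt 3 1 2)))))"

context sparse_ram begin

lemma const_eq: "a < W \<Longrightarrow> awp (Const i a) Q R m = Q (R(i := a)) m"
  by simp

declare awp.simps [simp del]

lemmas exec_simps = awp_macros const_eq sub_eq awp.simps(1,8,9)

section \<open>Contents of the stack and pushing of candidates\<close>

definition stk :: "(reg \<Rightarrow> nat) \<Rightarrow> lmem \<Rightarrow> nat set" where
  "stk R m = (\<lambda>i. m (Stk i)) ` {..<R 8}"

definition local_nbrs :: "nat set \<Rightarrow> (nat \<Rightarrow> nat set) \<Rightarrow> nat \<Rightarrow> nat set" where
  "local_nbrs V N u = (if u \<in> V \<and> card (N u) = 3 then insert u (N u) else {})"

lemma local_nbrs_less:
  assumes "rep n m V N" shows "local_nbrs V N u \<subseteq> {..<n}"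
proof
  fix x assume "x \<in> local_nbrs V N u"
  hence "u \<in> V" "x = u \<or> x \<in> N u" by (auto simp: local_nbrs_def split: if_splits)
  thus "x \<in> {..<n}" using rep_less[OF assms, of u x] assms by (auto simp: rep_def)
qed

lemma awp_push_nbrs:
  assumes e: "env R m" and r: "rep n m V N" and u: "R u < n" "u \<notin> {8,10,11,12,13}" and t: "R 8 + 4 \<le> 15 * n"
    and Q: "\<And>R' m'. (\<forall>r. r \<notin> {8,10,11,12,13} \<longrightarrow> R' r = R r) \<Longrightarrow> env R' m' \<Longrightarrow> rep n m' V N \<Longrightarrow> R' 8 \<le> R 8 + 4 \<Longrightarrow>
       stk R' m' = stk R m \<union> local_nbrs V N (R u) \<Longrightarrow> Q R' m'"
  shows "awp (push_nbrs u) Q R m"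
proof (cases "m (Deg (R u)) = 3")
  case True
  hence uV: "R u \<in> V" "card (N (R u)) = 3" using rep_deg3[OF r u(1)] by auto
  note nb = rep_nb3[OF r uV]
  have loc: "local_nbrs V N (R u) = {R u, m (Nb (R u) 1), m (Nb (R u) 2), m (Nb (R u) 3)}"
    unfolding local_nbrs_def using uV nb(1) by simp
  have n: "3 < n" using True adj_row_less[of n m "R u" "N (R u)"] r uV u(1) by (auto simp: rep_def)
  have c: "R 5 = 1" "R 6 = 3" using e by (auto simp: env_def)
  have W: "2 < W" using wide by simp
  have s4: "{..<Suc (Suc (Suc (Suc k)))} = {..<k} \<union> {k, Suc k, Suc (Suc k), Suc (Suc (Suc k))}" for k :: nat by auto
  show ?thesis
    unfolding push_nbrs_def
    using e u t n c True W
    apply (simp add: exec_simps)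
    apply (rule Q)
        apply simp
       apply simp
      apply (subst rep_mem_cong[of _ m]) apply simp_all
     apply (rule r)
    apply (simp add: stk_def loc s4)
    apply (auto simp: image_iff)
    done
next
  case False
  have c: "R 5 = 1" "R 6 = 3" using e by (auto simp: env_def)
  have "local_nbrs V N (R u) = {}" using False rep_deg3[OF r u(1)] by (auto simp: local_nbrs_def)
  thus ?thesis
    unfolding push_nbrs_def
    using e u False c
    apply (simp add: exec_simps)
    apply (rule Q)
    apply (simp_all add: r e stk_def env_def)
    done
qed

lemma awp_push3:
  assumes e: "env R m" and r: "rep n m V N" and u: "R u < n" "R v < n" "R w < n"
     "u \<notin> {8,10,11,12,13}" "v \<notin> {8,10,11,12,13}" "w \<notin> {8,10,11,12,13}" and t: "R 8 + 12 \<le> 15 * n"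
    and Q: "\<And>R' m'. (\<forall>r. r \<notin> {8,10,11,12,13} \<longrightarrow> R' r = R r) \<Longrightarrow> env R' m' \<Longrightarrow> rep n m' V N \<Longrightarrow> R' 8 \<le> R 8 + 12 \<Longrightarrow>
       stk R' m' = stk R m \<union> local_nbrs V N (R u) \<union> local_nbrs V N (R v) \<union> local_nbrs V N (R w) \<Longrightarrow> Q R' m'"
  shows "awp (push3 u v w) Q R m"
  unfolding push3_def awp.simps(8)
proof (rule awp_push_nbrs[OF e r u(1,4)])
  fix R1 m1 assume 1: "\<forall>r. r \<notin> {8,10,11,12,13} \<longrightarrow> R1 r = R r" "env R1 m1" "rep n m1 V N" "R1 8 \<le> R 8 + 4"
       "stk R1 m1 = stk R m \<union> local_nbrs V N (R u)"
  have r1: "R1 v = R v" "R1 w = R w" using 1(1) u(5,6) by blast+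
  show "awp (push_nbrs v) (awp (push_nbrs w) Q) R1 m1"
  proof (rule awp_push_nbrs[OF 1(2,3)])
    fix R2 m2 assume 2: "\<forall>r. r \<notin> {8,10,11,12,13} \<longrightarrow> R2 r = R1 r" "env R2 m2" "rep n m2 V N" "R2 8 \<le> R1 8 + 4"
       "stk R2 m2 = stk R1 m1 \<union> local_nbrs V N (R1 v)"
    have r2: "R2 w = R w" using 2(1) r1 u(6) by simp
    show "awp (push_nbrs w) Q R2 m2"
    proof (rule awp_push_nbrs[OF 2(2,3)])
      fix R3 m3 assume 3: "\<forall>r. r \<notin> {8,10,11,12,13} \<longrightarrow> R3 r = R2 r" "env R3 m3" "rep n m3 V N" "R3 8 \<le> R2 8 + 4"
       "stk R3 m3 = stk R2 m2 \<union> local_nbrs V N (R2 w)"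
      show "Q R3 m3"
        by (rule Q) (use 1 2 3 r1 r2 in simp_all)
    qed (use r2 u t 1(4) 2(4) in simp_all)
  qed (use r1 u t 1(4) in simp_all)
qed (use t in simp)

lemma awp_outer:
  assumes e: "env R m" and r: "rep n m V N" and u: "R u \<in> V" "N (R u) = {R v, R w, y}" "distinct [R v, R w, y]"
    and reg: "u \<notin> {d,20,21}" "v \<notin> {d,20,21}" "w \<notin> {d,20,21}" "8 \<le> d" "d \<notin> {20,21}"
  shows "awp (outer d u v w) Q R m = Q (R(20 := 2, 21 := m (Nb (R u) 3), d := y)) m"
proof -
  have c3: "card (N (R u)) = 3" unfolding u(2) using u(3) by simp
  note nb = rep_nb3[OF r u(1) c3]
  have un: "R u < n" using r u(1) by (auto simp: rep_def)
  have a: "adj_row n m (R u) (N (R u))" using r u(1) by (simp add: rep_def)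
  have n: "3 < n" using adj_row_less[OF a un] adj_row_image(2)[OF a] c3 by simp
  have le: "m (Nb (R u) 1) < n" "m (Nb (R u) 2) < n" "m (Nb (R u) 3) < n" using rep_less[OF r u(1)] nb(1) by auto
  have "\<Sum>(N (R u)) = R v + R w + y" unfolding u(2) using u(3) by simp
  moreover have "\<Sum>(N (R u)) = m (Nb (R u) 1) + m (Nb (R u) 2) + m (Nb (R u) 3)" unfolding nb(1) using nb(2) by simp
  ultimately have s: "m (Nb (R u) 1) + m (Nb (R u) 2) + m (Nb (R u) 3) = R v + R w + y" by simp
  hence s': "m (Nb (R u) (Suc 0)) + m (Nb (R u) 2) + m (Nb (R u) 3) - R v - R w = y" by simp
  have W: "2 < W" "3 * n < W" using wide by simp_all
  have c: "R 5 = 1" "R 6 = 3" using e by (auto simp: env_def)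
  have f: "R(20 := 2, 21 := x, d := y) = R(20 := 2, d := y, 21 := x)" for x using reg by (simp add: fun_upd_twist)
  show ?thesis
    unfolding outer_def
    using e un n reg c W le s'
    apply (simp add: exec_simps)
    apply (subst add_iff, simp)
    apply (simp add: exec_simps)
    apply (subst add_iff, simp)
    apply (simp add: exec_simps f fun_upd_twist)
    done
qed

text \<open>The last clause keeps the stack complete: a new anchor is on the stack or was an anchor
  before. The popped vertex is barred from the second alternative, so it must be on the stack if it
  is an anchor afterwards.\<close>

definition acted where
  "acted R m V N R' m' \<longleftrightarrow> (\<exists>V' N'. env R' m' \<and> rep n m' V' N' \<and> step (V, N) (V', N') \<and> R' 9 = card V' \<and> R' 14 = R 14 \<and>
     R' 8 \<le> R 8 + 12 \<and> stk R m \<subseteq> stk R' m' \<and> stk R' m' \<subseteq> stk R m \<union> {..<n} \<and>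
     (\<forall>x\<in>V'. anchor N' x \<longrightarrow> x \<in> stk R' m' \<or> x \<in> V \<and> anchor N x \<and> x \<noteq> R 14))"

text \<open>\<open>C\<close> collects the changed vertices. Equality is asked only where the new
  degree is three, so removed vertices, whose sets are empty, may lie outside
  \<open>C\<close>.\<close>

lemma anchor_pushed:
  assumes "anchor N' x" "\<And>u. u \<notin> C \<Longrightarrow> card (N' u) = 3 \<Longrightarrow> N' u = N u" "C \<subseteq> V'"
  shows "x \<in> (\<Union>u\<in>C. local_nbrs V' N' u) \<or> anchor N x"
  using anchor_local[OF assms(1), of N] assms(2,3) by (force simp: local_nbrs_def)

lemma awp_act_b:
  assumes wf: "wf_ngraph (V, N)" and e: "env R m" and r: "rep n m V N"
    and c: "confB N (R 15) (R 14) (R 16) (R 17) x y" and cnt: "R 9 = card V" and t: "R 8 + 12 \<le> 15 * n"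
    and Q: "\<And>R' m'. acted R m V N R' m' \<Longrightarrow> Q R' m'"
  shows "awp act_b Q R m"
proof -
  define v va vb vc where d: "v = R 14" "va = R 15" "vb = R 16" "vc = R 17"
  have cf: "confB N va v vb vc x y" using assms(4) by (simp add: d)
  note B = confB_facts[OF cf]
  have V: "v \<in> V" "va \<in> V" "vb \<in> V" "vc \<in> V"
    using wf_ngraphD(2)[OF wf, of v va] wf_ngraphD(2)[OF wf, of va v] wf_ngraphD(2)[OF wf, of vb v] wf_ngraphD(2)[OF wf, of vc v] B by auto
  have Vn: "v < n" "va < n" "vb < n" "vc < n" using V r by (auto simp: rep_def)
  have vc: "v \<in> N vc" using wf_ngraphD(3)[OF wf, of vc v] B by simp
  let ?R = "R(9 := R 9 - 1)"
  let ?N1 = "N(va := N va - {v} \<union> {vb})"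
  let ?N2 = "?N1(vb := ?N1 vb - {v} \<union> {va})"
  let ?N3 = "?N2(vc := ?N2 vc - {v})"
  let ?T = "resB (V, N) va v vb"
  have c5: "R 5 = 1" using e by (simp add: env_def)
  show ?thesis
    unfolding act_b_def awp.simps(8) sub_eq c5
  proof (rule awp_replace[of _ _ V N])
    fix R1 m1 assume 1: "frame ?R m R1 m1" "rep n m1 V (N(?R 15 := N (?R 15) - {?R 14} \<union> {?R 16}))"
    have rg1: "R1 14 = v" "R1 15 = va" "R1 16 = vb" "R1 17 = vc" using 1(1) by (simp_all add: frame_def d)
    have rep1: "rep n m1 V ?N1" using 1(2) by (simp add: d)
    have e1: "env R1 m1" using frame_env[OF 1(1)] e by simp
    show "awp (replace 16 14 15) (awp (delete 17 14) (awp (wr_deg 14 7) (awp (push3 15 16 17) Q))) R1 m1"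
    proof (rule awp_replace[OF e1 rep1])
      fix R2 m2 assume 2: "frame R1 m1 R2 m2" "rep n m2 V (?N1(R1 16 := ?N1 (R1 16) - {R1 14} \<union> {R1 15}))"
      have fr2: "frame ?R m R2 m2" by (rule frame_trans[OF 1(1) 2(1)])
      have rg2: "R2 14 = v" "R2 15 = va" "R2 16 = vb" "R2 17 = vc" using fr2 by (simp_all add: frame_def d)
      have rep2: "rep n m2 V ?N2" using 2(2) unfolding rg1 .
      have e2: "env R2 m2" by (rule frame_env[OF 2(1) e1])
      show "awp (delete 17 14) (awp (wr_deg 14 7) (awp (push3 15 16 17) Q)) R2 m2"
      proof (rule awp_delete[OF e2 rep2])
        fix R3 m3 assume 3: "frame R2 m2 R3 m3" "rep n m3 V (?N2(R2 17 := ?N2 (R2 17) - {R2 14}))"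
        have fr3: "frame ?R m R3 m3" by (rule frame_trans[OF fr2 3(1)])
        have rg3: "R3 14 = v" "R3 15 = va" "R3 16 = vb" "R3 17 = vc" "R3 8 = R 8" "R3 9 = R 9 - 1"
          using fr3 by (simp_all add: frame_def d)
        have rep3: "rep n m3 V ?N3" using 3(2) unfolding rg2 .
        have e3: "env R3 m3" by (rule frame_env[OF 3(1) e2])
        have r7: "R3 7 = 0" using e3 by (simp add: env_def)
        have vN: "v \<notin> N u" if "u \<notin> {va,vb,vc}" for u using wf_ngraphD(3)[OF wf, of v u] that B(2) by auto
        \<comment> \<open>Lists and \<open>resB\<close> disagree at the removed \<open>v\<close>,
          whose row is not cleared. Elsewhere they agree because only \<open>va\<close>,
          \<open>vb\<close>, \<open>vc\<close> list \<open>v\<close>.\<close>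
        have N': "?N3 u = snd ?T u" if "u \<in> V - {v}" for u
          using that B(4-9) vN[of u] by (auto simp: resB_def)
        have "rep n (m3(Deg v := 0)) (V - {v}) ?N3" using rep_kill[OF rep3 V(1)] .
        hence rep4: "rep n (m3(Deg v := 0)) (V - {v}) (snd ?T)" by (rule iffD1[OF rep_cong, rotated]) (rule N')
        let ?R4 = "R3(10 := b + v)" and ?m4 = "m3(Deg v := 0)"
        show "awp (wr_deg 14 7) (awp (push3 15 16 17) Q) R3 m3"
          unfolding awp_wr_deg[OF e3, of 14 7, unfolded rg3 r7, OF Vn(1), simplified]
        proof (rule awp_push3[OF _ rep4])
          fix R' m' assume 5: "\<forall>r. r \<notin> {8,10,11,12,13} \<longrightarrow> R' r = ?R4 r" "env R' m'" "rep n m' (V - {v}) (snd ?T)"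
            "R' 8 \<le> ?R4 8 + 12"
            "stk R' m' = stk ?R4 ?m4 \<union> local_nbrs (V - {v}) (snd ?T) (?R4 15) \<union> local_nbrs (V - {v}) (snd ?T) (?R4 16) \<union> local_nbrs (V - {v}) (snd ?T) (?R4 17)"
          have st: "stk ?R4 ?m4 = stk R m" using fr3 by (simp add: stk_def frame_def)
          have stk': "stk R' m' = stk R m \<union> (\<Union>u\<in>{va,vb,vc}. local_nbrs (V - {v}) (snd ?T) u)"
            using 5(5) unfolding st by (auto simp: rg3)
          have "local_nbrs (V - {v}) (snd ?T) u \<subseteq> {..<n}" for u
            by (rule local_nbrs_less[OF rep4])
          hence "stk R' m' \<subseteq> stk R m \<union> {..<n}" unfolding stk' by blast
          moreover have "step (V, N) (V - {v}, snd ?T)"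
            using stepB[of "(V, N)"] cf by (simp add: resB_def)
          moreover have "x \<in> stk R' m' \<or> x \<in> V \<and> anchor N x \<and> x \<noteq> R 14" if x: "x \<in> V - {v}" "anchor (snd ?T) x" for x
          proof -
            have "x \<in> (\<Union>u\<in>{va,vb,vc}. local_nbrs (V - {v}) (snd ?T) u) \<or> anchor N x"
            proof (rule anchor_pushed[OF x(2)])
              fix u assume u: "u \<notin> {va,vb,vc}" "card (snd ?T u) = 3"
              have "u \<noteq> v" using u(2) by (auto simp: resB_def)
              thus "snd ?T u = N u" using u(1) vN[OF u(1)] by (auto simp: resB_def)
            qed (use V B(4-9) in auto)
            thus ?thesis using x stk' d(1) by auto
          qed
          moreover have "R' 9 = card (V - {v})" using 5(1) rg3(6) cnt V(1) by simp
          ultimately have "acted R m V N R' m'"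
            unfolding acted_def using 5 stk' rg3 d by (intro exI[of _ "V - {v}"] exI[of _ "snd ?T"]) auto
          thus "Q R' m'" by (rule Q)
        qed (use e3 rg3 Vn t in simp_all)
      qed (use rg2 V vc B in auto)
    qed (use rg1 V Vn B in auto)
  qed (use e r V Vn B d in auto)
qed


lemma awp_act_a:
  assumes wf: "wf_ngraph (V, N)" and e: "env R m" and r: "rep n m V N"
    and c: "confA N (R 14) (R 15) (R 16) (R 17) (R 18) (R 19)" and cnt: "R 9 = card V" and t: "R 8 + 12 \<le> 15 * n"
    and Q: "\<And>R' m'. acted R m V N R' m' \<Longrightarrow> Q R' m'"
  shows "awp act_a Q R m"
proof -
  define vp vq vr vx vy vz where d: "vp = R 14" "vq = R 15" "vr = R 16" "vx = R 17" "vy = R 18" "vz = R 19"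
  have cf: "confA N vp vq vr vx vy vz" using c by (simp add: d)
  have A: "N vp = {vq,vr,vx}" "N vq = {vp,vr,vy}" "N vr = {vp,vq,vz}" 
    and ne: "vp \<noteq> vq" "vp \<noteq> vr" "vp \<noteq> vx" "vp \<noteq> vy" "vp \<noteq> vz" "vq \<noteq> vr" "vq \<noteq> vx" "vq \<noteq> vy" "vq \<noteq> vz"
      "vr \<noteq> vx" "vr \<noteq> vy" "vr \<noteq> vz" "vx \<noteq> vy" "vx \<noteq> vz" "vy \<noteq> vz"
    using cf by (simp_all add: confA_def)
  have V: "vp \<in> V" "vq \<in> V" "vr \<in> V" "vy \<in> V" "vz \<in> V"
    using wf_ngraphD(2)[OF wf, of _ vp] wf_ngraphD(2)[OF wf, of _ vq] wf_ngraphD(2)[OF wf, of _ vr] A by auto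
  have Vn: "vp < n" "vq < n" "vr < n" "vy < n" "vz < n" using V r by (auto simp: rep_def)
  have qN: "vq \<in> N u \<longleftrightarrow> u \<in> {vp,vr,vy}" and rN: "vr \<in> N u \<longleftrightarrow> u \<in> {vp,vq,vz}" and pN: "vp \<in> N u \<longleftrightarrow> u \<in> {vq,vr,vx}" for u
    using A wf_ngraphD(3)[OF wf, of u vq] wf_ngraphD(3)[OF wf, of vq u] wf_ngraphD(3)[OF wf, of u vr] wf_ngraphD(3)[OF wf, of vr u]
      wf_ngraphD(3)[OF wf, of u vp] wf_ngraphD(3)[OF wf, of vp u] by auto
  let ?R = "R(9 := R 9 - 1 - 1)"
  let ?N1 = "N(vy := N vy - {vq} \<union> {vp})"
  let ?N2 = "?N1(vz := ?N1 vz - {vr} \<union> {vp})"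
  let ?N3 = "?N2(vp := ?N2 vp - {vq} \<union> {vy})"
  let ?N4 = "?N3(vp := ?N3 vp - {vr} \<union> {vz})"
  let ?T = "resA (V, N) vp vq vr vx vy vz" and ?V = "V - {vq} - {vr}"
  have c5: "R 5 = 1" using e by (simp add: env_def)
  have R_eq: "(R(9 := R 9 - R 5))(9 := (R(9 := R 9 - R 5)) 9 - (R(9 := R 9 - R 5)) 5) = ?R"
    by (simp add: c5)
  have TN: "snd ?T u = N u" if "u \<notin> {vp,vq,vr,vy,vz}" for u
  proof -
    have "vq \<notin> N u" "vr \<notin> N u" using that qN rN by auto
    hence "merge vp vq vr ` N u = N u" by (force simp: merge_def image_iff)
    thus ?thesis using that by (simp add: resA_def)
  qed
  \<comment> \<open>The only discarded corner that \<open>vy\<close> sees is \<open>vq\<close>, so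
    the image under \<open>merge\<close> is a single replacement.\<close>
  have my: "merge vp vq vr ` N vy = N vy - {vq} \<union> {vp}"
    using qN[of vy] rN[of vy] ne by (auto simp: merge_def image_iff)
  have mz: "merge vp vq vr ` N vz = N vz - {vr} \<union> {vp}"
    using qN[of vz] rN[of vz] ne by (auto simp: merge_def image_iff)
  have N': "?N4 u = snd ?T u" if "u \<in> ?V" for u
  proof -
    have uqr: "u \<noteq> vq" "u \<noteq> vr" using that by auto
    consider "u = vp" | "u = vy" | "u = vz" | "u \<notin> {vp,vy,vz}" by blast
    thus ?thesis
    proof cases
      case 1 thus ?thesis using ne A(1) by (auto simp: resA_def)
    next
      case 2 thus ?thesis using ne my by (simp add: resA_def)
    next
      case 3 thus ?thesis using ne mz by (simp add: resA_def)
    next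
      case 4 thus ?thesis using TN[of u] uqr by simp
    qed
  qed
  show ?thesis
    unfolding act_a_def awp.simps(8) sub_eq R_eq
  proof (rule awp_replace[of _ _ V N])
    fix R1 m1 assume 1: "frame ?R m R1 m1" "rep n m1 V (N(?R 18 := N (?R 18) - {?R 15} \<union> {?R 14}))"
    have rg1: "R1 14 = vp" "R1 15 = vq" "R1 16 = vr" "R1 18 = vy" "R1 19 = vz" using 1(1) by (simp_all add: frame_def d)
    have rep1: "rep n m1 V ?N1" using 1(2) by (simp add: d)
    have e1: "env R1 m1" using frame_env[OF 1(1)] e by simp
    show "awp (replace 19 16 14) (awp (replace 14 15 18) (awp (replace 14 16 19) (awp (wr_deg 15 7) (awp (wr_deg 16 7) (awp (push3 14 18 19) Q))))) R1 m1"
    proof (rule awp_replace[OF e1 rep1])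
      fix R2 m2 assume 2: "frame R1 m1 R2 m2" "rep n m2 V (?N1(R1 19 := ?N1 (R1 19) - {R1 16} \<union> {R1 14}))"
      have fr2: "frame ?R m R2 m2" by (rule frame_trans[OF 1(1) 2(1)])
      have rg2: "R2 14 = vp" "R2 15 = vq" "R2 16 = vr" "R2 18 = vy" "R2 19 = vz" using fr2 by (simp_all add: frame_def d)
      have rep2: "rep n m2 V ?N2" using 2(2) unfolding rg1 .
      have e2: "env R2 m2" by (rule frame_env[OF 2(1) e1])
      show "awp (replace 14 15 18) (awp (replace 14 16 19) (awp (wr_deg 15 7) (awp (wr_deg 16 7) (awp (push3 14 18 19) Q)))) R2 m2"
      proof (rule awp_replace[OF e2 rep2])
        fix R3 m3 assume 3: "frame R2 m2 R3 m3" "rep n m3 V (?N2(R2 14 := ?N2 (R2 14) - {R2 15} \<union> {R2 18}))"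
        have fr3: "frame ?R m R3 m3" by (rule frame_trans[OF fr2 3(1)])
        have rg3: "R3 14 = vp" "R3 15 = vq" "R3 16 = vr" "R3 18 = vy" "R3 19 = vz" using fr3 by (simp_all add: frame_def d)
        have rep3: "rep n m3 V ?N3" using 3(2) unfolding rg2 .
        have e3: "env R3 m3" by (rule frame_env[OF 3(1) e2])
        show "awp (replace 14 16 19) (awp (wr_deg 15 7) (awp (wr_deg 16 7) (awp (push3 14 18 19) Q))) R3 m3"
        proof (rule awp_replace[OF e3 rep3])
          fix R4 m4 assume 4: "frame R3 m3 R4 m4" "rep n m4 V (?N3(R3 14 := ?N3 (R3 14) - {R3 16} \<union> {R3 19}))"
          have fr4: "frame ?R m R4 m4" by (rule frame_trans[OF fr3 4(1)])
          have rg4: "R4 14 = vp" "R4 15 = vq" "R4 16 = vr" "R4 18 = vy" "R4 19 = vz" "R4 8 = R 8" "R4 9 = R 9 - 1 - 1"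
            using fr4 by (simp_all add: frame_def d)
          have rep4: "rep n m4 V ?N4" using 4(2) unfolding rg3 .
          have e4: "env R4 m4" by (rule frame_env[OF 4(1) e3])
          have r7: "R4 7 = 0" using e4 by (simp add: env_def)
          let ?m6 = "m4(Deg vq := 0, Deg vr := 0)"
          have "rep n ?m6 ?V ?N4" using rep_kill[OF rep_kill[OF rep4 V(2)], of vr] V(3) ne by auto
          hence rep6: "rep n ?m6 ?V (snd ?T)" by (rule iffD1[OF rep_cong, rotated]) (rule N')
          let ?R6 = "R4(10 := b + vr)"
          have "awp (wr_deg 15 7) (awp (wr_deg 16 7) (awp (push3 14 18 19) Q)) R4 m4 = awp (push3 14 18 19) Q ?R6 ?m6"
            using e4 rg4 Vn r7 by (simp add: awp_wr_deg)
          moreover have "awp (push3 14 18 19) Q ?R6 ?m6"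
          proof (rule awp_push3[OF _ rep6])
            fix R' m' assume 5: "\<forall>r. r \<notin> {8,10,11,12,13} \<longrightarrow> R' r = ?R6 r" "env R' m'" "rep n m' ?V (snd ?T)"
              "R' 8 \<le> ?R6 8 + 12"
              "stk R' m' = stk ?R6 ?m6 \<union> local_nbrs ?V (snd ?T) (?R6 14) \<union> local_nbrs ?V (snd ?T) (?R6 18) \<union> local_nbrs ?V (snd ?T) (?R6 19)"
            have st: "stk ?R6 ?m6 = stk R m" using fr4 by (simp add: stk_def frame_def)
            have stk': "stk R' m' = stk R m \<union> (\<Union>u\<in>{vp,vy,vz}. local_nbrs ?V (snd ?T) u)"
              using 5(5) unfolding st by (auto simp: rg4)
            have "local_nbrs ?V (snd ?T) u \<subseteq> {..<n}" for u
              by (rule local_nbrs_less[OF rep6])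
            hence "stk R' m' \<subseteq> stk R m \<union> {..<n}" unfolding stk' by blast
            moreover have T: "?T = (?V, snd ?T)" by (auto simp: resA_def)
            have "step (V, N) ?T" by (rule stepA) (simp add: cf)
            hence "step (V, N) (?V, snd ?T)" using T by simp
            moreover have "x \<in> stk R' m' \<or> x \<in> V \<and> anchor N x \<and> x \<noteq> R 14" if x: "x \<in> ?V" "anchor (snd ?T) x" for x
            proof (cases "x = vp")
              \<comment> \<open>\<open>vp\<close> was popped but lives on as the contracted vertex.
                Its new degree is three, so it is pushed again.\<close>
              case True
              have "snd ?T vp = {vx,vy,vz}" by (simp add: resA_def)
              hence "card (snd ?T vp) = 3" using ne by simp
              hence "vp \<in> local_nbrs ?V (snd ?T) vp" using V(1) ne by (simp add: local_nbrs_def)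
              thus ?thesis using stk' True by blast
            next
              case False
              have "x \<in> (\<Union>u\<in>{vp,vy,vz}. local_nbrs ?V (snd ?T) u) \<or> anchor N x"
              proof (rule anchor_pushed[OF x(2)])
                fix u assume u: "u \<notin> {vp,vy,vz}" "card (snd ?T u) = 3"
                have "u \<noteq> vq" "u \<noteq> vr" using u(2) ne by (auto simp: resA_def split: if_splits)
                thus "snd ?T u = N u" using u(1) TN by blast
              qed (use V ne in auto)
              thus ?thesis using x stk' d(1) False by auto
            qed
            moreover have "R' 9 = card ?V" using 5(1) rg4(7) cnt V ne by simp
            ultimately have "acted R m V N R' m'"
              unfolding acted_def using 5 stk' rg4 d by (intro exI[of _ ?V] exI[of _ "snd ?T"]) auto
            thus "Q R' m'" by (rule Q)
          qed (use e4 rg4 Vn t in simp_all)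
          ultimately show "awp (wr_deg 15 7) (awp (wr_deg 16 7) (awp (push3 14 18 19) Q)) R4 m4" by simp
        qed (use rg3 V Vn A ne in auto)
      qed (use rg2 V Vn A ne in auto)
    qed (use rg1 V Vn A ne rN[of vz] pN[of vz] in auto)
  qed (use e r V Vn A ne d qN[of vy] pN[of vy] in auto)
qed

end

section \<open>The search at the popped vertex\<close>

lemma anchor_card:
  assumes "anchor N v" shows "card (N v) = 3"
proof -
  from assms consider q r x y z where "confA N v q r x y z" | p r s x y where "confB N p v r s x y"
    unfolding anchor_def by blast
  thus ?thesis by cases (simp_all add: confA_def confB_def)
qed

context sparse_ram begin

text \<open>Lets scratch registers be set before a reduction without affecting what it
  guarantees.\<close>

lemma acted_cong: "R 8 = S 8 \<Longrightarrow> R 14 = S 14 \<Longrightarrow> acted R m V N = acted S m V N"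
  by (intro ext) (simp add: acted_def stk_def)

lemma awp_probe:
  assumes wf: "wf_ngraph (V, N)" and e: "env R m" and r: "rep n m V N" and v: "R 14 \<in> V"
    and Nv: "N (R 14) = {R 15, R 16, R 17}" "distinct [R 15, R 16, R 17]"
    and cnt: "R 9 = card V" and t: "R 8 + 12 \<le> 15 * n"
    and Q1: "\<And>R'. (\<forall>r. r \<notin> {18,19,20,21} \<longrightarrow> R' r = R r) \<Longrightarrow> \<not> triggered N (R 14) (R 15) (R 16) (R 17) \<Longrightarrow> Q R' m"
    and Q2: "\<And>R' m'. acted R m V N R' m' \<Longrightarrow> Q R' m'"
  shows "awp probe Q R m"
proof -
  note sym = wf_ngraphD(3)[OF wf, simplified] and irr = wf_ngraphD(4)[OF wf, simplified]
  have V: "R 15 \<in> V" "R 16 \<in> V" "R 17 \<in> V"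
    using wf_ngraphD(2)[OF wf, of _ "R 14"] Nv by auto
  have Vn: "R 14 < n" "R 15 < n" "R 16 < n" "R 17 < n" using V v r by (auto simp: rep_def)
  have ne: "R 14 \<noteq> R 15" "R 14 \<noteq> R 16" "R 14 \<noteq> R 17" "R 15 \<noteq> R 16" "R 15 \<noteq> R 17" "R 16 \<noteq> R 17"
    using irr[of "R 14"] Nv by auto
  have vN: "R 14 \<in> N (R 15)" "R 14 \<in> N (R 16)" "R 14 \<in> N (R 17)" using Nv(1) by (auto intro: sym)
  have c: "R 6 = 3" "R 7 = 0" using e by (auto simp: env_def)
  have trig3: "card (N (R 15)) = 3 \<and> card (N (R 16)) = 3" if "triggered N (R 14) (R 15) (R 16) (R 17)"
    using that unfolding triggered_def by (auto simp: confA_def confB_def)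
  have D: "m (Deg (R 15)) = 3 \<longleftrightarrow> card (N (R 15)) = 3" "m (Deg (R 16)) = 3 \<longleftrightarrow> card (N (R 16)) = 3"
    using rep_deg3[OF r] Vn V by auto
  have P: "m (Pos (R i) (R j)) = 0 \<longleftrightarrow> R j \<notin> N (R i)" if "i \<in> {15,16,17}" "j \<in> {15,16,17}" for i j
    using rep_pos[OF r] V Vn that by auto
  show ?thesis
  proof (cases "card (N (R 15)) = 3 \<and> card (N (R 16)) = 3")
    case False
    hence "\<not> triggered N (R 14) (R 15) (R 16) (R 17)" using trig3 by blast
    thus ?thesis unfolding probe_def using e Vn c False D
      by (auto simp: exec_simps intro: Q1)
  next
    case True
    note c3 = True[THEN conjunct1] True[THEN conjunct2]
    have "awp try_b Q R' m" if nadj: "R 16 \<notin> N (R 15)" and R': "R' = R(20 := 0)" for R'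
    proof -
      have nt: "\<not> triggered N (R 14) (R 15) (R 16) (R 17)" if "R 17 \<notin> N (R 15) \<or> R 17 \<notin> N (R 16)"
        using that nadj unfolding triggered_def by (auto simp: confA_def confB_def)
      show ?thesis
      proof (cases "R 17 \<in> N (R 15) \<and> R 17 \<in> N (R 16)")
        case False
        thus ?thesis unfolding try_b_def R' using e Vn c nt P[of 15 17] P[of 16 17]
          by (auto simp: exec_simps intro!: Q1)
      next
        case T: True
        obtain x where x: "N (R 15) = {R 14, R 17, x}" "x \<noteq> R 14" "x \<noteq> R 17"
          using card3_obtain[OF c3(1) vN(1) T[THEN conjunct1] ne(3)] by blast
        obtain y where y: "N (R 16) = {R 14, R 17, y}" "y \<noteq> R 14" "y \<noteq> R 17"
          using card3_obtain[OF c3(2) vN(2) T[THEN conjunct2] ne(3)] by blast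
        have xy: "x \<noteq> R 15" "y \<noteq> R 16" "x \<noteq> R 16" "y \<noteq> R 15"
          using irr[of "R 15"] irr[of "R 16"] nadj sym[of "R 15" "R 16"] x(1) y(1) by auto
        have cf: "confB N (R 15) (R 14) (R 16) (R 17) x y"
          unfolding confB_def using x y Nv(1) ne xy by (auto simp: insert_commute)
        let ?R = "R(20 := m (Pos (R 16) (R 17)))"
        have "awp act_b Q ?R m"
          by (rule awp_act_b[OF wf _ r, of _ x y]) (use e cf cnt t Q2 acted_cong[of ?R R] in auto)
        thus ?thesis unfolding try_b_def R' using e Vn c T P[of 15 17] P[of 16 17]
          by (auto simp: exec_simps)
      qed
    qed
    moreover have "awp try_a Q R' m" if adj: "R 16 \<in> N (R 15)" and R': "R' = R(20 := m (Pos (R 15) (R 16)))" for R'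
    proof -
      obtain y where y: "N (R 15) = {R 14, R 16, y}" "y \<noteq> R 14" "y \<noteq> R 16"
        using card3_obtain[OF c3(1) vN(1) adj ne(2)] by blast
      obtain z where z: "N (R 16) = {R 14, R 15, z}" "z \<noteq> R 14" "z \<noteq> R 15"
        using card3_obtain[OF c3(2) vN(2) sym[OF adj] ne(1)] by blast
      have yz: "y \<noteq> R 15" "z \<noteq> R 16" using irr[of "R 15"] irr[of "R 16"] y(1) z(1) by auto
      define x1 x2 where x12: "x1 = m (Nb (R 15) 3)" "x2 = m (Nb (R 16) 3)"
      let ?R1 = "R'(20 := 2, 21 := x1, 18 := y)"
      let ?R2 = "?R1(20 := 2, 21 := x2, 19 := z)"
      have e1: "env ?R1 m" using e by (simp add: R')
      have "awp try_a Q R' m = awp (Seq (outer 19 16 14 15)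
         (If (Equal 18 19) Skip (If (Equal 18 17) Skip (If (Equal 19 17) Skip act_a)))) Q ?R1 m"
        unfolding try_a_def awp.simps(8)
        by (subst awp_outer[where y = y and V = V and N = N]) (use e r V y ne x12 in \<open>auto simp: R'\<close>)
      also have "\<dots> = awp (If (Equal 18 19) Skip (If (Equal 18 17) Skip (If (Equal 19 17) Skip act_a))) Q ?R2 m"
        unfolding awp.simps(8)
        by (subst awp_outer[where y = z and V = V and N = N]) (use e1 r V z ne x12 in \<open>auto simp: R'\<close>)
      finally have eq: "awp try_a Q R' m = \<dots>" .
      show ?thesis
      proof (cases "y = z \<or> y = R 17 \<or> z = R 17")
        case True
        have "\<not> triggered N (R 14) (R 15) (R 16) (R 17)"
        proof
          assume "triggered N (R 14) (R 15) (R 16) (R 17)"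
          then consider y' z' where "confA N (R 14) (R 15) (R 16) (R 17) y' z'"
            | x' y' where "confB N (R 15) (R 14) (R 16) (R 17) x' y'" unfolding triggered_def by blast
          thus False
          proof cases
            case 1
            hence "y' \<in> N (R 15)" "y' \<noteq> R 14" "y' \<noteq> R 16" "z' \<in> N (R 16)" "z' \<noteq> R 14" "z' \<noteq> R 15"
              by (auto simp: confA_def)
            \<comment> \<open>The third neighbours are unique, so a triggering triangle would have
              to use \<open>y\<close> and \<open>z\<close>.\<close>
            hence "y' = y" "z' = z" unfolding y(1) z(1) by simp_all
            thus False using 1 True by (auto simp: confA_def)
          next
            case 2 thus False using adj confB_facts(18)[OF 2] by blast
          qed
        qed
        hence "Q ?R2 m" by (intro Q1) (simp_all add: R')
        thus ?thesis unfolding eq awp.simps(1,9) test_holds.simps using True by (auto simp: R')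
      next
        case False
        have cf: "confA N (R 14) (R 15) (R 16) (R 17) y z"
          unfolding confA_def using y z Nv(1) ne yz False by auto
        have "awp act_a Q ?R2 m"
          by (rule awp_act_a[OF wf _ r]) (use e cf cnt t Q2 acted_cong[of ?R2 R] in \<open>auto simp: R'\<close>)
        thus ?thesis unfolding eq using False by (auto simp: exec_simps R')
      qed
    qed
    ultimately show ?thesis unfolding probe_def using e Vn c True D P[of 15 16]
      by (auto simp: exec_simps)
  qed
qed

lemma awp_attempt:
  assumes wf: "wf_ngraph (V, N)" and e: "env R m" and r: "rep n m V N" and v: "R 14 < n"
    and cnt: "R 9 = card V" and t: "13 * R 9 + R 8 \<le> 14 * n"
    and ijk: "(i, j, k) \<in> {(1,2,3), (2,3,1), (3,1,2)}"
    and Q1: "\<And>R'. (\<forall>r \<le> 14. R' r = R r) \<Longrightarrow> (R 14 \<in> V \<Longrightarrow> card (N (R 14)) = 3 \<Longrightarrow>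
      \<not> triggered N (R 14) (m (Nb (R 14) i)) (m (Nb (R 14) j)) (m (Nb (R 14) k))) \<Longrightarrow> Q R' m"
    and Q2: "\<And>R' m'. acted R m V N R' m' \<Longrightarrow> Q R' m'"
  shows "awp (attempt i j k) Q R m"
proof (cases "m (Deg (R 14)) = 3")
  case False
  hence n: "\<not> (R 14 \<in> V \<and> card (N (R 14)) = 3)" using rep_deg3[OF r v] by simp
  have c: "R 6 = 3" using e by (simp add: env_def)
  show ?thesis
    unfolding attempt_def using e v c False n by (auto simp: exec_simps intro!: Q1)
next
  case True
  hence vV: "R 14 \<in> V" "card (N (R 14)) = 3" using rep_deg3[OF r v] by auto
  note nb = rep_nb3[OF r vV]
  have a: "adj_row n m (R 14) (N (R 14))" using r vV(1) by (simp add: rep_def)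
  have n: "3 < n" using adj_row_less[OF a v] True by simp
  have lt: "i < n" "j < n" "k < n" "i < W" "j < W" "k < W" using ijk n wide by auto
  have Nv: "N (R 14) = {m (Nb (R 14) i), m (Nb (R 14) j), m (Nb (R 14) k)}"
    "distinct [m (Nb (R 14) i), m (Nb (R 14) j), m (Nb (R 14) k)]" using ijk nb by auto
  have c: "R 6 = 3" using e by (simp add: env_def)
  have "finite V" using wf_ngraphD(1)[OF wf] by simp
  \<comment> \<open>One vertex remains, which ties up 13 units of the potential; so twelve more
    pushes fit on the stack.\<close>
  hence "card V \<noteq> 0" using vV(1) by auto
  hence t': "R 8 + 12 \<le> 15 * n" using t cnt by linarith
  let ?R = "R(15 := m (Nb (R 14) i), 16 := m (Nb (R 14) j), 20 := k, 17 := m (Nb (R 14) k))"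
  have "awp probe Q ?R m"
    by (rule awp_probe[OF wf _ r]) (use e vV Nv cnt t' Q2 acted_cong[of ?R R] in \<open>auto intro!: Q1\<close>)
  moreover have "R(20 := i, 15 := m (Nb (R 14) i), 20 := j, 16 := m (Nb (R 14) j), 20 := k, 17 := m (Nb (R 14) k)) = ?R"
    by (simp add: fun_upd_twist)
  ultimately show ?thesis
    unfolding attempt_def using e v c True lt by (simp add: exec_simps fun_upd_twist)
qed

text \<open>\<open>\<rho>\<close> is the fixed answer for the input graph. The weight 13 makes the
  potential drop with every reduction, which removes at least one vertex and pushes at most
  twelve.\<close>

definition sound_state where
  "sound_state \<rho> R m V N \<longleftrightarrow> env R m \<and> rep n m V N \<and> wf_ngraph (V, N) \<and> R 9 = card V \<and> stk R m \<subseteq> {..<n} \<and>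
     13 * R 9 + R 8 \<le> 14 * n \<and> (D3_reducible (ugraph_of (V, N)) \<longleftrightarrow> \<rho>)"

text \<open>The state between rotations. Either the stack is complete, as after a reduction, or the
  popped vertex is the only anchor that may be missing, and the rotations in \<open>L\<close> are
  ruled out for it. \<open>p\<close> caps the potential at its value after the pop.\<close>

definition tried where
  "tried \<rho> p L R m \<longleftrightarrow> (\<exists>V N. sound_state \<rho> R m V N \<and> 13 * R 9 + R 8 \<le> p \<and> R 14 < n \<and>
     ((\<forall>x\<in>V. anchor N x \<longrightarrow> x \<in> stk R m) \<or>
      (\<forall>x\<in>V. anchor N x \<longrightarrow> x \<in> stk R m \<or> x = R 14) \<and>
      (\<forall>(i,j,k) \<in> L. R 14 \<in> V \<longrightarrow> card (N (R 14)) = 3 \<longrightarrow>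
        \<not> triggered N (R 14) (m (Nb (R 14) i)) (m (Nb (R 14) j)) (m (Nb (R 14) k)))))"

definition covered where
  "covered \<rho> R m \<longleftrightarrow> (\<exists>V N. sound_state \<rho> R m V N \<and> (\<forall>x\<in>V. anchor N x \<longrightarrow> x \<in> stk R m))"

lemma stk_cong: "R' 8 = R 8 \<Longrightarrow> stk R' m = stk R m"
  by (simp add: stk_def)

lemma env_cong: "\<forall>r\<le>7. R' r = R r \<Longrightarrow> env R' m = env R m"
  by (simp add: env_def)

lemma tried_attempt:
  assumes T: "tried \<rho> p L R m" and ijk: "(i, j, k) \<in> {(1,2,3), (2,3,1), (3,1,2)}"
  shows "awp (attempt i j k) (tried \<rho> p (insert (i,j,k) L)) R m"
proof -
  obtain V N where S: "sound_state \<rho> R m V N" and p: "13 * R 9 + R 8 \<le> p" "R 14 < n"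
    and C: "(\<forall>x\<in>V. anchor N x \<longrightarrow> x \<in> stk R m) \<or>
      (\<forall>x\<in>V. anchor N x \<longrightarrow> x \<in> stk R m \<or> x = R 14) \<and>
      (\<forall>(i,j,k) \<in> L. R 14 \<in> V \<longrightarrow> card (N (R 14)) = 3 \<longrightarrow>
        \<not> triggered N (R 14) (m (Nb (R 14) i)) (m (Nb (R 14) j)) (m (Nb (R 14) k)))"
    using T unfolding tried_def by blast
  have s: "env R m" "rep n m V N" "wf_ngraph (V, N)" "R 9 = card V" "stk R m \<subseteq> {..<n}" "13 * R 9 + R 8 \<le> 14 * n"
    "D3_reducible (ugraph_of (V, N)) \<longleftrightarrow> \<rho>" using S unfolding sound_state_def by blast+
  note wf = s(3)
  show ?thesis
  proof (rule awp_attempt[OF wf s(1,2) p(2) s(4,6) ijk])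
    fix R' assume R': "\<forall>r\<le>14. R' r = R r" and nt: "R 14 \<in> V \<Longrightarrow> card (N (R 14)) = 3 \<Longrightarrow>
      \<not> triggered N (R 14) (m (Nb (R 14) i)) (m (Nb (R 14) j)) (m (Nb (R 14) k))"
    have st: "stk R' m = stk R m" using R' by (intro stk_cong) simp
    have "sound_state \<rho> R' m V N" using s R' st env_cong[of R' R m] by (simp add: sound_state_def)
    thus "tried \<rho> p (insert (i,j,k) L) R' m"
      unfolding tried_def st using R' p C nt by (intro exI[of _ V] exI[of _ N]) auto
  next
    fix R' m' assume "acted R m V N R' m'"
    then obtain V' N' where A: "env R' m'" "rep n m' V' N'" "step (V, N) (V', N')" "R' 9 = card V'" "R' 14 = R 14"
      "R' 8 \<le> R 8 + 12" "stk R m \<subseteq> stk R' m'" "stk R' m' \<subseteq> stk R m \<union> {..<n}"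
      "\<forall>x\<in>V'. anchor N' x \<longrightarrow> x \<in> stk R' m' \<or> x \<in> V \<and> anchor N x \<and> x \<noteq> R 14"
      unfolding acted_def by blast
    have wf': "wf_ngraph (V', N')" by (rule wf_step[OF A(3) wf])
    have "card V' < card V" using card_step[OF wf A(3)] by simp
    hence lt: "13 * R' 9 + R' 8 < 13 * R 9 + R 8" using A(4,6) s by linarith
    have "D3_reducible (ugraph_of (V', N')) = D3_reducible (ugraph_of (V, N))"
      using reducible_step[OF wf A(3)] reducible_if_step[OF wf A(3)] by blast
    hence "sound_state \<rho> R' m' V' N'" using s A wf' lt by (auto simp: sound_state_def)
    \<comment> \<open>Before the step only the popped vertex could be missing, and
      \<open>acted\<close> excludes it; the stack is complete again.\<close>
    moreover have "\<forall>x\<in>V'. anchor N' x \<longrightarrow> x \<in> stk R' m'" using A(7,9) C by blast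
    ultimately show "tried \<rho> p (insert (i,j,k) L) R' m'"
      unfolding tried_def using lt p A(5) by (intro exI[of _ V'] exI[of _ N']) auto
  qed
qed

lemma awp_process:
  assumes "covered \<rho> R m" and pos: "0 < R 8"
  shows "awp process (\<lambda>R' m'. covered \<rho> R' m' \<and> 13 * R' 9 + R' 8 < 13 * R 9 + R 8) R m"
proof -
  obtain V N where S: "sound_state \<rho> R m V N" and C: "\<forall>x\<in>V. anchor N x \<longrightarrow> x \<in> stk R m"
    using assms(1) unfolding covered_def by blast
  note s = S[unfolded sound_state_def]
  have c: "R 5 = 1" "R 4 = b + 2 * n + 2 * n * n" using s by (auto simp: env_def)
  define t where "t = R 8 - 1"
  have t: "R 8 = Suc t" using pos by (simp add: t_def)
  let ?v = "m (Stk t)"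
  let ?R = "R(8 := t, 10 := b + 2 * n + 2 * n * n + t, 14 := ?v)"
  let ?p = "13 * ?R 9 + ?R 8"
  have st: "stk R m = insert ?v (stk ?R m)" by (simp add: stk_def t lessThan_Suc)
  have tW: "b + 2 * n + 2 * n * n + t < W" using s t wide by simp
  have "tried \<rho> ?p {} ?R m"
    unfolding tried_def using s C st t
    by (intro exI[of _ V] exI[of _ N]) (auto simp: sound_state_def)
  hence 1: "awp (attempt 1 2 3) (tried \<rho> ?p {(1,2,3)}) ?R m" by (rule tried_attempt) simp
  have 2: "awp (attempt 2 3 1) (tried \<rho> ?p {(2,3,1),(1,2,3)}) R1 m1" if "tried \<rho> ?p {(1,2,3)} R1 m1" for R1 m1
    using that by (rule tried_attempt) simp
  have 3: "awp (attempt 3 1 2) (tried \<rho> ?p {(3,1,2),(2,3,1),(1,2,3)}) R1 m1" if "tried \<rho> ?p {(2,3,1),(1,2,3)} R1 m1" for R1 m1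
    using that by (rule tried_attempt) simp
  have 4: "covered \<rho> R' m' \<and> 13 * R' 9 + R' 8 < 13 * R 9 + R 8" if T: "tried \<rho> ?p {(3,1,2),(2,3,1),(1,2,3)} R' m'" for R' m'
  proof -
    obtain V N where S: "sound_state \<rho> R' m' V N" and p: "13 * R' 9 + R' 8 \<le> ?p" 
      and C: "(\<forall>x\<in>V. anchor N x \<longrightarrow> x \<in> stk R' m') \<or>
      (\<forall>x\<in>V. anchor N x \<longrightarrow> x \<in> stk R' m' \<or> x = R' 14) \<and>
      (\<forall>(i,j,k) \<in> {(3,1,2),(2,3,1),(1,2,3)}. R' 14 \<in> V \<longrightarrow> card (N (R' 14)) = 3 \<longrightarrow>
        \<not> triggered N (R' 14) (m' (Nb (R' 14) i)) (m' (Nb (R' 14) j)) (m' (Nb (R' 14) k)))"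
      using T unfolding tried_def by blast
    \<comment> \<open>If an anchor were missing, it would be the popped vertex with all three
      rotations refuted, against \<open>anchor_triggered\<close>.\<close>
    have "\<forall>x\<in>V. anchor N x \<longrightarrow> x \<in> stk R' m'"
    proof (rule ccontr)
      assume no: "\<not> ?thesis"
      hence v: "R' 14 \<in> V" "anchor N (R' 14)" using C by auto
      have c3: "card (N (R' 14)) = 3" using v(2) by (rule anchor_card)
      have r: "rep n m' V N" using S by (simp add: sound_state_def)
      show False
        using anchor_triggered[OF v(2) rep_nb3[OF r v(1) c3]] C no v(1) c3 by auto
    qed
    thus ?thesis using S p t unfolding covered_def by auto
  qed
  let ?Q = "\<lambda>R' m'. covered \<rho> R' m' \<and> 13 * R' 9 + R' 8 < 13 * R 9 + R 8"
  have 3: "awp (attempt 3 1 2) ?Q R1 m1" if "tried \<rho> ?p {(2,3,1),(1,2,3)} R1 m1" for R1 m1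
    by (rule awp_mono[OF 3[OF that]]) (rule 4)
  have 2: "awp (attempt 2 3 1) (awp (attempt 3 1 2) ?Q) R1 m1" if "tried \<rho> ?p {(1,2,3)} R1 m1" for R1 m1
    by (rule awp_mono[OF 2[OF that]]) (rule 3)
  have "awp (attempt 1 2 3) (awp (attempt 2 3 1) (awp (attempt 3 1 2) ?Q)) ?R m"
    by (rule awp_mono[OF 1]) (rule 2)
  moreover have "awp (Load 14 10) Q (R(8 := t, 10 := b + 2 * n + 2 * n * n + t)) m = Q ?R m" for Q
    by (subst load_iff[of "Stk t"]) simp_all
  ultimately show ?thesis
    unfolding process_def awp.simps(8) sub_eq using c t tW by (subst add_iff) simp_all
qed

end

section \<open>The recognizer\<close>

text \<open>Uses that registers start at 0: register 7 serves as address 0 and is never written.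
  Register 2 becomes the input length, two sizes and two cells per edge.\<close>

definition read_sizes :: prog where
  "read_sizes = Seq (Const 5 1) (Seq (Load 1 7) (Seq (Load 11 5) (Seq (Add 2 11 11) (Seq (Const 10 2) (Seq (Add 2 2 10)
     (Seq (Add 3 2 1) (Seq (Const 6 3) (Seq (Add 12 3 1) (Add 13 1 1)))))))))"

text \<open>Row addresses arise by repeated addition of \<open>2 * n\<close>; after the last row,
  register 12 is the start of the stack.\<close>

definition set_row :: prog where
  "set_row = Seq (Add 10 3 14) (Seq (Store 10 12) (Seq (Add 12 12 13) (Add 14 14 5)))"

definition add_edge :: prog where
  "add_edge = Seq (Load 15 14) (Seq (Add 14 14 5) (Seq (Load 16 14) (Seq (Add 14 14 5)
     (Seq (append 15 16) (append 16 15)))))"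

text \<open>Removed vertices have degree 0, so the count may run over all original vertices.\<close>

definition count_cubic :: prog where
  "count_cubic = Seq (rd_deg 11 14) (Seq (If (Equal 11 6) (Add 15 15 5) Skip) (Add 14 14 5))"

definition answer :: prog where
  "answer = Seq (Const 10 4) (If (Equal 9 10) (If (Equal 15 10) (Const 0 1) (Const 0 0)) (Const 0 0))"

text \<open>\<open>push 8\<close> stores the current height as a vertex, so the initial stack holds
  every vertex once.\<close>

definition recognizer :: prog where
  "recognizer = Seq read_sizes (Seq (While (Less 14 1) set_row) (Seq (Copy 4 12) (Seq (While (Less 8 1) (push 8))
     (Seq (Seq (Copy 9 1) (Const 14 2)) (Seq (While (Less 14 2) add_edge) (Seq (While (Less 7 8) process)
     (Seq (Seq (Const 14 0) (Const 15 0)) (Seq (While (Less 14 1) count_cubic) answer))))))))"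

lemma length_input_words: "length (input_words n es) = 2 * length es + 2"
  by (induction es) (auto simp: input_words_def)

lemma nth_concat_pairs:
  "j < length es \<Longrightarrow> concat (map (\<lambda>(u, v). [u, v]) es) ! (2 * j) = fst (es ! j) \<and>
     concat (map (\<lambda>(u, v). [u, v]) es) ! Suc (2 * j) = snd (es ! j)"
proof (induction es arbitrary: j)
  case (Cons e es)
  obtain u v where "e = (u, v)" by (cases e)
  thus ?case using Cons by (cases j) auto
qed simp

lemma nth_input_words:
  "input_words n es ! 0 = n" "input_words n es ! 1 = length es"
  "j < length es \<Longrightarrow> input_words n es ! (2 + 2 * j) = fst (es ! j)"
  "j < length es \<Longrightarrow> input_words n es ! (3 + 2 * j) = snd (es ! j)"
  using nth_concat_pairs[of j es] by (simp_all add: input_words_def numeral_3_eq_3 numeral_2_eq_2)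

section \<open>Correctness of the phases of the recognizer\<close>

locale graph_input = sparse_ram +
  fixes G :: "nat ugraph" and es :: "(nat \<times> nat) list"
  assumes G: "simple_graph G" "verts G = {..<n}" "edge_list G es" and b: "b = 2 * length es + 2"
begin

definition init_mem :: lmem where
  "init_mem l = (case l of Inp i \<Rightarrow> input_words n es ! i | _ \<Rightarrow> 0)"

text \<open>Records the zeros that matter, degrees and positions. List cells have a meaning only up
  to the degree and are left free.\<close>

definition blank :: "lmem \<Rightarrow> bool" where
  "blank m \<longleftrightarrow> (\<forall>v. m (Deg v) = 0) \<and> (\<forall>v i. m (Pos v i) = 0) \<and> (\<forall>i. m (Inp i) = init_mem (Inp i))"

lemma mrel_init: "mrel (snd (initial_state (input_words n es))) init_mem"
  unfolding mrel_def
proof (intro allI impI)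
  fix l assume "valid l"
  have len: "length (input_words n es) = b" by (simp add: length_input_words b)
  show "snd (initial_state (input_words n es)) (addr l) = init_mem l"
    using \<open>valid l\<close> by (cases l) (simp_all add: initial_state_def init_mem_def len)
qed

definition rows_inv where
  "rows_inv R m k \<longleftrightarrow> R 1 = n \<and> R 2 = b \<and> R 3 = b + n \<and> R 5 = 1 \<and> R 6 = 3 \<and> R 7 = 0 \<and> R 8 = 0 \<and>
     R 14 \<le> n \<and> k = n - R 14 \<and> R 12 = b + 2 * n + 2 * n * R 14 \<and> R 13 = 2 * n \<and>
     (\<forall>v<R 14. m (Row v) = b + 2 * n + 2 * n * v) \<and> blank m"

lemma read_sizes: "ewp read_sizes (cost read_sizes) (\<lambda>R m. rows_inv R m n) (\<lambda>_. 0) init_mem"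
proof (rule ewp_awp)
  have i0: "init_mem (Inp 0) = n" "init_mem (Inp 1) = length es"
    by (simp_all add: init_mem_def nth_input_words[unfolded One_nat_def])
  have W: "b + n + n < W" "3 < W" using wide by auto
  have bb: "Suc (Suc (2 * length es)) = b" "length es + length es = 2 * length es" using b by simp_all
  hence W2: "2 * length es < W" "Suc (Suc (2 * length es + n)) < W" "Suc (Suc (2 * n + 2 * length es)) < W" using W by linarith+
  have bl: "blank init_mem" by (simp add: blank_def init_mem_def)
  have b2: "0 < b" "1 < b" using b by simp_all
  show "awp read_sizes (\<lambda>R m. rows_inv R m n) (\<lambda>_. 0) init_mem"
    unfolding read_sizes_def awp.simps(8)
    apply (subst const_eq) subgoal using W by simp
    apply (subst load_iff[of "Inp 0"]) subgoal using b2 by simp subgoal by simp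
    apply (subst load_iff[of "Inp 1"]) subgoal using b2 by simp subgoal by simp
    unfolding i0
    using W W2 bl apply (simp add: exec_simps awp.simps(4) rows_inv_def bb)
    done
qed

lemma set_row:
  assumes "rows_inv R m k" "test_holds (Less 14 1) R"
  shows "awp set_row (\<lambda>R' m'. \<exists>k'<k. rows_inv R' m' k') R m"
proof -
  note I = assms(1)[unfolded rows_inv_def]
  have lt: "R 14 < n" using assms(2) I by simp
  have W: "b + 2 * n + 2 * n * Suc (R 14) < W"
  proof -
    have "2 * n * Suc (R 14) \<le> 2 * n * n" using lt by (intro mult_le_mono2) simp
    thus ?thesis using wide by linarith
  qed
  let ?R = "R(10 := b + n + R 14, 12 := b + 2 * n + 2 * n * Suc (R 14), 14 := Suc (R 14))"
  let ?m = "m(Row (R 14) := b + 2 * n + 2 * n * R 14)"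
  have "rows_inv ?R ?m (n - Suc (R 14))"
    using I lt by (auto simp: rows_inv_def blank_def less_Suc_eq)
  hence "\<exists>k'<k. rows_inv ?R ?m k'" using I lt by (intro exI[of _ "n - Suc (R 14)"]) simp
  thus ?thesis
    unfolding set_row_def awp.simps(8)
    apply (subst add_iff) subgoal using I lt wide by simp
    apply (subst store_iff[of "Row (R 14)"]) subgoal using lt by simp subgoal using I by simp
    using I lt W wide apply (simp add: awp.simps(4) algebra_simps)
    done
qed

definition push_inv where
  "push_inv R m k \<longleftrightarrow> env R m \<and> R 8 \<le> n \<and> k = n - R 8 \<and> (\<forall>i<R 8. m (Stk i) = i) \<and> blank m"

lemma rows_done:
  assumes "rows_inv R m k" "\<not> test_holds (Less 14 1) R"
  shows "awp (Copy 4 12) (\<lambda>R m. push_inv R m n) R m"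
  using assms by (auto simp: rows_inv_def push_inv_def env_def awp.simps)

lemma push_init:
  assumes "push_inv R m k" "test_holds (Less 8 1) R"
  shows "awp (push 8) (\<lambda>R' m'. \<exists>k'<k. push_inv R' m' k') R m"
proof -
  note I = assms(1)[unfolded push_inv_def]
  have lt: "R 8 < n" using assms(2) I by (simp add: env_def)
  let ?R = "R(10 := addr (Stk (R 8)), 8 := Suc (R 8))"
  have "push_inv ?R (m(Stk (R 8) := R 8)) (n - Suc (R 8))"
    using I lt by (auto simp: push_inv_def blank_def less_Suc_eq)
  hence "\<exists>k'<k. push_inv ?R (m(Stk (R 8) := R 8)) k'"
    using I lt by (intro exI[of _ "n - Suc (R 8)"]) simp
  thus ?thesis by (subst awp_push) (use I lt in simp_all)
qed

definition prefix_nbrs :: "nat \<Rightarrow> nat \<Rightarrow> nat set" where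
  "prefix_nbrs j v = {u. {v, u} \<in> set (map (\<lambda>(u, v). {u, v}) (take j es))}"

definition edge_inv where
  "edge_inv R m k \<longleftrightarrow> env R m \<and> R 8 = n \<and> R 9 = n \<and> stk R m = {..<n} \<and> (\<forall>i. m (Inp i) = init_mem (Inp i)) \<and>
     (\<exists>j\<le>length es. R 14 = 2 + 2 * j \<and> k = length es - j \<and> rep n m {..<n} (prefix_nbrs j))"

lemma push_done:
  assumes "push_inv R m k" "\<not> test_holds (Less 8 1) R"
  shows "awp (Seq (Copy 9 1) (Const 14 2)) (\<lambda>R m. edge_inv R m (length es)) R m"
proof -
  note I = assms(1)[unfolded push_inv_def]
  have R: "R 8 = n" "R 1 = n" using assms(2) I by (auto simp: env_def)
  have "rep n m {..<n} (prefix_nbrs 0)"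
    using I by (auto simp: rep_def adj_row_def prefix_nbrs_def blank_def)
  moreover have "stk R m = {..<n}" using I R by (simp add: stk_def)
  ultimately show ?thesis
    using I R wide by (auto simp: awp.simps edge_inv_def stk_def blank_def intro!: exI[of _ 0])
qed

text \<open>Each unordered pair is listed once, so neither endpoint lists the other yet, as
  \<open>awp_append\<close> requires.\<close>

lemma edge_props:
  assumes j: "j < length es" and e: "es ! j = (u, w)"
  shows "u < n" "w < n" "u \<noteq> w" "w \<notin> prefix_nbrs j u" "u \<notin> prefix_nbrs j w"
    "prefix_nbrs (Suc j) = (prefix_nbrs j)(u := insert w (prefix_nbrs j u), w := insert u (prefix_nbrs j w))"
proof -
  let ?f = "\<lambda>(u, v). {u, v}"
  have d: "distinct (map ?f es)" and s: "set (map ?f es) = edges G" using G(3) by (auto simp: edge_list_def)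
  have "{u, w} \<in> edges G" using nth_mem[OF j] e unfolding s[symmetric] by force
  thus uw: "u < n" "w < n" "u \<noteq> w" using G(1,2) unfolding simple_graph_def by force+
  have t: "take (Suc j) es = take j es @ [(u, w)]" using j e by (simp add: take_Suc_conv_app_nth)
  have "distinct (map ?f (take (Suc j) es))" using d by (simp add: take_map[symmetric])
  hence n: "{u, w} \<notin> set (map ?f (take j es))" unfolding t by auto
  thus "w \<notin> prefix_nbrs j u" "u \<notin> prefix_nbrs j w"
    by (simp_all only: prefix_nbrs_def mem_Collect_eq insert_commute not_False_eq_True)
  have "x \<in> prefix_nbrs (Suc j) v \<longleftrightarrow> {v, x} = {u, w} \<or> x \<in> prefix_nbrs j v" for v x
    unfolding prefix_nbrs_def t by simp
  thus "prefix_nbrs (Suc j) = (prefix_nbrs j)(u := insert w (prefix_nbrs j u), w := insert u (prefix_nbrs j w))"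
    using uw(3) by (intro ext set_eqI) (auto simp: doubleton_eq_iff)
qed

lemma add_edge:
  assumes "edge_inv R m k" "test_holds (Less 14 2) R"
  shows "awp add_edge (\<lambda>R' m'. \<exists>k'<k. edge_inv R' m' k') R m"
proof -
  note I = assms(1)[unfolded edge_inv_def]
  obtain j where j: "j \<le> length es" "R 14 = 2 + 2 * j" "k = length es - j" "rep n m {..<n} (prefix_nbrs j)"
    using I by blast
  have e: "env R m" and Rb: "R 2 = b" and R5: "R 5 = 1" using I by (auto simp: env_def)
  have jl: "j < length es" using assms(2) Rb b j(2) by simp
  obtain u w where uw: "es ! j = (u, w)" by fastforce
  note P = edge_props[OF jl uw]
  have in1: "m (Inp (2 + 2 * j)) = u" "m (Inp (Suc (Suc (Suc (2 * j))))) = w"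
    using I nth_input_words(3,4)[OF jl] uw by (simp_all add: init_mem_def numeral_3_eq_3)
  have W: "4 + 2 * j < W" "Suc (Suc (Suc (2 * j))) < b" "2 + 2 * j < b" "4 + 2 * j \<le> b" using jl b wide by auto
  let ?R = "R(15 := u, 14 := Suc (Suc (Suc (Suc (2 * j)))), 16 := w)"
  have eR: "env ?R m" using e by simp
  have "awp (append 15 16) (awp (append 16 15) (\<lambda>R' m'. \<exists>k'<k. edge_inv R' m' k')) ?R m"
  proof (rule awp_append[OF eR j(4)])
    fix R1 m1 assume 1: "frame ?R m R1 m1" "rep n m1 {..<n} ((prefix_nbrs j)(?R 15 := insert (?R 16) (prefix_nbrs j (?R 15))))"
    have rg: "R1 15 = u" "R1 16 = w" using 1(1) by (simp_all add: frame_def)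
    have rep1: "rep n m1 {..<n} ((prefix_nbrs j)(u := insert w (prefix_nbrs j u)))" using 1(2) by simp
    show "awp (append 16 15) (\<lambda>R' m'. \<exists>k'<k. edge_inv R' m' k') R1 m1"
    proof (rule awp_append[OF frame_env[OF 1(1) eR] rep1])
      fix R2 m2 assume 2: "frame R1 m1 R2 m2" "rep n m2 {..<n} (((prefix_nbrs j)(u := insert w (prefix_nbrs j u)))
         (R1 16 := insert (R1 15) (((prefix_nbrs j)(u := insert w (prefix_nbrs j u))) (R1 16))))"
      have fr: "frame ?R m R2 m2" by (rule frame_trans[OF 1(1) 2(1)])
      have "rep n m2 {..<n} (prefix_nbrs (Suc j))" using 2(2) P(3) unfolding rg P(6) by simp
      moreover have "env R2 m2" by (rule frame_env[OF fr eR])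
      moreover have "stk R2 m2 = stk R m" using fr by (simp add: stk_def frame_def)
      ultimately have "edge_inv R2 m2 (length es - Suc j)"
        using I fr jl unfolding edge_inv_def by (auto simp: frame_def intro!: exI[of _ "Suc j"])
      thus "\<exists>k'<k. edge_inv R2 m2 k'" using jl j(3) by (intro exI[of _ "length es - Suc j"]) simp
    qed (use rg P in auto)
  qed (use P in auto)
  moreover have "R(15 := u, 14 := Suc (Suc (Suc (2 * j))), 16 := w, 14 := Suc (Suc (Suc (Suc (2 * j))))) = ?R" by (simp add: fun_upd_twist)
  moreover have "awp (Load 15 14) Q R m = Q (R(15 := u)) m" for Q
    using load_iff[of "Inp (2 + 2 * j)" R 14 15 Q m] in1 W j(2) by simp
  moreover have "awp (Load 16 14) Q (R(15 := u, 14 := Suc (Suc (Suc (2 * j))))) m = Q (R(15 := u, 14 := Suc (Suc (Suc (2 * j))), 16 := w)) m" for Q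
    using load_iff[of "Inp (Suc (Suc (Suc (2 * j))))" "R(15 := u, 14 := Suc (Suc (Suc (2 * j))))" 14 16 Q m] in1 W by simp
  ultimately show ?thesis
    unfolding add_edge_def awp.simps(8) using W R5 j(2) by (simp add: awp.simps(4))
qed

definition process_inv where
  "process_inv R m k \<longleftrightarrow> covered (D3_reducible G) R m \<and> k = 13 * R 9 + R 8"

text \<open>\<open>14 * n\<close> is the initial potential: 13 per vertex and one stack entry per
  vertex.\<close>

lemma edges_done:
  assumes "edge_inv R m k" "\<not> test_holds (Less 14 2) R"
  shows "process_inv R m (14 * n)"
proof -
  note I = assms(1)[unfolded edge_inv_def]
  obtain j where j: "j \<le> length es" "R 14 = 2 + 2 * j" "rep n m {..<n} (prefix_nbrs j)"
    using I by blast
  have "R 2 = b" using I by (simp add: env_def)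
  hence jl: "j = length es" using assms(2) j b by simp
  have "prefix_nbrs j = nbrs G" using G(3) unfolding jl by (auto simp: prefix_nbrs_def nbrs_def adj_def edge_list_def fun_eq_iff)
  moreover have "ugraph_of ({..<n}, nbrs G) = G" "wf_ngraph ({..<n}, nbrs G)"
    using ugraph_of_nbrs[OF G(1)] G(2) by simp_all
  ultimately have "sound_state (D3_reducible G) R m {..<n} (nbrs G)"
    using I j by (simp add: sound_state_def)
  thus ?thesis using I unfolding process_inv_def covered_def by fastforce
qed

lemma process:
  assumes "process_inv R m k" "test_holds (Less 7 8) R"
  shows "awp process (\<lambda>R' m'. \<exists>k'<k. process_inv R' m' k') R m"
proof -
  have c: "covered (D3_reducible G) R m" "k = 13 * R 9 + R 8" using assms(1) by (auto simp: process_inv_def)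
  have "R 7 = 0" using c by (auto simp: covered_def sound_state_def env_def)
  hence "0 < R 8" using assms(2) by simp
  from awp_process[OF c(1) this] show ?thesis
    by (rule awp_mono) (simp add: process_inv_def c(2))
qed

definition count_inv where
  "count_inv R m k \<longleftrightarrow> R 14 \<le> n \<and> k = n - R 14 \<and> (\<exists>V N. env R m \<and> rep n m V N \<and> R 9 = card V \<and>
     R 15 = card {v. v < R 14 \<and> v \<in> V \<and> card (N v) = 3} \<and>
     (D3_reducible G \<longleftrightarrow> card V = 4 \<and> card {v \<in> V. card (N v) = 3} = 4))"

lemma process_done:
  assumes "process_inv R m k" "\<not> test_holds (Less 7 8) R"
  shows "awp (Seq (Const 14 0) (Const 15 0)) (\<lambda>R m. count_inv R m n) R m"
proof -
  obtain V N where S: "sound_state (D3_reducible G) R m V N" "\<forall>x\<in>V. anchor N x \<longrightarrow> x \<in> stk R m"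
    using assms(1) unfolding process_inv_def covered_def by blast
  have s: "env R m" "rep n m V N" "wf_ngraph (V, N)" "R 9 = card V" "D3_reducible (ugraph_of (V, N)) \<longleftrightarrow> D3_reducible G"
    using S(1) by (simp_all add: sound_state_def)
  have "R 8 = 0" using assms(2) s(1) by (simp add: env_def)
  \<comment> \<open>The empty stack contains every anchor, so the graph has none.\<close>
  hence "\<forall>v\<in>V. \<not> anchor N v" using S(2) by (simp add: stk_def)
  hence "D3_reducible G \<longleftrightarrow> card V = 4 \<and> card {v \<in> V. card (N v) = 3} = 4"
    using reducible_irreducible[OF s(3)] s(5) by simp
  hence "count_inv (R(14 := 0, 15 := 0)) m n"
    unfolding count_inv_def using s by (intro conjI exI[of _ V] exI[of _ N]) simp_all
  thus ?thesis using wide by (simp add: awp.simps)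
qed

lemma count_cubic:
  assumes "count_inv R m k" "test_holds (Less 14 1) R"
  shows "awp count_cubic (\<lambda>R' m'. \<exists>k'<k. count_inv R' m' k') R m"
proof -
  obtain V N where I: "R 14 \<le> n" "k = n - R 14" "env R m" "rep n m V N" "R 9 = card V"
     "R 15 = card {v. v < R 14 \<and> v \<in> V \<and> card (N v) = 3}"
     "D3_reducible G \<longleftrightarrow> card V = 4 \<and> card {v \<in> V. card (N v) = 3} = 4"
    using assms(1) unfolding count_inv_def by blast
  have c: "R 1 = n" "R 5 = 1" "R 6 = 3" using I(3) by (auto simp: env_def)
  have lt: "R 14 < n" using assms(2) c by simp
  let ?A = "\<lambda>i. {v. v < i \<and> v \<in> V \<and> card (N v) = 3}"
  have A: "?A (Suc i) = (if i \<in> V \<and> card (N i) = 3 then insert i (?A i) else ?A i)" for i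
    by (auto simp: less_Suc_eq)
  have cA: "card (?A (Suc (R 14))) = (if m (Deg (R 14)) = 3 then Suc (R 15) else R 15)"
    unfolding A using rep_deg3[OF I(4) lt] I(6) by simp
  have le: "R 15 \<le> n"
  proof -
    have "card (?A (R 14)) \<le> card {..<n}" using lt by (intro card_mono) auto
    thus ?thesis using I(6) by simp
  qed
  let ?R = "R(11 := m (Deg (R 14)), 15 := card (?A (Suc (R 14))), 14 := Suc (R 14))"
  have "count_inv ?R m (n - Suc (R 14))"
    unfolding count_inv_def using I lt by (intro conjI exI[of _ V] exI[of _ N]) simp_all
  hence *: "\<exists>k'<k. count_inv ?R m k'" using I(2) lt by (intro exI[of _ "n - Suc (R 14)"]) simp
  show ?thesis
  proof (cases "m (Deg (R 14)) = 3")
    case True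
    have "?R = R(11 := 3, 15 := Suc (R 15), 14 := Suc (R 14))" using cA True by simp
    thus ?thesis using * c I(3) lt le wide True
      unfolding count_cubic_def by (simp add: exec_simps awp.simps(4))
  next
    case False
    have "?R = R(11 := m (Deg (R 14)), 14 := Suc (R 14))"
      using cA False by (auto simp: fun_eq_iff)
    thus ?thesis using * c I(3) lt le wide False
      unfolding count_cubic_def by (simp add: exec_simps awp.simps(4))
  qed
qed

lemma count_done:
  assumes "count_inv R m k" "\<not> test_holds (Less 14 1) R"
  shows "awp answer (\<lambda>R m. R 0 = (if D3_reducible G then 1 else 0)) R m"
proof -
  obtain V N where I: "R 14 \<le> n" "env R m" "rep n m V N" "R 9 = card V"
     "R 15 = card {v. v < R 14 \<and> v \<in> V \<and> card (N v) = 3}"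
     "D3_reducible G \<longleftrightarrow> card V = 4 \<and> card {v \<in> V. card (N v) = 3} = 4"
    using assms(1) unfolding count_inv_def by blast
  have "R 14 = n" using I(1,2) assms(2) by (simp add: env_def)
  hence "{v. v < R 14 \<and> v \<in> V \<and> card (N v) = 3} = {v \<in> V. card (N v) = 3}"
    using I(3) by (auto simp: rep_def)
  hence "R 15 = card {v \<in> V. card (N v) = 3}" using I(5) by simp
  thus ?thesis unfolding answer_def using I(4,6) wide by (simp add: exec_simps)
qed

definition time_bound :: nat where
  "time_bound = cost read_sizes + (1 + (1 + cost set_row) * n + (1 + (1 + (1 + cost (push 8)) * n + (2 +
     (1 + (1 + cost add_edge) * length es + (1 + (1 + cost process) * (14 * n) + (2 +
     (1 + (1 + cost count_cubic) * n + cost answer))))))))"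

text \<open>Assembled from the end of the program backwards: each phase only has to establish the
  invariant that starts the next.\<close>

lemma recognizer_correct:
  "ewp recognizer time_bound (\<lambda>R m. R 0 = (if D3_reducible G then 1 else 0)) (\<lambda>_. 0) init_mem"
proof -
  let ?Q = "\<lambda>R m. R 0 = (if D3_reducible G then 1 else 0)"
  let ?P9 = "Seq (While (Less 14 1) count_cubic) answer" 
  let ?T9 = "1 + (1 + cost count_cubic) * n + cost answer"
  have 9: "ewp ?P9 ?T9 ?Q R m" if "count_inv R m n" for R m
    by (rule ewp_Seq[OF ewp_While[where I = count_inv, OF count_cubic that] _ order_refl])
      (blast intro: ewp_awp count_done)+
  let ?P8 = "Seq (Seq (Const 14 0) (Const 15 0)) ?P9" and ?T8 = "2 + ?T9"
  have 8: "ewp ?P8 ?T8 ?Q R m" if "process_inv R m k" "\<not> test_holds (Less 7 8) R" for R m k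
    by (rule ewp_Seq[OF ewp_awp[OF process_done[OF that]] 9]) simp_all
  let ?P7 = "Seq (While (Less 7 8) process) ?P8" and ?T7 = "1 + (1 + cost process) * (14 * n) + ?T8"
  have 7: "ewp ?P7 ?T7 ?Q R m" if "process_inv R m (14 * n)" for R m
    by (rule ewp_Seq[OF ewp_While[where I = process_inv, OF process that] _ order_refl]) (blast intro: 8)+
  let ?P6 = "Seq (While (Less 14 2) add_edge) ?P7" and ?T6 = "1 + (1 + cost add_edge) * length es + ?T7"
  have 6: "ewp ?P6 ?T6 ?Q R m" if "edge_inv R m (length es)" for R m
    by (rule ewp_Seq[OF ewp_While[where I = edge_inv, OF add_edge that] _ order_refl]) (blast intro: 7 edges_done)+
  let ?P5 = "Seq (Seq (Copy 9 1) (Const 14 2)) ?P6" and ?T5 = "2 + ?T6"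
  have 5: "ewp ?P5 ?T5 ?Q R m" if "push_inv R m k" "\<not> test_holds (Less 8 1) R" for R m k
    by (rule ewp_Seq[OF ewp_awp[OF push_done[OF that]] 6]) simp_all
  let ?P4 = "Seq (While (Less 8 1) (push 8)) ?P5" and ?T4 = "1 + (1 + cost (push 8)) * n + ?T5"
  have 4: "ewp ?P4 ?T4 ?Q R m" if "push_inv R m n" for R m
    by (rule ewp_Seq[OF ewp_While[where I = push_inv, OF push_init that] _ order_refl]) (blast intro: 5)+
  let ?P3 = "Seq (Copy 4 12) ?P4" and ?T3 = "1 + ?T4"
  have 3: "ewp ?P3 ?T3 ?Q R m" if "rows_inv R m k" "\<not> test_holds (Less 14 1) R" for R m k
    by (rule ewp_Seq[OF ewp_awp[OF rows_done[OF that]] 4]) simp_all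
  let ?P2 = "Seq (While (Less 14 1) set_row) ?P3" and ?T2 = "1 + (1 + cost set_row) * n + ?T3"
  have 2: "ewp ?P2 ?T2 ?Q R m" if "rows_inv R m n" for R m
    by (rule ewp_Seq[OF ewp_While[where I = rows_inv, OF set_row that] _ order_refl]) (blast intro: 3)+
  show ?thesis unfolding recognizer_def time_bound_def
    by (rule ewp_Seq[OF read_sizes 2 order_refl])
qed

end

text \<open>30 covers both the 10 units spent once outside \<open>read_sizes\<close> and
  \<open>answer\<close> and the 17 loop tests charged per vertex, 14 of them for
  \<open>process\<close>.\<close>

definition time_factor :: nat where
  "time_factor = cost read_sizes + cost answer + cost set_row + cost (push 8) + cost add_edge +
     14 * cost process + cost count_cubic + 30"

theorem theorem4:
  shows "\<exists>P. decides_in_linear_time P D3_reducible"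
  unfolding decides_in_linear_time_def
proof (rule exI[of _ recognizer], rule exI[of _ time_factor], rule exI[of _ 7], intro allI impI)
  fix G :: "nat ugraph" and n es
  assume G: "simple_graph G \<and> verts G = {..<n} \<and> edge_list G es"
  define X where "X = graph_size G + 2"
  have size: "graph_size G = n + length es"
  proof -
    have "distinct (map (\<lambda>(u, v). {u, v}) es)" "set (map (\<lambda>(u, v). {u, v}) es) = edges G"
      using G by (simp_all add: edge_list_def)
    hence "card (edges G) = length (map (\<lambda>(u, v). {u, v}) es)" using distinct_card by metis
    thus ?thesis using G by (simp add: graph_size_def)
  qed
  have "(2 * length es + 2) + 2 * n + 2 * n * n + 20 * n + 20 < X ^ 7"
  proof -
    have X: "2 \<le> X" "n \<le> X" "2 * length es + 2 \<le> 2 * X" by (simp_all add: X_def size)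
    have "2 * n * n \<le> 2 * X * X" using X(2) by (intro mult_le_mono) simp_all
    moreover have XX: "2 * X \<le> X * X" using X(1) by simp
    moreover have "4 \<le> X * X" using mult_le_mono[OF X(1) X(1)] by simp
    \<comment> \<open>\<open>24 * X\<close> is at most \<open>12 * (X * X)\<close> and 20 is at most
      \<open>5 * (X * X)\<close>, which gives 19 with the quadratic table. As 19 is below 32 and
      \<open>2 ^ 5\<close> is at most \<open>X ^ 5\<close>, five more powers of \<open>X\<close>
      absorb the factor; this is the origin of the exponent 7.\<close>
    ultimately have "(2 * length es + 2) + 2 * n + 2 * n * n + 20 * n + 20 \<le> 19 * (X * X)" using X by linarith
    also have "\<dots> < 32 * (X * X)" using X(1) by simp
    also have "\<dots> \<le> X ^ 5 * (X * X)" using power_mono[OF X(1), of 5] by (intro mult_le_mono1) simp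
    also have "\<dots> = X ^ 7" by (simp add: power_numeral_reduce)
    finally show ?thesis .
  qed
  then interpret graph_input n "2 * length es + 2" "X ^ 7" G es
    using G by unfold_locales simp_all
  have "time_bound \<le> time_factor * (graph_size G + 1)"
  proof -
    have "time_bound \<le> time_factor + (time_factor * n + time_factor * length es)"
    proof -
      have "(2 + cost add_edge) * length es \<le> time_factor * length es"
        by (intro mult_le_mono1) (simp add: time_factor_def)
      moreover have "((1 + cost set_row) + (1 + cost (push 8)) + (1 + cost process) * 14 + (1 + cost count_cubic)) * n \<le> time_factor * n"
        by (intro mult_le_mono1) (simp add: time_factor_def)
      moreover have "cost read_sizes + cost answer + 10 \<le> time_factor" by (simp add: time_factor_def)
      ultimately show ?thesis unfolding time_bound_def by (simp add: algebra_simps)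
    qed
    thus ?thesis by (simp add: size algebra_simps)
  qed
  moreover obtain t R M where "exec (X ^ 7) recognizer (\<lambda>_. 0, snd (initial_state (input_words n es))) t (R, M)"
    "t \<le> time_bound" "R 0 = (if D3_reducible G then 1 else 0)"
    using recognizer_correct mrel_init unfolding ewp_def by blast
  moreover have "(\<lambda>_. 0, snd (initial_state (input_words n es))) = initial_state (input_words n es)"
    by (simp add: initial_state_def)
  ultimately show "\<exists>t R M. exec ((graph_size G + 2) ^ 7) recognizer (initial_state (input_words n es)) t (R, M) \<and>
      t \<le> time_factor * (graph_size G + 1) \<and> R 0 = (if D3_reducible G then 1 else 0)"
    unfolding X_def by (metis le_trans)
qed

end
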